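(* Let $n\in\mathbb{C}$ and $k\in\frac12\mathbb{Z}$ with $k\ge 1$. The map $$\mathbb{C}A_{k-\frac12}(n)\otimes_{\mathbb{C}A_{k-1}(n)}\mathbb{C}A_{k-\frac12}(n)\longrightarrow \mathbb{C}I_k(n),\qquad b_1\otimes b_2\longmapsto b_1p_kb_2,$$ is an isomorphism of algebras (not necessarily with identity), where the left-hand side is the basic construction algebra with product $$(c_1\otimes c_2)(c_3\otimes c_4)=c_1\otimes\varepsilon(c_2c_3)c_4,$$ with $\varepsilon=\varepsilon^{\frac12}:\mathbb{C}A_{k-\frac12}(n)\to\mathbb{C}A_{k-1}(n)$ if $k$ is an integer, and $\varepsilon=\varepsilon_{\frac12}:\mathbb{C}A_{k-\frac12}(n)\to\mathbb{C}A_{k-1}(n)$ if $k$ is not an integer.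
   Context: For an integer $m\ge0$, $A_m$ is the set of set partitions of $\{1,\ldots,m,1',\ldots,m'\}$ ($A_0$ has one element), and $A_{m+\frac12}$ is the set of $d\in A_{m+1}$ in which $m+1$ and $(m+1)'$ are in the same block. The composition $d_1\circ d_2$ is obtained by placing $d_1$ above $d_2$ (top row $1,\ldots,m$, bottom row $1',\ldots,m'$), identifying bottom vertex $i'$ of $d_1$ with top vertex $i$ of $d_2$, and removing the connected components lying entirely in the middle row. For $n\in\mathbb{C}$ and $k\in\frac12\mathbb{Z}_{\ge0}$ the partition algebra $\mathbb{C}A_k(n)$ has basis $A_k$ and product $d_1d_2=n^{\ell}(d_1\circ d_2)$, where $\ell$ is the number of components removed. There are inclusions $\mathbb{C}A_{m-\frac12}(n)\subseteq\mathbb{C}A_m(n)$ (since $A_{m-\frac12}\subseteq A_m$) and $\mathbb{C}A_{m-1}(n)\subseteq\mathbb{C}A_{m-\frac12}(n)$ (add the block $\{m,m'\}$). The propagating number $pn(d)$ is the number of blocks of $d$ containing both unprimed and primed elements (for $d\in A_{m+\frac12}$ it is computed in $A_{m+1}$). $\mathbb{C}I_k(n)$ is the ideal of $\mathbb{C}A_k(n)$ spanned by $I_k=\{d\in A_k: pn(d)<k\}$. For an integer $m\ge1$ define linear maps: $\varepsilon_{\frac12}:\mathbb{C}A_m(n)\to\mathbb{C}A_{m-\frac12}(n)$ sends $d$ to the partition obtained by merging the block containing $m$ and the block containing $m'$; $\varepsilon^{\frac12}:\mathbb{C}A_{m-\frac12}(n)\to\mathbb{C}A_{m-1}(n)$ sends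 $d$ to the partition obtained by deleting $m$ and $m'$, multiplied by $n$ if this deletion reduces the number of blocks (i.e. if $\{m,m'\}$ is a block of $d$). These are bimodule maps over the target algebra. For an integer $k\ge1$, $p_k\in A_k$ has blocks $\{k\},\{k'\}$ and $\{i,i'\}$ for $i<k$. For $k=m+\frac12$ with $m\ge1$ an integer, $p_k\in A_{m+\frac12}\subseteq A_{m+1}$ has blocks $\{m,m+1,m',(m+1)'\}$ and $\{i,i'\}$ for $i<m$. *)

theory Defs
  imports Complex_Main "HOL-Library.Poly_Mapping" "HOL-Library.Disjoint_Sets"
begin

section \<open>Formal complex linear combinations\<close>

text \<open>
  The complex vector space with basis a set \<open>S\<close> is the set of all
  \<open>x :: 'a \<Rightarrow>\<^sub>0 complex\<close> with \<open>Poly_Mapping.keys x \<subseteq> S\<close>.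
\<close>

definition cscale :: "complex \<Rightarrow> ('a \<Rightarrow>\<^sub>0 complex) \<Rightarrow> ('a \<Rightarrow>\<^sub>0 complex)" where
  "cscale c x = Poly_Mapping.map ((*) c) x"

lemma lookup_cscale [simp]:
  "Poly_Mapping.lookup (cscale c x) u = c * Poly_Mapping.lookup x u"
  by (simp add: cscale_def Poly_Mapping.map.rep_eq when_def)

interpretation fcomb: vector_space "cscale :: complex \<Rightarrow> ('a \<Rightarrow>\<^sub>0 complex) \<Rightarrow> ('a \<Rightarrow>\<^sub>0 complex)"
  by unfold_locales (auto intro!: poly_mapping_eqI simp: lookup_add algebra_simps)

definition free_space :: "'a set \<Rightarrow> ('a \<Rightarrow>\<^sub>0 complex) set" where
  "free_space S = {x. Poly_Mapping.keys x \<subseteq> S}"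

definition basis :: "'a \<Rightarrow> ('a \<Rightarrow>\<^sub>0 complex)" where
  "basis u = Poly_Mapping.single u 1"

definition lin_ext :: "('a \<Rightarrow> ('b \<Rightarrow>\<^sub>0 complex)) \<Rightarrow> ('a \<Rightarrow>\<^sub>0 complex) \<Rightarrow> ('b \<Rightarrow>\<^sub>0 complex)" where
  "lin_ext h x = (\<Sum>u\<in>Poly_Mapping.keys x. cscale (Poly_Mapping.lookup x u) (h u))"

definition bilin_ext ::
  "('a \<Rightarrow> 'b \<Rightarrow> ('c \<Rightarrow>\<^sub>0 complex)) \<Rightarrow> ('a \<Rightarrow>\<^sub>0 complex) \<Rightarrow> ('b \<Rightarrow>\<^sub>0 complex) \<Rightarrow> ('c \<Rightarrow>\<^sub>0 complex)" where
  "bilin_ext h x y = lin_ext (\<lambda>u. lin_ext (\<lambda>v. h u v) y) x"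


section \<open>Associative complex algebras, not necessarily with identity\<close>

record 'a alg =
  carr :: "'a set"
  vadd :: "'a \<Rightarrow> 'a \<Rightarrow> 'a"
  vzero :: 'a
  vscale :: "complex \<Rightarrow> 'a \<Rightarrow> 'a"
  vmult :: "'a \<Rightarrow> 'a \<Rightarrow> 'a"

locale complex_algebra =
  fixes A :: "'a alg"
  assumes add_closed: "\<lbrakk>x \<in> carr A; y \<in> carr A\<rbrakk> \<Longrightarrow> vadd A x y \<in> carr A"
    and zero_closed: "vzero A \<in> carr A"
    and scale_closed: "x \<in> carr A \<Longrightarrow> vscale A c x \<in> carr A"
    and mult_closed: "\<lbrakk>x \<in> carr A; y \<in> carr A\<rbrakk> \<Longrightarrow> vmult A x y \<in> carr A"
    and add_assoc: "\<lbrakk>x \<in> carr A; y \<in> carr A; z \<in> carr A\<rbrakk>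
          \<Longrightarrow> vadd A (vadd A x y) z = vadd A x (vadd A y z)"
    and add_comm: "\<lbrakk>x \<in> carr A; y \<in> carr A\<rbrakk> \<Longrightarrow> vadd A x y = vadd A y x"
    and add_zero: "x \<in> carr A \<Longrightarrow> vadd A x (vzero A) = x"
    and add_inverse: "x \<in> carr A \<Longrightarrow> \<exists>y\<in>carr A. vadd A x y = vzero A"
    and scale_add_right: "\<lbrakk>x \<in> carr A; y \<in> carr A\<rbrakk>
          \<Longrightarrow> vscale A c (vadd A x y) = vadd A (vscale A c x) (vscale A c y)"
    and scale_add_left: "x \<in> carr A
          \<Longrightarrow> vscale A (c + c') x = vadd A (vscale A c x) (vscale A c' x)"
    and scale_scale: "x \<in> carr A \<Longrightarrow> vscale A c (vscale A c' x) = vscale A (c * c') x"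
    and scale_one: "x \<in> carr A \<Longrightarrow> vscale A 1 x = x"
    and mult_assoc: "\<lbrakk>x \<in> carr A; y \<in> carr A; z \<in> carr A\<rbrakk>
          \<Longrightarrow> vmult A (vmult A x y) z = vmult A x (vmult A y z)"
    and mult_add_left: "\<lbrakk>x \<in> carr A; y \<in> carr A; z \<in> carr A\<rbrakk>
          \<Longrightarrow> vmult A (vadd A x y) z = vadd A (vmult A x z) (vmult A y z)"
    and mult_add_right: "\<lbrakk>x \<in> carr A; y \<in> carr A; z \<in> carr A\<rbrakk>
          \<Longrightarrow> vmult A x (vadd A y z) = vadd A (vmult A x y) (vmult A x z)"
    and mult_scale_left: "\<lbrakk>x \<in> carr A; y \<in> carr A\<rbrakk>
          \<Longrightarrow> vmult A (vscale A c x) y = vscale A c (vmult A x y)"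
    and mult_scale_right: "\<lbrakk>x \<in> carr A; y \<in> carr A\<rbrakk>
          \<Longrightarrow> vmult A x (vscale A c y) = vscale A c (vmult A x y)"

definition alg_iso :: "'a alg \<Rightarrow> 'b alg \<Rightarrow> ('a \<Rightarrow> 'b) \<Rightarrow> bool" where
  "alg_iso A B f \<longleftrightarrow>
     bij_betw f (carr A) (carr B) \<and>
     (\<forall>x\<in>carr A. \<forall>y\<in>carr A. f (vadd A x y) = vadd B (f x) (f y)) \<and>
     (\<forall>c. \<forall>x\<in>carr A. f (vscale A c x) = vscale B c (f x)) \<and>
     (\<forall>x\<in>carr A. \<forall>y\<in>carr A. f (vmult A x y) = vmult B (f x) (f y))"


section \<open>Tensor product over a complex algebra\<close>

text \<open>
  \<open>M\<close> is a right module and \<open>N\<close> a left module over an algebra with carrier \<open>R\<close>, with actions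
  \<open>ra\<close> and \<open>la\<close>; all three are subspaces of types of formal combinations. The tensor product is
  the free complex vector space on \<open>M \<times> N\<close> modulo the span of \<open>tensor_rels\<close>, and its elements
  are the classes of \<open>tensor_eq\<close>.
\<close>

definition tensor_rels ::
  "('a \<Rightarrow>\<^sub>0 complex) set \<Rightarrow> ('b \<Rightarrow>\<^sub>0 complex) set \<Rightarrow> 'r set \<Rightarrow>
   (('a \<Rightarrow>\<^sub>0 complex) \<Rightarrow> 'r \<Rightarrow> ('a \<Rightarrow>\<^sub>0 complex)) \<Rightarrow> ('r \<Rightarrow> ('b \<Rightarrow>\<^sub>0 complex) \<Rightarrow> ('b \<Rightarrow>\<^sub>0 complex)) \<Rightarrow>
   ((('a \<Rightarrow>\<^sub>0 complex) \<times> ('b \<Rightarrow>\<^sub>0 complex)) \<Rightarrow>\<^sub>0 complex) set" where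
  "tensor_rels M N R ra la =
     {basis (x + x', y) - basis (x, y) - basis (x', y) | x x' y. x \<in> M \<and> x' \<in> M \<and> y \<in> N} \<union>
     {basis (x, y + y') - basis (x, y) - basis (x, y') | x y y'. x \<in> M \<and> y \<in> N \<and> y' \<in> N} \<union>
     {basis (cscale c x, y) - cscale c (basis (x, y)) | c x y. x \<in> M \<and> y \<in> N} \<union>
     {basis (x, cscale c y) - cscale c (basis (x, y)) | c x y. x \<in> M \<and> y \<in> N} \<union>
     {basis (ra x r, y) - basis (x, la r y) | x r y. x \<in> M \<and> r \<in> R \<and> y \<in> N}"

definition tensor_eq ::
  "('a \<Rightarrow>\<^sub>0 complex) set \<Rightarrow> ('b \<Rightarrow>\<^sub>0 complex) set \<Rightarrow> 'r set \<Rightarrow>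
   (('a \<Rightarrow>\<^sub>0 complex) \<Rightarrow> 'r \<Rightarrow> ('a \<Rightarrow>\<^sub>0 complex)) \<Rightarrow> ('r \<Rightarrow> ('b \<Rightarrow>\<^sub>0 complex) \<Rightarrow> ('b \<Rightarrow>\<^sub>0 complex)) \<Rightarrow>
   ((('a \<Rightarrow>\<^sub>0 complex) \<times> ('b \<Rightarrow>\<^sub>0 complex)) \<Rightarrow>\<^sub>0 complex) rel" where
  "tensor_eq M N R ra la =
     {(s, t). s \<in> free_space (M \<times> N) \<and> t \<in> free_space (M \<times> N) \<and>
              s - t \<in> fcomb.span (tensor_rels M N R ra la)}"


section \<open>Partition diagrams\<close>

text \<open>
  The vertex \<open>(0, i)\<close> is \<open>i\<close> in the top row and \<open>(1, i)\<close> is \<open>i'\<close> in the bottom row.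
\<close>

type_synonym vertex = "nat \<times> nat"
type_synonym diagram = "vertex set set"

definition vertices :: "nat \<Rightarrow> vertex set" where
  "vertices m = {0, 1} \<times> {1..m}"

definition vpair :: "nat \<Rightarrow> vertex set" where
  "vpair i = {(0, i), (1, i)}"

text \<open>For \<open>k = m + 1/2\<close> the number of columns is \<open>m + 1 = \<lceil>k\<rceil>\<close>.\<close>

definition diagrams :: "real \<Rightarrow> diagram set" where
  "diagrams k = {d. partition_on (vertices (nat \<lceil>k\<rceil>)) d \<and>
                    (k \<notin> \<int> \<longrightarrow> (\<exists>B\<in>d. vpair (nat \<lceil>k\<rceil>) \<subseteq> B))}"

text \<open>
  The stack of \<open>d1\<close> above \<open>d2\<close> has the rows 0, 1, 2: shifting \<open>d2\<close> down by one row identifies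
  its top row with the bottom row of \<open>d1\<close>.
\<close>

definition stack_blocks :: "diagram \<Rightarrow> diagram \<Rightarrow> vertex set set" where
  "stack_blocks d1 d2 = d1 \<union> (`) (\<lambda>(r, i). (Suc r, i)) ` d2"

definition components :: "diagram \<Rightarrow> diagram \<Rightarrow> vertex set set" where
  "components d1 d2 =
     \<Union>(stack_blocks d1 d2) // (\<Union>B\<in>stack_blocks d1 d2. B \<times> B)\<^sup>+"

definition middle_row :: "vertex set" where
  "middle_row = {1} \<times> UNIV"

definition removed :: "diagram \<Rightarrow> diagram \<Rightarrow> nat" where
  "removed d1 d2 = card {C \<in> components d1 d2. C \<subseteq> middle_row}"

definition diag_comp :: "diagram \<Rightarrow> diagram \<Rightarrow> diagram" where
  "diag_comp d1 d2 =
     {(\<lambda>(r, i). (if r = 2 then 1 else r, i)) ` (C - middle_row) | C.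
        C \<in> components d1 d2 \<and> \<not> C \<subseteq> middle_row}"

definition pn :: "diagram \<Rightarrow> nat" where
  "pn d = card {B \<in> d. (\<exists>i. (0, i) \<in> B) \<and> (\<exists>j. (1, j) \<in> B)}"

definition ideal_diagrams :: "real \<Rightarrow> diagram set" where
  "ideal_diagrams k = {d \<in> diagrams k. real (pn d) < k}"

definition p_diag :: "real \<Rightarrow> diagram" where
  "p_diag k =
     (if k \<in> \<int> then {{(0, nat \<lfloor>k\<rfloor>)}, {(1, nat \<lfloor>k\<rfloor>)}}
      else {vpair (nat \<lfloor>k\<rfloor>) \<union> vpair (nat \<lfloor>k\<rfloor> + 1)})
     \<union> vpair ` {1..<nat \<lfloor>k\<rfloor>}"


section \<open>Partition algebras\<close>

type_synonym comb = "diagram \<Rightarrow>\<^sub>0 complex"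

definition pmult :: "complex \<Rightarrow> comb \<Rightarrow> comb \<Rightarrow> comb" where
  "pmult n = bilin_ext (\<lambda>d1 d2. cscale (n ^ removed d1 d2) (basis (diag_comp d1 d2)))"

definition partition_algebra :: "complex \<Rightarrow> real \<Rightarrow> comb alg" where
  "partition_algebra n k =
     \<lparr>carr = free_space (diagrams k), vadd = (+), vzero = 0, vscale = cscale, vmult = pmult n\<rparr>"

definition partition_ideal :: "complex \<Rightarrow> real \<Rightarrow> comb alg" where
  "partition_ideal n k = (partition_algebra n k)\<lparr>carr := free_space (ideal_diagrams k)\<rparr>"

text \<open>
  The inclusion of the algebra with index \<open>k - 1/2\<close> into the one with index \<open>k\<close>: for \<open>k = m\<close> the
  diagrams on both sides have \<open>m\<close> columns, for \<open>k = m + 1/2\<close> the block on column \<open>m + 1\<close> is added.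
\<close>

definition incl :: "real \<Rightarrow> comb \<Rightarrow> comb" where
  "incl k = lin_ext (\<lambda>d. basis (if k \<in> \<int> then d else insert (vpair (nat \<lceil>k\<rceil>)) d))"

definition eps_lower_half :: "nat \<Rightarrow> comb \<Rightarrow> comb" where
  "eps_lower_half m =
     lin_ext (\<lambda>d. basis ({B \<in> d. B \<inter> vpair m = {}} \<union> {\<Union>{B \<in> d. B \<inter> vpair m \<noteq> {}}}))"

definition eps_upper_half :: "complex \<Rightarrow> nat \<Rightarrow> comb \<Rightarrow> comb" where
  "eps_upper_half n m =
     lin_ext (\<lambda>d. let d' = (\<lambda>B. B - vpair m) ` d - {{}}
                  in cscale (if card d' < card d then n else 1) (basis d'))"

definition eps :: "complex \<Rightarrow> real \<Rightarrow> comb \<Rightarrow> comb" where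
  "eps n k = (if k \<in> \<int> then eps_upper_half n (nat \<lfloor>k\<rfloor>) else eps_lower_half (nat \<lfloor>k\<rfloor>))"


section \<open>The basic construction\<close>

definition bc_eq :: "complex \<Rightarrow> real \<Rightarrow> ((comb \<times> comb) \<Rightarrow>\<^sub>0 complex) rel" where
  "bc_eq n k =
     tensor_eq (carr (partition_algebra n (k - 1/2))) (carr (partition_algebra n (k - 1/2)))
       (carr (partition_algebra n (k - 1)))
       (\<lambda>b r. pmult n b (incl (k - 1/2) r)) (\<lambda>r b. pmult n (incl (k - 1/2) r) b)"

definition pure_tensor :: "complex \<Rightarrow> real \<Rightarrow> comb \<Rightarrow> comb \<Rightarrow> ((comb \<times> comb) \<Rightarrow>\<^sub>0 complex) set" where
  "pure_tensor n k b1 b2 = bc_eq n k `` {basis (b1, b2)}"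

text \<open>
  The operations on classes are those induced by the operations on representatives; the product
  of representatives is the bilinear extension of
  \<open>((c1, c2), (c3, c4)) \<mapsto> (c1, \<epsilon>(c2 c3) c4)\<close>.
\<close>

definition basic_construction :: "complex \<Rightarrow> real \<Rightarrow> ((comb \<times> comb) \<Rightarrow>\<^sub>0 complex) set alg" where
  "basic_construction n k =
     \<lparr>carr = free_space (carr (partition_algebra n (k - 1/2)) \<times>
                         carr (partition_algebra n (k - 1/2))) // bc_eq n k,
      vadd = (\<lambda>X Y. \<Union>s\<in>X. \<Union>t\<in>Y. bc_eq n k `` {s + t}),
      vzero = bc_eq n k `` {0},
      vscale = (\<lambda>c X. \<Union>s\<in>X. bc_eq n k `` {cscale c s}),
      vmult = (\<lambda>X Y. \<Union>s\<in>X. \<Union>t\<in>Y. bc_eq n k ``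
        {bilin_ext (\<lambda>(c1, c2) (c3, c4).
            basis (c1, pmult n (incl (k - 1/2) (eps n k (pmult n c2 c3))) c4)) s t})\<rparr>"

end

(* A diagram d on rows {1..a} and {1..b} is encoded by the zero-one matrix sat d P Q, indexed by
   subsets P, Q of the rows, that records whether P together with Q is a union of blocks. The matrix
   determines d, and the matrix product of d1 and d2 is 2 ^ removed times the matrix of the
   composite. This gives associativity, and it turns every identity between composites into a count
   of subsets of the middle row.

   Put M = N - 1, where N is the number of columns for index k. Then p_k factors through M points
   as proj followed by its flip, multiplication by proj identifies the left factor of the tensor
   product with the diagrams from N to M points, and proj' x proj = eps x (proj' the flip of proj).
   So b1 p_k b2 becomes composition through M points; its image is spanned by the diagrams with
   fewer than N propagating blocks, and it is multiplicative. For injectivity, a pure tensor of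
   diagrams is moved modulo the relations to a multiple of a factorization that depends only on the
   composite. All properties of the basic construction are then transported from the ideal. *)

theory Submission
  imports Defs
begin

section \<open>Composition of diagrams in terms of saturated sets\<close>

text \<open>The base 2 comes from the test objects: once its outer rows are fixed, a saturated set
  may still contain or omit each removed component, and nothing else is free. Comparing exponents of
  2 therefore recovers the number of removed components itself, which is the exponent of n for every
  n at once, n = 0 included.

  That n may be 0 is the main obstacle. For integral k the square of \<open>p_k\<close> is n times
  \<open>p_k\<close>, so \<open>p_k\<close> cannot in general be scaled to an idempotent, and a
  factor n ^ removed can never be cancelled. The auxiliary factorizations are therefore built
  without removed components: a point of the middle row that would be left alone is tied to a block
  that reaches an outer row. For M = 0, that is k = 1, there is no middle point to use; then the
  algebra of index k - 1/2 has a single basis diagram.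

  No basis of the tensor product is at hand, since the algebra of index k - 1 need not be
  semisimple. Injectivity is obtained from a linear section of the map to the ideal that inverts it
  modulo the tensor relations.\<close>

definition closed_under :: "'a set set \<Rightarrow> 'a set \<Rightarrow> bool" where
  "closed_under \<B> S \<longleftrightarrow> (\<forall>B\<in>\<B>. \<forall>u\<in>B. \<forall>v\<in>B. u \<in> S \<longleftrightarrow> v \<in> S)"

lemma closed_underD: "closed_under \<B> S \<Longrightarrow> B \<in> \<B> \<Longrightarrow> u \<in> B \<Longrightarrow> v \<in> B \<Longrightarrow> u \<in> S \<longleftrightarrow> v \<in> S"
  unfolding closed_under_def by blast

lemma closed_under_Un: "closed_under (A \<union> B) S \<longleftrightarrow> closed_under A S \<and> closed_under B S"
  unfolding closed_under_def by blast

lemma closed_under_cong: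
  assumes "\<And>B u. B \<in> \<B> \<Longrightarrow> u \<in> B \<Longrightarrow> u \<in> S \<longleftrightarrow> u \<in> T"
  shows "closed_under \<B> S \<longleftrightarrow> closed_under \<B> T"
  unfolding closed_under_def using assms by blast

text \<open>The transitive closure suffices, because the union of the squares of the blocks is
  already reflexive on the vertices and symmetric.\<close>

lemma equiv_generated: "equiv (\<Union>\<B>) ((\<Union>B\<in>\<B>. B \<times> B)\<^sup>+)"
proof -
  let ?E = "\<Union>B\<in>\<B>. B \<times> B"
  have "?E\<^sup>+ \<subseteq> (\<Union>\<B>) \<times> (\<Union>\<B>)"
    by (rule trancl_subset_Sigma) auto
  moreover have "refl_on (\<Union>\<B>) (?E\<^sup>+)"
    unfolding refl_on_def by blast
  moreover have "sym (?E\<^sup>+)"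
    by (rule sym_trancl) (auto simp: sym_def)
  ultimately show ?thesis
    by (auto simp: equiv_def)
qed

lemma partition_on_generated: "partition_on (\<Union>\<B>) (\<Union>\<B> // (\<Union>B\<in>\<B>. B \<times> B)\<^sup>+)"
  by (rule partition_on_quotient[OF equiv_generated])

text \<open>Membership in \<open>S\<close> is constant along each generating pair, hence along every
  chain of them. Saturation can thus be tested on the blocks of a stack, without describing its
  components.\<close>

lemma closed_under_generated:
  "closed_under (\<Union>\<B> // (\<Union>B\<in>\<B>. B \<times> B)\<^sup>+) S \<longleftrightarrow> closed_under \<B> S"
proof
  let ?E = "\<Union>B\<in>\<B>. B \<times> B"
  assume L: "closed_under (\<Union>\<B> // ?E\<^sup>+) S"
  show "closed_under \<B> S"
    unfolding closed_under_def
  proof (intro ballI)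
    fix B u v assume B: "B \<in> \<B>" "u \<in> B" "v \<in> B"
    then have "?E\<^sup>+ `` {u} \<in> \<Union>\<B> // ?E\<^sup>+" by (auto intro: quotientI)
    moreover have "u \<in> ?E\<^sup>+ `` {u}" "v \<in> ?E\<^sup>+ `` {u}" using B by auto
    ultimately show "u \<in> S \<longleftrightarrow> v \<in> S" using L unfolding closed_under_def by blast
  qed
next
  let ?E = "\<Union>B\<in>\<B>. B \<times> B"
  assume R: "closed_under \<B> S"
  have *: "u \<in> S \<longleftrightarrow> v \<in> S" if "(u, v) \<in> ?E\<^sup>+" for u v
    using that by (induction rule: trancl_induct) (use R in \<open>auto simp: closed_under_def\<close>)
  show "closed_under (\<Union>\<B> // ?E\<^sup>+) S"
    unfolding closed_under_def quotient_def using * by blast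
qed

definition rows :: "nat set \<Rightarrow> nat set \<Rightarrow> vertex set" where
  "rows P Q = {0} \<times> P \<union> {1} \<times> Q"

lemma in_rows [simp]: "(r, i) \<in> rows P Q \<longleftrightarrow> (r = 0 \<and> i \<in> P) \<or> (r = 1 \<and> i \<in> Q)"
  by (auto simp: rows_def)

definition sat :: "diagram \<Rightarrow> nat set \<Rightarrow> nat set \<Rightarrow> bool" where
  "sat d P Q \<longleftrightarrow> closed_under d (rows P Q)"

lemma sat_empty [simp]: "sat d {} {}"
  by (simp add: sat_def closed_under_def rows_def)

definition dgms :: "nat \<Rightarrow> nat \<Rightarrow> diagram set" where
  "dgms a b = {d. partition_on (rows {1..a} {1..b}) d}"

lemma finite_dgm: "d \<in> dgms a b \<Longrightarrow> finite d"
  unfolding dgms_def using finite_elements[of "rows {1..a} {1..b}" d] by (simp add: rows_def)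

lemma vertex_set_eq_rows:
  "B \<subseteq> rows X Y \<Longrightarrow> B = rows {i. (0, i) \<in> B} {i. (1, i) \<in> B}"
  by (auto simp: rows_def)

text \<open>The block of a vertex u is the least saturated set that contains u, so the saturated
  sets determine the blocks.\<close>

lemma sat_subset:
  assumes d: "d \<in> dgms a b" and d': "d' \<in> dgms a b"
    and eq: "\<And>P Q. P \<subseteq> {1..a} \<Longrightarrow> Q \<subseteq> {1..b} \<Longrightarrow> sat d P Q \<longleftrightarrow> sat d' P Q"
  shows "d \<subseteq> d'"
proof
  \<comment> \<open>Kept general in both diagrams so that it applies with their roles exchanged; the
    two inclusions give equality of the blocks through a common vertex.\<close>
  have sub: "B' \<subseteq> B" if "e \<in> dgms a b" "e' \<in> dgms a b" "B \<in> e" "B' \<in> e'" "u \<in> B" "u \<in> B'"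
    and e: "\<And>P Q. P \<subseteq> {1..a} \<Longrightarrow> Q \<subseteq> {1..b} \<Longrightarrow> sat e P Q \<longleftrightarrow> sat e' P Q" for e e' B B' u
  proof -
    have p: "partition_on (rows {1..a} {1..b}) e" using that by (simp add: dgms_def)
    have Bs: "B \<subseteq> rows {1..a} {1..b}" using partition_onD1[OF p] that by blast
    define P Q where "P = {i. (0, i) \<in> B}" and "Q = {i. (1, i) \<in> B}"
    have PQ: "P \<subseteq> {1..a}" "Q \<subseteq> {1..b}" using Bs unfolding P_def Q_def by (auto simp: rows_def)
    have BPQ: "B = rows P Q" using vertex_set_eq_rows[OF Bs] by (simp add: P_def Q_def)
    have "closed_under e B"
      unfolding closed_under_def
    proof (intro ballI)
      fix C x y assume "C \<in> e" "x \<in> C" "y \<in> C"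
      then show "x \<in> B \<longleftrightarrow> y \<in> B"
        using disjointD[OF partition_onD2[OF p], of C B] \<open>B \<in> e\<close> by blast
    qed
    then have "closed_under e' B" using e[OF PQ] by (simp add: sat_def BPQ)
    then show ?thesis using that unfolding closed_under_def by blast
  qed
  fix B assume B: "B \<in> d"
  have p: "partition_on (rows {1..a} {1..b}) d" and p': "partition_on (rows {1..a} {1..b}) d'"
    using d d' by (simp_all add: dgms_def)
  obtain u where u: "u \<in> B" using partition_onD3[OF p] B by (metis ex_in_conv)
  then have "u \<in> \<Union>d'" using partition_onD1[OF p] partition_onD1[OF p'] B by blast
  then obtain B' where B': "B' \<in> d'" "u \<in> B'" by blast
  have "B = B'"
    using sub[OF d d' B B'(1) u B'(2) eq] sub[OF d' d B'(1) B B'(2) u] eq by blast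
  then show "B \<in> d'" using B' by simp
qed

lemma sat_inject:
  assumes "d \<in> dgms a b" and "d' \<in> dgms a b"
    and "\<And>P Q. P \<subseteq> {1..a} \<Longrightarrow> Q \<subseteq> {1..b} \<Longrightarrow> sat d P Q \<longleftrightarrow> sat d' P Q"
  shows "d = d'"
  using sat_subset[of d a b d'] sat_subset[of d' a b d] assms by blast

section \<open>Stacks of two diagrams in three rows\<close>

definition rows3 :: "nat set \<Rightarrow> nat set \<Rightarrow> nat set \<Rightarrow> vertex set" where
  "rows3 P R Q = {0} \<times> P \<union> {1} \<times> R \<union> {2} \<times> Q"

abbreviation squash :: "vertex \<Rightarrow> vertex" where
  "squash \<equiv> \<lambda>(r, i). (if r = 2 then 1 else r, i)"

lemma squash_inj: "inj_on squash (rows3 P {} Q)"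
  by (auto simp: inj_on_def rows3_def)

lemma squash_in_rows: "u \<in> rows3 X {} Y \<Longrightarrow> squash u \<in> rows P Q \<longleftrightarrow> u \<in> rows3 P R Q"
  by (auto simp: rows_def rows3_def)

context
  fixes a b c d1 d2
  assumes d1: "d1 \<in> dgms a b" and d2: "d2 \<in> dgms b c"
begin

lemma Union_stack: "\<Union>(stack_blocks d1 d2) = rows3 {1..a} {1..b} {1..c}"
proof -
  have "\<Union>d1 = rows {1..a} {1..b}" "\<Union>d2 = rows {1..b} {1..c}"
    using d1 d2 by (auto simp: dgms_def partition_on_def)
  moreover have "\<Union>((`) (\<lambda>(r, i). (Suc r, i)) ` d2) = (\<lambda>(r, i). (Suc r, i)) ` \<Union>d2"
    by blast
  moreover have "(\<lambda>(r, i). (Suc r, i)) ` rows {1..b} {1..c} = {1} \<times> {1..b} \<union> {2} \<times> {1..c}"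
    unfolding rows_def by force
  ultimately show ?thesis
    by (simp add: stack_blocks_def rows_def rows3_def Un_assoc)
qed

lemma partition_on_components: "partition_on (rows3 {1..a} {1..b} {1..c}) (components d1 d2)"
  using partition_on_generated[of "stack_blocks d1 d2"]
  by (simp add: components_def Union_stack)

text \<open>The generators suffice, and a block of \<open>d1\<close> sees only rows 0 and 1, a
  shifted block of \<open>d2\<close> only rows 1 and 2. The shared set \<open>R\<close> is what
  turns stacking into a matrix product.\<close>

lemma closed_under_components:
  "closed_under (components d1 d2) (rows3 P R Q) \<longleftrightarrow> sat d1 P R \<and> sat d2 R Q"
proof -
  have 1: "closed_under d1 (rows3 P R Q) \<longleftrightarrow> closed_under d1 (rows P R)"
  proof (rule closed_under_cong)
    fix B u assume "B \<in> d1" "u \<in> B"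
    then have "u \<in> rows {1..a} {1..b}" using d1 by (auto simp only: dgms_def partition_on_def)
    then show "u \<in> rows3 P R Q \<longleftrightarrow> u \<in> rows P R" by (auto simp: rows_def rows3_def)
  qed
  have 2: "closed_under ((`) (\<lambda>(r, i). (Suc r, i)) ` d2) (rows3 P R Q) \<longleftrightarrow> closed_under d2 (rows R Q)"
  proof -
    have "(\<lambda>(r, i). (Suc r, i)) u \<in> rows3 P R Q \<longleftrightarrow> u \<in> rows R Q" if "B \<in> d2" "u \<in> B" for B u
    proof -
      have "u \<in> rows {1..b} {1..c}" using d2 that by (auto simp only: dgms_def partition_on_def)
      then show ?thesis by (auto simp: rows_def rows3_def)
    qed
    then show ?thesis unfolding closed_under_def ball_simps by (intro ball_cong refl) blast
  qed
  show ?thesis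
    unfolding components_def closed_under_generated
    by (simp add: stack_blocks_def closed_under_Un 1 2 sat_def)
qed

lemma outer_part:
  assumes "C \<in> components d1 d2" shows "C - middle_row \<subseteq> rows3 {1..a} {} {1..c}"
  using partition_onD1[OF partition_on_components] assms
  by (auto simp: rows3_def middle_row_def)

text \<open>Once the middle row is gone, renaming row 2 to row 1 is injective, so the partition of
  the outer rows that the components induce stays a partition.\<close>

lemma diag_comp_dgms: "diag_comp d1 d2 \<in> dgms a c"
proof -
  let ?K = "{C - middle_row | C. C \<in> components d1 d2 \<and> \<not> C \<subseteq> middle_row}"
  have K: "partition_on (rows3 {1..a} {} {1..c}) ?K"
  proof (rule partition_onI)
    show "\<Union>?K = rows3 {1..a} {} {1..c}"
    proof
      show "\<Union>?K \<subseteq> rows3 {1..a} {} {1..c}" using outer_part by blast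
      show "rows3 {1..a} {} {1..c} \<subseteq> \<Union>?K"
      proof
        fix u assume u: "u \<in> rows3 {1..a} {} {1..c}"
        then have "u \<in> rows3 {1..a} {1..b} {1..c}" "u \<notin> middle_row"
          by (auto simp: rows3_def middle_row_def)
        moreover from this obtain C where "C \<in> components d1 d2" "u \<in> C"
          using partition_onD1[OF partition_on_components] by blast
        ultimately show "u \<in> \<Union>?K" by blast
      qed
    qed
    show "{} \<notin> ?K" by auto
    fix p q assume "p \<in> ?K" "q \<in> ?K" "p \<noteq> q"
    then show "disjnt p q"
      using partition_onD2[OF partition_on_components] unfolding disjoint_def disjnt_def by blast
  qed
  have "diag_comp d1 d2 = (`) squash ` ?K"
    unfolding diag_comp_def by blast
  moreover have "squash ` rows3 {1..a} {} {1..c} = rows {1..a} {1..c}"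
    by (force simp: rows_def rows3_def)
  moreover have "{} \<notin> (`) squash ` ?K"
    by auto
  ultimately show ?thesis
    using partition_on_inj_image[OF K squash_inj] by (simp add: dgms_def)
qed

text \<open>The bottom row is kept as row 2, before the relabelling by \<open>squash\<close>, so
  that the counting can stay inside the stack. The middle entry of \<open>rows3 P {} Q\<close> is
  arbitrary, as no middle vertex is tested.\<close>

lemma sat_diag_comp:
  "sat (diag_comp d1 d2) P Q \<longleftrightarrow>
    (\<forall>C\<in>components d1 d2. \<forall>u\<in>C - middle_row. \<forall>v\<in>C - middle_row.
      u \<in> rows3 P {} Q \<longleftrightarrow> v \<in> rows3 P {} Q)" (is "_ = ?R")
proof -
  have *: "squash u \<in> rows P Q \<longleftrightarrow> u \<in> rows3 P {} Q"
    if "C \<in> components d1 d2" "u \<in> C - middle_row" for C u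
    using outer_part[OF that(1)] that(2) by (intro squash_in_rows) blast
  have "sat (diag_comp d1 d2) P Q \<longleftrightarrow>
    (\<forall>C\<in>components d1 d2. \<not> C \<subseteq> middle_row \<longrightarrow> (\<forall>u\<in>C - middle_row. \<forall>v\<in>C - middle_row.
      squash u \<in> rows P Q \<longleftrightarrow> squash v \<in> rows P Q))"
  proof -
    have "diag_comp d1 d2 =
        (\<lambda>C. squash ` (C - middle_row)) ` {C \<in> components d1 d2. \<not> C \<subseteq> middle_row}"
      unfolding diag_comp_def by blast
    then show ?thesis
      unfolding sat_def closed_under_def by (simp only: ball_simps mem_Collect_eq) blast
  qed
  also have "\<dots> \<longleftrightarrow> ?R"
    using * by blast
  finally show ?thesis .
qed

text \<open>
  Reading \<open>sat d\<close> as a zero-one matrix indexed by subsets of the two rows, this says that the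
  matrix product is composition up to the factor \<open>2 ^ removed\<close>: a saturated set of the stack is
  determined by its outer rows up to a free choice on every removed component.
\<close>

lemma card_sat:
  "card {R. R \<subseteq> {1..b} \<and> sat d1 P R \<and> sat d2 R Q} =
    (if sat (diag_comp d1 d2) P Q then 2 ^ removed d1 d2 else 0)"
proof (cases "sat (diag_comp d1 d2) P Q")
  case False
  have "sat (diag_comp d1 d2) P Q" if "R \<subseteq> {1..b}" "sat d1 P R" "sat d2 R Q" for R
  proof -
    have "closed_under (components d1 d2) (rows3 P R Q)"
      using that closed_under_components by blast
    moreover have "u \<in> rows3 P R Q \<longleftrightarrow> u \<in> rows3 P {} Q" if "u \<notin> middle_row" for u
      using that by (auto simp: rows3_def middle_row_def)
    ultimately show ?thesis
      unfolding sat_diag_comp closed_under_def by blast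
  qed
  then have "{R. R \<subseteq> {1..b} \<and> sat d1 P R \<and> sat d2 R Q} = {}" using False by blast
  then show ?thesis using False by simp
next
  case True
  let ?C = "components d1 d2"
  let ?M = "{C \<in> ?C. C \<subseteq> middle_row}"
  let ?S = "{R. R \<subseteq> {1..b} \<and> closed_under ?C (rows3 P R Q)}"
  \<comment> \<open>\<open>U\<close> collects the components that the prescribed outer rows force
    into the saturated set. No removed component meets it, so \<open>f D\<close> adds to the forced
    middle points those of the removed components chosen in \<open>D\<close>.\<close>
  define U where "U = \<Union>{C \<in> ?C. C \<inter> rows3 P {} Q \<noteq> {}}"
  define f where "f D = {i. (1, i) \<in> \<Union>D \<or> (1, i) \<in> U}" for D :: diagram
  note part = partition_on_components
  have eq: "C = C'" if "C \<in> ?C" "C' \<in> ?C" "u \<in> C" "u \<in> C'" for C C' u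
    using disjointD[OF partition_onD2[OF part] that(1,2)] that(3,4) by blast
  have nonempty: "\<exists>u. u \<in> C" if "C \<in> ?C" for C
    using partition_onD3[OF part] that by (metis ex_in_conv)
  have sub: "C \<subseteq> rows3 {1..a} {1..b} {1..c}" if "C \<in> ?C" for C
    using partition_onD1[OF part] that by blast
  have mid: "\<exists>i\<in>{1..b}. u = (1, i)" if "C \<in> ?C" "u \<in> C" "u \<in> middle_row" for C u
    using sub[OF that(1)] that(2,3) by (auto simp: rows3_def middle_row_def)
  have U_elim: thesis if C: "C \<in> ?C" "u \<in> C" and u: "u \<in> U" and thesis: "\<And>v. v \<in> C \<Longrightarrow> v \<in> rows3 P {} Q \<Longrightarrow> thesis"
    for C u thesis
  proof -
    obtain C' v where C': "C' \<in> ?C" "u \<in> C'" "v \<in> C'" "v \<in> rows3 P {} Q"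
      using u unfolding U_def by blast
    then show thesis using thesis eq[OF C'(1) C(1) C'(2) C(2)] by simp
  qed
  \<comment> \<open>Here saturation for the composite enters: a component with one prescribed outer
    vertex has all its outer vertices prescribed.\<close>
  have outer: "u \<in> U \<longleftrightarrow> u \<in> rows3 P {} Q" if "C \<in> ?C" and "u \<in> C" and "u \<notin> middle_row" for C u
  proof
    assume "u \<in> U"
    then obtain v where "v \<in> C" "v \<in> rows3 P {} Q" by (rule U_elim[OF \<open>C \<in> ?C\<close> \<open>u \<in> C\<close>])
    moreover have "v \<notin> middle_row" using \<open>v \<in> rows3 P {} Q\<close> by (auto simp: rows3_def middle_row_def)
    ultimately show "u \<in> rows3 P {} Q" using True that unfolding sat_diag_comp by blast
  qed (use that in \<open>auto simp: U_def\<close>)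
  have in_f: "u \<in> rows3 P (f D) Q \<longleftrightarrow> C \<in> D \<or> u \<in> U"
    if D: "D \<subseteq> ?M" and C: "C \<in> ?C" "u \<in> C" for D C u
  proof (cases "u \<in> middle_row")
    case True
    then obtain i where "u = (1, i)" using mid C by blast
    moreover have "u \<in> \<Union>D \<longleftrightarrow> C \<in> D" using eq C D by blast
    ultimately show ?thesis by (auto simp: rows3_def f_def)
  next
    case False
    then have "u \<in> rows3 P (f D) Q \<longleftrightarrow> u \<in> rows3 P {} Q"
      by (auto simp: rows3_def middle_row_def)
    moreover have "C \<notin> D" using D C False by blast
    ultimately show ?thesis using outer[OF C False] by blast
  qed
  have U_closed: "u \<in> U \<longleftrightarrow> v \<in> U" if "C \<in> ?C" "u \<in> C" "v \<in> C" for C u v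
    using U_elim[of C u "u \<in> U \<longleftrightarrow> v \<in> U"] U_elim[of C v "u \<in> U \<longleftrightarrow> v \<in> U"] that
    unfolding U_def by blast
  have U_mid: "u \<notin> U" if "C \<in> ?M" and "u \<in> C" for C u
  proof
    assume "u \<in> U"
    moreover have "C \<in> ?C" using that by simp
    ultimately obtain v where "v \<in> C" "v \<in> rows3 P {} Q"
      using \<open>u \<in> U\<close> \<open>u \<in> C\<close> U_elim by metis
    then show False using that by (auto simp: rows3_def middle_row_def)
  qed
  have "bij_betw f (Pow ?M) ?S"
  \<comment> \<open>The choice is recovered from \<open>R\<close> as the set of removed components
    that meet it, since a saturated set contains such a component entirely or not at all.\<close>
  proof (rule bij_betw_byWitness[where f' = "\<lambda>R. {C \<in> ?M. C \<inter> {1} \<times> R \<noteq> {}}"])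
    show "\<forall>D\<in>Pow ?M. {C \<in> ?M. C \<inter> {1} \<times> f D \<noteq> {}} = D"
    proof (intro ballI set_eqI)
      fix D C assume "D \<in> Pow ?M"
      then have D: "D \<subseteq> ?M" by simp
      show "C \<in> {C \<in> ?M. C \<inter> {1} \<times> f D \<noteq> {}} \<longleftrightarrow> C \<in> D"
      proof (cases "C \<in> ?M")
        case True
        then obtain u where u: "u \<in> C" using nonempty by blast
        obtain i where i: "u = (1, i)" using mid True u by blast
        have "v \<in> {1} \<times> f D \<longleftrightarrow> C \<in> D" if "v \<in> C" for v
        proof -
          have "v \<in> middle_row" using True that by blast
          then have "v \<in> {1} \<times> f D \<longleftrightarrow> v \<in> rows3 P (f D) Q"
            by (auto simp: rows3_def middle_row_def)
          also have "\<dots> \<longleftrightarrow> C \<in> D" using in_f[OF D, of C v] U_mid[OF True that] True that by blast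
          finally show ?thesis .
        qed
        then show ?thesis using True u by blast
      qed (use D in blast)
    qed
    show "\<forall>R\<in>?S. f {C \<in> ?M. C \<inter> {1} \<times> R \<noteq> {}} = R"
    proof (intro ballI set_eqI)
      fix R i assume R: "R \<in> ?S"
      let ?D = "{C \<in> ?M. C \<inter> {1} \<times> R \<noteq> {}}"
      have cl: "u \<in> rows3 P R Q \<longleftrightarrow> v \<in> rows3 P R Q" if "C \<in> ?C" "u \<in> C" "v \<in> C" for C u v
        using R that unfolding closed_under_def by blast
      show "i \<in> f ?D \<longleftrightarrow> i \<in> R"
      proof (cases "i \<in> {1..b}")
        case True
        then have "(1, i) \<in> rows3 {1..a} {1..b} {1..c}" by (simp add: rows3_def)
        then obtain C where C: "C \<in> ?C" "(1, i) \<in> C" using partition_onD1[OF part] by blast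
        have "i \<in> f ?D \<longleftrightarrow> (1, i) \<in> rows3 P (f ?D) Q" by (simp add: rows3_def)
        also have "\<dots> \<longleftrightarrow> C \<in> ?D \<or> (1, i) \<in> U" using in_f[of ?D C "(1, i)"] C by blast
        also have "\<dots> \<longleftrightarrow> (1, i) \<in> rows3 P R Q"
        proof (cases "C \<subseteq> middle_row")
          case True
          have "v \<in> {1} \<times> R \<longleftrightarrow> v \<in> rows3 P R Q" if "v \<in> C" for v
            using True that by (auto simp: rows3_def middle_row_def)
          then show ?thesis using cl C U_mid True by blast
        next
          case False
          then obtain v where v: "v \<in> C" "v \<notin> middle_row" by blast
          have "(1, i) \<in> U \<longleftrightarrow> v \<in> rows3 P {} Q"
            using U_closed[OF C v(1)] outer[OF C(1) v] by blast
          also have "\<dots> \<longleftrightarrow> v \<in> rows3 P R Q" using v by (auto simp: rows3_def middle_row_def)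
          finally show ?thesis using cl[OF C v(1)] False by blast
        qed
        finally show ?thesis by (simp add: rows3_def)
      next
        case False
        have "(1, i) \<notin> C" if "C \<in> ?C" for C using sub[OF that] False by (auto simp: rows3_def)
        then have "i \<notin> f ?D" by (auto simp: f_def U_def)
        then show ?thesis using R False by blast
      qed
    qed
    show "f ` Pow ?M \<subseteq> ?S"
    proof clarify
      fix D assume D: "D \<subseteq> ?M"
      have "f D \<subseteq> {1..b}"
      proof
        fix i assume "i \<in> f D"
        then obtain C where "C \<in> ?C" "(1, i) \<in> C" using D by (auto simp: f_def U_def)
        then show "i \<in> {1..b}" using mid[of C "(1, i)"] by (auto simp: middle_row_def)
      qed
      moreover have "closed_under ?C (rows3 P (f D) Q)"
        unfolding closed_under_def using in_f[OF D] U_closed by blast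
      ultimately show "f D \<subseteq> {1..b} \<and> closed_under ?C (rows3 P (f D) Q)" by blast
    qed
    show "(\<lambda>R. {C \<in> ?M. C \<inter> {1} \<times> R \<noteq> {}}) ` ?S \<subseteq> Pow ?M" by blast
  qed
  then have "card ?S = card (Pow ?M)" by (simp add: bij_betw_same_card)
  moreover have "finite ?M"
    using finite_elements[OF _ part] by (simp add: rows3_def)
  ultimately show ?thesis
    using True by (simp add: card_Pow removed_def closed_under_components)
qed

end

section \<open>Recognizing a composite by counting middle sets\<close>

lemma exists_middle_iff:
  assumes "d1 \<in> dgms a b" and "d2 \<in> dgms b c"
  shows "sat (diag_comp d1 d2) P Q \<longleftrightarrow> (\<exists>R\<subseteq>{1..b}. sat d1 P R \<and> sat d2 R Q)"
proof
  let ?S = "{R. R \<subseteq> {1..b} \<and> sat d1 P R \<and> sat d2 R Q}"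
  assume "sat (diag_comp d1 d2) P Q"
  then have "card ?S > 0" using card_sat[OF assms, of P Q] by simp
  then show "\<exists>R\<subseteq>{1..b}. sat d1 P R \<and> sat d2 R Q" by (metis (mono_tags, lifting) card_gt_0_iff ex_in_conv mem_Collect_eq)
next
  let ?S = "{R. R \<subseteq> {1..b} \<and> sat d1 P R \<and> sat d2 R Q}"
  assume "\<exists>R\<subseteq>{1..b}. sat d1 P R \<and> sat d2 R Q"
  moreover have "finite ?S" by (rule finite_subset[of _ "Pow {1..b}"]) auto
  ultimately have "card ?S > 0" by (auto simp: card_gt_0_iff)
  then show "sat (diag_comp d1 d2) P Q" using card_sat[OF assms, of P Q] by (auto split: if_splits)
qed

text \<open>A criterion for the values of \<open>diag_comp\<close> and \<open>removed\<close> that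
  mentions no components. By \<open>composesD\<close> the count determines both the composite and
  the exponent, so later identities only require counting sets \<open>R\<close>.\<close>

definition composes :: "nat \<Rightarrow> nat \<Rightarrow> nat \<Rightarrow> diagram \<Rightarrow> diagram \<Rightarrow> nat \<Rightarrow> diagram \<Rightarrow> bool" where
  "composes a b c d1 d2 l d3 \<longleftrightarrow> d1 \<in> dgms a b \<and> d2 \<in> dgms b c \<and> d3 \<in> dgms a c \<and>
     (\<forall>P\<subseteq>{1..a}. \<forall>Q\<subseteq>{1..c}. card {R. R \<subseteq> {1..b} \<and> sat d1 P R \<and> sat d2 R Q} =
        (if sat d3 P Q then 2 ^ l else 0))"

text \<open>The zero pattern of the matrix gives the diagram. The entry at two empty sets is never
  zero, and there the exponent can be read off.\<close>

lemma power_sat_eqD: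
  assumes "d \<in> dgms a c" and "d' \<in> dgms a c"
    and eq: "\<And>P Q. P \<subseteq> {1..a} \<Longrightarrow> Q \<subseteq> {1..c} \<Longrightarrow>
      (if sat d P Q then 2 ^ l else 0) = (if sat d' P Q then 2 ^ l' else (0 :: nat))"
  shows "d = d' \<and> l = l'"
proof
  show "d = d'"
    using assms(1,2)
  proof (rule sat_inject)
    fix P Q :: "nat set" assume "P \<subseteq> {1..a}" "Q \<subseteq> {1..c}"
    then show "sat d P Q \<longleftrightarrow> sat d' P Q" using eq[of P Q] by (auto split: if_splits)
  qed
  show "l = l'" using eq[of "{}" "{}"] by simp
qed

lemma composesD:
  assumes "composes a b c d1 d2 l d3"
  shows "diag_comp d1 d2 = d3" and "removed d1 d2 = l"
proof -
  have "diag_comp d1 d2 = d3 \<and> removed d1 d2 = l"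
  proof (rule power_sat_eqD)
    show "diag_comp d1 d2 \<in> dgms a c" "d3 \<in> dgms a c"
      using assms diag_comp_dgms by (auto simp: composes_def)
    fix P Q :: "nat set" assume "P \<subseteq> {1..a}" "Q \<subseteq> {1..c}"
    then have "card {R. R \<subseteq> {1..b} \<and> sat d1 P R \<and> sat d2 R Q} = (if sat d3 P Q then 2 ^ l else 0)"
      using assms unfolding composes_def by blast
    moreover have "card {R. R \<subseteq> {1..b} \<and> sat d1 P R \<and> sat d2 R Q} =
        (if sat (diag_comp d1 d2) P Q then 2 ^ removed d1 d2 else 0)"
      using assms by (intro card_sat) (auto simp: composes_def)
    ultimately show "(if sat (diag_comp d1 d2) P Q then 2 ^ removed d1 d2 else 0) =
        (if sat d3 P Q then 2 ^ l else (0::nat))"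
      by (rule trans[OF sym, rotated])
  qed
  then show "diag_comp d1 d2 = d3" and "removed d1 d2 = l" by simp_all
qed

text \<open>If nothing is removed, the middle set is forced by the outer ones. The function
  \<open>\<rho>\<close> names this forced set, so each count is 1 or 0.\<close>

lemma composesI:
  assumes "d1 \<in> dgms a b" and "d2 \<in> dgms b c" and "d3 \<in> dgms a c"
    and iff: "\<And>P R Q. P \<subseteq> {1..a} \<Longrightarrow> R \<subseteq> {1..b} \<Longrightarrow> Q \<subseteq> {1..c} \<Longrightarrow>
      sat d1 P R \<and> sat d2 R Q \<longleftrightarrow> sat d3 P Q \<and> R = \<rho> P Q"
    and sub: "\<And>P Q. P \<subseteq> {1..a} \<Longrightarrow> Q \<subseteq> {1..c} \<Longrightarrow> sat d3 P Q \<Longrightarrow> \<rho> P Q \<subseteq> {1..b}"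
  shows "composes a b c d1 d2 0 d3"
  unfolding composes_def
proof (intro conjI allI impI)
  fix P Q :: "nat set" assume PQ: "P \<subseteq> {1..a}" "Q \<subseteq> {1..c}"
  have "{R. R \<subseteq> {1..b} \<and> sat d1 P R \<and> sat d2 R Q} = (if sat d3 P Q then {\<rho> P Q} else {})"
    using iff[OF PQ(1) _ PQ(2)] sub[OF PQ] by auto
  then show "card {R. R \<subseteq> {1..b} \<and> sat d1 P R \<and> sat d2 R Q} = (if sat d3 P Q then 2 ^ 0 else 0)"
    by simp
qed (use assms in auto)

text \<open>The triple matrix product is a power of 2 times a zero-one matrix in either bracketing;
  comparing the two gives the diagrams and, through the exponents, the equality of the powers of
  n.\<close>

lemma diag_comp_assoc:
  assumes d1: "d1 \<in> dgms a b" and d2: "d2 \<in> dgms b c" and d3: "d3 \<in> dgms c e"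
  shows "diag_comp (diag_comp d1 d2) d3 = diag_comp d1 (diag_comp d2 d3)"
    and "removed d1 d2 + removed (diag_comp d1 d2) d3 = removed d2 d3 + removed d1 (diag_comp d2 d3)"
proof -
  let ?m = "\<lambda>d P Q. if sat d P Q then 1 else 0 :: nat"
  have m: "(\<Sum>R\<in>Pow {1..y}. ?m f P R * ?m g R Q) = 2 ^ removed f g * ?m (diag_comp f g) P Q"
    if "f \<in> dgms x y" "g \<in> dgms y z" for f g x y z P Q
  proof -
    have "(\<Sum>R\<in>Pow {1..y}. ?m f P R * ?m g R Q) =
        (\<Sum>R\<in>Pow {1..y}. if sat f P R \<and> sat g R Q then 1 else 0)"
      by (rule sum.cong) auto
    also have "\<dots> = card {R. R \<subseteq> {1..y} \<and> sat f P R \<and> sat g R Q}"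
      by (simp add: sum.If_cases Int_def)
    finally show ?thesis using card_sat[OF that, of P Q] by simp
  qed
  note d12 = diag_comp_dgms[OF d1 d2] and d23 = diag_comp_dgms[OF d2 d3]
  have "diag_comp (diag_comp d1 d2) d3 = diag_comp d1 (diag_comp d2 d3) \<and>
    removed d1 d2 + removed (diag_comp d1 d2) d3 = removed d2 d3 + removed d1 (diag_comp d2 d3)"
  proof (rule power_sat_eqD)
    fix P Q :: "nat set"
    have "(\<Sum>R'\<in>Pow {1..c}. (\<Sum>R\<in>Pow {1..b}. ?m d1 P R * ?m d2 R R') * ?m d3 R' Q) =
        (\<Sum>R\<in>Pow {1..b}. ?m d1 P R * (\<Sum>R'\<in>Pow {1..c}. ?m d2 R R' * ?m d3 R' Q))"
      unfolding sum_distrib_left sum_distrib_right mult.assoc by (rule sum.swap)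
    then have "2 ^ removed d1 d2 * (\<Sum>R'\<in>Pow {1..c}. ?m (diag_comp d1 d2) P R' * ?m d3 R' Q) =
        2 ^ removed d2 d3 * (\<Sum>R\<in>Pow {1..b}. ?m d1 P R * ?m (diag_comp d2 d3) R Q)"
      unfolding m[OF d1 d2] m[OF d2 d3] sum_distrib_left by (simp only: ac_simps)
    then show "(if sat (diag_comp (diag_comp d1 d2) d3) P Q
          then 2 ^ (removed d1 d2 + removed (diag_comp d1 d2) d3) else 0) =
        (if sat (diag_comp d1 (diag_comp d2 d3)) P Q
          then 2 ^ (removed d2 d3 + removed d1 (diag_comp d2 d3)) else (0::nat))"
      unfolding m[OF d12 d3] m[OF d1 d23] by (simp add: power_add split: if_splits)
  qed (use diag_comp_dgms assms in blast)+
  then show "diag_comp (diag_comp d1 d2) d3 = diag_comp d1 (diag_comp d2 d3)"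
    and "removed d1 d2 + removed (diag_comp d1 d2) d3 = removed d2 d3 + removed d1 (diag_comp d2 d3)"
    by simp_all
qed

section \<open>Reflection exchanging the two rows\<close>

definition flip :: "diagram \<Rightarrow> diagram" where
  "flip d = (`) (\<lambda>(r, i). (1 - r, i)) ` d"

lemma flip_vertex_image: "(\<lambda>(r, i). (1 - r, i)) ` rows P Q = rows Q P"
  by (force simp: rows_def)

lemma flip_dgms: "d \<in> dgms a b \<Longrightarrow> flip d \<in> dgms b a"
proof -
  assume d: "d \<in> dgms a b"
  then have p: "partition_on (rows {1..a} {1..b}) d" by (simp add: dgms_def)
  have inj: "inj_on (\<lambda>(r, i). (1 - r, i)) (rows {1..a} {1..b})"
    by (auto simp: inj_on_def rows_def)
  have "{} \<notin> flip d" using partition_onD3[OF p] by (auto simp: flip_def)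
  then show ?thesis
    using partition_on_inj_image[OF p inj] by (simp add: dgms_def flip_vertex_image flip_def[symmetric] del: One_nat_def)
qed

text \<open>The subtraction \<open>1 - r\<close> is truncated, so it is an involution only on rows 0
  and 1; this is where \<open>d\<close> has to be a diagram.\<close>

lemma flip_flip:
  assumes "d \<in> dgms a b" shows "flip (flip d) = d"
proof -
  have "(\<lambda>(r, i). (1 - r, i)) ` (\<lambda>(r, i). (1 - r, i)) ` B = B" if "B \<in> d" for B
  proof -
    have "B \<subseteq> rows {1..a} {1..b}" using assms that by (auto simp: dgms_def partition_on_def)
    then have "(\<lambda>(r, i). (1 - r, i)) ((\<lambda>(r, i). (1 - r, i)) u) = u" if "u \<in> B" for u
      using that by (auto simp: rows_def)
    then show ?thesis unfolding image_image by (simp add: image_def)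
  qed
  then show ?thesis unfolding flip_def image_image by (simp add: image_def)
qed

lemma sat_flip:
  assumes "d \<in> dgms a b" shows "sat (flip d) Q P \<longleftrightarrow> sat d P Q"
proof -
  have "(\<lambda>(r, i). (1 - r, i)) u \<in> rows Q P \<longleftrightarrow> u \<in> rows P Q" if "B \<in> d" "u \<in> B" for B u
  proof -
    have "u \<in> rows {1..a} {1..b}" using assms that by (auto simp: dgms_def partition_on_def)
    then show ?thesis by (auto simp: rows_def)
  qed
  then show ?thesis
    unfolding sat_def closed_under_def flip_def ball_simps by (intro ball_cong refl) blast
qed

text \<open>Reflection transposes the zero-one matrix, and transposition reverses products. Every
  fact about left factors thus yields one about right factors.\<close>

lemma composes_flip:
  assumes "composes a b c d1 d2 l d3"
  shows "composes c b a (flip d2) (flip d1) l (flip d3)"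
proof -
  have d: "d1 \<in> dgms a b" "d2 \<in> dgms b c" "d3 \<in> dgms a c"
    and card: "\<And>P Q. P \<subseteq> {1..a} \<Longrightarrow> Q \<subseteq> {1..c} \<Longrightarrow>
      card {R. R \<subseteq> {1..b} \<and> sat d1 P R \<and> sat d2 R Q} = (if sat d3 P Q then 2 ^ l else 0)"
    using assms unfolding composes_def by blast+
  show ?thesis
    unfolding composes_def
  proof (intro conjI allI impI)
    fix P Q :: "nat set" assume PQ: "P \<subseteq> {1..c}" "Q \<subseteq> {1..a}"
    have "{R. R \<subseteq> {1..b} \<and> sat (flip d2) P R \<and> sat (flip d1) R Q} =
        {R. R \<subseteq> {1..b} \<and> sat d1 Q R \<and> sat d2 R P}"
      using d sat_flip by blast
    then show "card {R. R \<subseteq> {1..b} \<and> sat (flip d2) P R \<and> sat (flip d1) R Q} =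
        (if sat (flip d3) P Q then 2 ^ l else 0)"
      unfolding sat_flip[OF d(3)] using card[OF PQ(2,1)] by simp
  qed (use d flip_dgms in blast)+
qed

section \<open>Diagrams as fibres of labellings\<close>

text \<open>A diagram given as a cospan: \<open>f\<close> and \<open>g\<close> label the top and
  bottom points, and points lie in one block exactly when their labels agree. Labels that occur in
  neither row contribute nothing, so any label type may be used.\<close>

definition fib :: "nat \<Rightarrow> nat \<Rightarrow> (nat \<Rightarrow> 'l) \<Rightarrow> (nat \<Rightarrow> 'l) \<Rightarrow> diagram" where
  "fib a b f g = (\<lambda>x. rows {i \<in> {1..a}. f i = x} {j \<in> {1..b}. g j = x}) ` (f ` {1..a} \<union> g ` {1..b})"

lemma fib_dgms [simp]: "fib a b f g \<in> dgms a b"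
  unfolding dgms_def mem_Collect_eq
proof (rule partition_onI)
  show "\<Union>(fib a b f g) = rows {1..a} {1..b}"
    by (auto simp: fib_def rows_def)
  show "{} \<notin> fib a b f g"
    by (auto simp: fib_def rows_def)
  fix p q assume "p \<in> fib a b f g" "q \<in> fib a b f g" "p \<noteq> q"
  then show "disjnt p q"
    by (auto simp: fib_def rows_def disjnt_def)
qed

text \<open>Saturated sets are the pullbacks of predicates on labels. Computing a composite of
  labelled diagrams then means matching two predicates along the middle row.\<close>

lemma sat_fib:
  "sat (fib a b f g) P Q \<longleftrightarrow>
    (\<exists>\<chi>. (\<forall>i\<in>{1..a}. i \<in> P \<longleftrightarrow> \<chi> (f i)) \<and> (\<forall>j\<in>{1..b}. j \<in> Q \<longleftrightarrow> \<chi> (g j)))"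
proof
  assume L: "sat (fib a b f g) P Q"
  \<comment> \<open>A label is selected as soon as one point carrying it is; by saturation it does
    not matter which point.\<close>
  let ?\<chi> = "\<lambda>x. (\<exists>i\<in>{1..a}. f i = x \<and> i \<in> P) \<or> (\<exists>j\<in>{1..b}. g j = x \<and> j \<in> Q)"
  have "u \<in> rows P Q \<longleftrightarrow> v \<in> rows P Q"
    if "x \<in> f ` {1..a} \<union> g ` {1..b}" "u \<in> rows {i \<in> {1..a}. f i = x} {j \<in> {1..b}. g j = x}"
      "v \<in> rows {i \<in> {1..a}. f i = x} {j \<in> {1..b}. g j = x}" for x u v
    using L that unfolding sat_def closed_under_def fib_def by blast
  note * = this
  have 1: "i \<in> P \<longleftrightarrow> i' \<in> P" if "i \<in> {1..a}" "i' \<in> {1..a}" "f i' = f i" for i i'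
    using that *[of "f i" "(0, i)" "(0, i')"] by simp
  have 2: "i \<in> P \<longleftrightarrow> j \<in> Q" if "i \<in> {1..a}" "j \<in> {1..b}" "g j = f i" for i j
    using that *[of "f i" "(0, i)" "(1, j)"] by simp
  have 3: "j \<in> Q \<longleftrightarrow> j' \<in> Q" if "j \<in> {1..b}" "j' \<in> {1..b}" "g j' = g j" for j j'
    using that *[of "g j" "(1, j)" "(1, j')"] by simp
  have "i \<in> P \<longleftrightarrow> ?\<chi> (f i)" if "i \<in> {1..a}" for i
    using that 1 2 by metis
  moreover have "j \<in> Q \<longleftrightarrow> ?\<chi> (g j)" if "j \<in> {1..b}" for j
    using that 2 3 by metis
  ultimately show "\<exists>\<chi>. (\<forall>i\<in>{1..a}. i \<in> P \<longleftrightarrow> \<chi> (f i)) \<and> (\<forall>j\<in>{1..b}. j \<in> Q \<longleftrightarrow> \<chi> (g j))"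
    by (intro exI[of _ ?\<chi>] conjI ballI)
next
  assume "\<exists>\<chi>. (\<forall>i\<in>{1..a}. i \<in> P \<longleftrightarrow> \<chi> (f i)) \<and> (\<forall>j\<in>{1..b}. j \<in> Q \<longleftrightarrow> \<chi> (g j))"
  then obtain \<chi> where \<chi>: "\<forall>i\<in>{1..a}. i \<in> P \<longleftrightarrow> \<chi> (f i)" "\<forall>j\<in>{1..b}. j \<in> Q \<longleftrightarrow> \<chi> (g j)"
    by blast
  have "u \<in> rows P Q \<longleftrightarrow> \<chi> x" if "u \<in> rows {i \<in> {1..a}. f i = x} {j \<in> {1..b}. g j = x}" for u x
    using that \<chi> by (auto simp: rows_def)
  then show "sat (fib a b f g) P Q"
    unfolding sat_def closed_under_def fib_def ball_simps by blast
qed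

lemma sat_fibI:
  "(\<And>i. i \<in> {1..a} \<Longrightarrow> i \<in> P \<longleftrightarrow> \<chi> (f i)) \<Longrightarrow> (\<And>j. j \<in> {1..b} \<Longrightarrow> j \<in> Q \<longleftrightarrow> \<chi> (g j)) \<Longrightarrow>
    sat (fib a b f g) P Q"
  unfolding sat_fib by blast

lemma sat_fibE:
  assumes "sat (fib a b f g) P Q"
  obtains \<chi> where "\<And>i. i \<in> {1..a} \<Longrightarrow> i \<in> P \<longleftrightarrow> \<chi> (f i)" "\<And>j. j \<in> {1..b} \<Longrightarrow> j \<in> Q \<longleftrightarrow> \<chi> (g j)"
  using assms unfolding sat_fib by blast

section \<open>Labelling a diagram by its own blocks\<close>

definition block_of :: "diagram \<Rightarrow> vertex \<Rightarrow> vertex set" where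
  "block_of d u = (THE B. B \<in> d \<and> u \<in> B)"

lemma block_of_eq:
  assumes "d \<in> dgms a b" and "B \<in> d" and "u \<in> B"
  shows "block_of d u = B"
  unfolding block_of_def
proof (rule the_equality)
  have p: "partition_on (rows {1..a} {1..b}) d" using assms by (simp add: dgms_def)
  fix C assume "C \<in> d \<and> u \<in> C"
  then show "C = B" using disjointD[OF partition_onD2[OF p], of B C] assms by blast
qed (use assms in blast)

lemma block_of_mem:
  assumes "d \<in> dgms a b" and "u \<in> rows {1..a} {1..b}"
  shows "block_of d u \<in> d" and "u \<in> block_of d u"
proof -
  obtain B where "B \<in> d" "u \<in> B"
    using assms unfolding dgms_def partition_on_def by blast
  then show "block_of d u \<in> d" and "u \<in> block_of d u" using block_of_eq[OF assms(1)] by auto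
qed

lemma dgm_eq_fib:
  assumes d: "d \<in> dgms a b"
  shows "d = fib a b (\<lambda>i. block_of d (0, i)) (\<lambda>j. block_of d (1, j))"
  using d fib_dgms
proof (rule sat_inject)
  fix P Q :: "nat set"
  have p: "partition_on (rows {1..a} {1..b}) d" using assms by (simp add: dgms_def)
  show "sat d P Q \<longleftrightarrow> sat (fib a b (\<lambda>i. block_of d (0, i)) (\<lambda>j. block_of d (1, j))) P Q"
  proof
    assume L: "sat d P Q"
    have "u \<in> rows P Q \<longleftrightarrow> block_of d u \<subseteq> rows P Q" if "u \<in> rows {1..a} {1..b}" for u
      using L block_of_mem[OF d that] unfolding sat_def closed_under_def by blast
    then show "sat (fib a b (\<lambda>i. block_of d (0, i)) (\<lambda>j. block_of d (1, j))) P Q"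
      by (intro sat_fibI[where \<chi> = "\<lambda>B. B \<subseteq> rows P Q"]) (metis in_rows zero_neq_one)+
  next
    assume "sat (fib a b (\<lambda>i. block_of d (0, i)) (\<lambda>j. block_of d (1, j))) P Q"
    then obtain \<chi> where \<chi>: "\<And>i. i \<in> {1..a} \<Longrightarrow> i \<in> P \<longleftrightarrow> \<chi> (block_of d (0, i))"
        "\<And>j. j \<in> {1..b} \<Longrightarrow> j \<in> Q \<longleftrightarrow> \<chi> (block_of d (1, j))"
      by (rule sat_fibE) blast
    have "u \<in> rows P Q \<longleftrightarrow> \<chi> B" if "B \<in> d" "u \<in> B" for B u
    proof -
      have "u \<in> rows {1..a} {1..b}" using p that unfolding partition_on_def by blast
      then show ?thesis using \<chi> block_of_eq[OF d that] by (auto simp: rows_def)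
    qed
    then show "sat d P Q" unfolding sat_def closed_under_def by blast
  qed
qed

lemma dgm_cases:
  assumes "d \<in> dgms a b"
  obtains f g :: "nat \<Rightarrow> vertex set" where "d = fib a b f g"
  using dgm_eq_fib[OF assms] by blast

text \<open>
  The morphisms of the category in which the \<open>k\<close>-th partition algebras live: the flag \<open>s\<close>
  marks half-integral indices, where the last points of both rows are joined.
\<close>

definition mor :: "bool \<Rightarrow> nat \<Rightarrow> nat \<Rightarrow> diagram set" where
  "mor s a b = {d \<in> dgms a b. s \<longrightarrow> (\<exists>B\<in>d. (0, a) \<in> B \<and> (1, b) \<in> B)}"

lemma mor_dgms: "d \<in> mor s a b \<Longrightarrow> d \<in> dgms a b"
  by (simp add: mor_def)

lemma mor_last:
  assumes "d \<in> mor True a b" and "sat d P Q" shows "a \<in> P \<longleftrightarrow> b \<in> Q"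
proof -
  obtain B where "B \<in> d" "(0, a) \<in> B" "(1, b) \<in> B" using assms by (auto simp: mor_def)
  then have "(0, a) \<in> rows P Q \<longleftrightarrow> (1, b) \<in> rows P Q"
    using assms(2) unfolding sat_def closed_under_def by blast
  then show ?thesis by simp
qed

text \<open>Apply the hypothesis to the two traces of the block of the last top point: this block is
  saturated, so it must contain the last bottom point as well.\<close>

lemma mor_lastI:
  assumes d: "d \<in> dgms a b" and "1 \<le> a"
    and last: "\<And>P Q. P \<subseteq> {1..a} \<Longrightarrow> Q \<subseteq> {1..b} \<Longrightarrow> sat d P Q \<Longrightarrow> a \<in> P \<Longrightarrow> b \<in> Q"
  shows "d \<in> mor s a b"
proof -
  have p: "partition_on (rows {1..a} {1..b}) d" using d by (simp add: dgms_def)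
  let ?B = "block_of d (0, a)"
  have B: "?B \<in> d" "(0, a) \<in> ?B"
    using block_of_mem[OF d, of "(0, a)"] \<open>1 \<le> a\<close> by auto
  have Bs: "?B \<subseteq> rows {1..a} {1..b}" using B p unfolding partition_on_def by blast
  define P Q where "P = {i. (0, i) \<in> ?B}" and "Q = {i. (1, i) \<in> ?B}"
  have "P \<subseteq> {1..a}" "Q \<subseteq> {1..b}" using Bs unfolding P_def Q_def by (auto simp: rows_def)
  moreover have "sat d P Q"
  proof -
    have "?B = rows P Q" using vertex_set_eq_rows[OF Bs] by (simp add: P_def Q_def)
    moreover have "closed_under d ?B"
      unfolding closed_under_def using block_of_eq[OF d] B(1) by metis
    ultimately show ?thesis by (simp add: sat_def)
  qed
  moreover have "a \<in> P" using B by (simp add: P_def)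
  ultimately have "b \<in> Q" by (rule last)
  then show ?thesis using d B by (auto simp: mor_def Q_def)
qed

lemma fib_mor:
  assumes "s \<Longrightarrow> 1 \<le> a \<and> 1 \<le> b \<and> f a = g b" shows "fib a b f g \<in> mor s a b"
proof (cases s)
  case True
  have "b \<in> Q" if "sat (fib a b f g) P Q" "a \<in> P" for P Q
    using that assms True by (elim sat_fibE) auto
  then show ?thesis using assms True by (intro mor_lastI) auto
qed (simp add: mor_def)

lemma mor_cases:
  assumes d: "d \<in> mor s a b" and "s \<Longrightarrow> 1 \<le> a \<and> 1 \<le> b"
  obtains f g :: "nat \<Rightarrow> vertex set" where "d = fib a b f g" "s \<Longrightarrow> f a = g b"
proof
  show "d = fib a b (\<lambda>i. block_of d (0, i)) (\<lambda>j. block_of d (1, j))"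
    using dgm_eq_fib[OF mor_dgms[OF d]] .
  assume s
  then obtain B where "B \<in> d" "(0, a) \<in> B" "(1, b) \<in> B" using d by (auto simp: mor_def)
  then show "block_of d (0, a) = block_of d (1, b)"
    using block_of_eq[OF mor_dgms[OF d]] by metis
qed

lemma diag_comp_mor:
  assumes "d1 \<in> mor s a b" and "d2 \<in> mor s b c" and "s \<Longrightarrow> 1 \<le> a"
  shows "diag_comp d1 d2 \<in> mor s a c"
proof (cases s)
  case True
  have d: "d1 \<in> dgms a b" "d2 \<in> dgms b c" using assms by (auto simp: mor_def)
  have dT: "d1 \<in> mor True a b" "d2 \<in> mor True b c" using assms True by simp_all
  show ?thesis
  proof (rule mor_lastI)
    fix P Q assume "sat (diag_comp d1 d2) P Q" "a \<in> P"
    then show "c \<in> Q"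
      using mor_last[of d1 a b P] mor_last[of d2 b c _ Q] dT
      unfolding exists_middle_iff[OF d] by blast
  qed (use assms True d diag_comp_dgms in auto)
qed (use assms diag_comp_dgms in \<open>auto simp: mor_def\<close>)

lemma composes_mor:
  assumes "composes a b c d1 d2 l d3" "d1 \<in> mor s a b" and "d2 \<in> mor s b c" and "s \<Longrightarrow> 1 \<le> a"
  shows "d3 \<in> mor s a c"
  using diag_comp_mor[OF assms(2-4)] composesD[OF assms(1)] by simp

lemma flip_mor: "d \<in> mor s a b \<Longrightarrow> flip d \<in> mor s b a"
proof -
  assume d: "d \<in> mor s a b"
  show "flip d \<in> mor s b a"
  proof (cases s)
    case True
    then obtain B where B: "B \<in> d" "(0, a) \<in> B" "(1, b) \<in> B" using d by (auto simp: mor_def)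
    let ?B = "(\<lambda>(r, i). (1 - r, i)) ` B"
    have "(0, b) \<in> ?B" "(1, a) \<in> ?B" using B by (force, force)
    moreover have "?B \<in> flip d" using B(1) by (simp add: flip_def)
    ultimately show ?thesis using flip_dgms[OF mor_dgms[OF d]] unfolding mor_def by blast
  qed (use d flip_dgms in \<open>auto simp: mor_def\<close>)
qed

section \<open>Factorizations\<close>

text \<open>
  Every morphism from \<open>M + 1\<close> to \<open>M\<close> points is \<open>a \<rho>\<close> with \<open>a\<close> von Neumann regular, without any
  removed component: \<open>a\<close> keeps the top blocks and joins the bottom points that do not propagate
  to the last top point, and \<open>\<rho>\<close> restores the bottom blocks. This fails for \<open>M = 0\<close>.
\<close>

lemma regular_factorization:
  assumes N: "N = Suc M" and M: "1 \<le> M" and \<alpha>: "\<alpha> \<in> mor s N M"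
  obtains a \<rho> v \<sigma> where "a \<in> mor s N M" "\<rho> \<in> mor s M M" "v \<in> mor s M N"
    "composes N M M a \<rho> 0 \<alpha>" "composes M N M v a 0 \<sigma>" "composes N M M a \<sigma> 0 a"
proof -
  obtain f g :: "nat \<Rightarrow> vertex set" where fg: "\<alpha> = fib N M f g" and last: "s \<Longrightarrow> f N = g M"
    using mor_cases[OF \<alpha>] M N by auto
  define prp where "prp j \<longleftrightarrow> g j \<in> f ` {1..N}" for j
  \<comment> \<open>A top point in the block of the bottom point \<open>j\<close>. A point that does
    not propagate gets the default \<open>N\<close>: left alone, it would cause a removed component
    in the composite of \<open>?a\<close> and \<open>?\<rho>\<close>.\<close>
  define tp where "tp j = (if prp j then SOME i. i \<in> {1..N} \<and> f i = g j else N)" for j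
  \<comment> \<open>The point \<open>M\<close> is preferred as representative, so that for
    half-integral indices \<open>\<phi>\<close> sends the last top point to the last bottom point
    and \<open>?v\<close> is a morphism.\<close>
  define rep where "rep x = (if g M = x then M else SOME j. j \<in> {1..M} \<and> g j = x)" for x
  \<comment> \<open>The target for top blocks without bottom points. It is a nonpropagating point
    whenever one exists, so that \<open>tp\<close> sends it back to \<open>N\<close>; otherwise 1 is
    only a filler, available because 1 \<le> M.\<close>
  define j0 where "j0 = (if \<exists>j\<in>{1..M}. \<not> prp j then SOME j. j \<in> {1..M} \<and> \<not> prp j else 1)"
  define \<phi> where "\<phi> i = (if f i \<in> g ` {1..M} then rep (f i) else j0)" for i
  have tp: "tp j \<in> {1..N} \<and> f (tp j) = g j" if "prp j" for j
  proof -
    have "\<exists>i. i \<in> {1..N} \<and> f i = g j" using that by (auto simp: prp_def)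
    from someI_ex[OF this] show ?thesis using that by (simp add: tp_def)
  qed
  have tp': "\<not> prp j \<Longrightarrow> tp j = N" for j by (simp add: tp_def)
  have tpN: "tp j \<in> {1..N}" for j using tp[of j] tp'[of j] N by (cases "prp j") auto
  have rep: "rep x \<in> {1..M} \<and> g (rep x) = x" if "x \<in> g ` {1..M}" for x
  proof (cases "g M = x")
    case False
    have "\<exists>j. j \<in> {1..M} \<and> g j = x" using that by auto
    from someI_ex[OF this] show ?thesis using False by (simp add: rep_def)
  qed (use M in \<open>simp add: rep_def\<close>)
  have j0: "j0 \<in> {1..M} \<and> (\<forall>j\<in>{1..M}. \<not> prp j \<longrightarrow> \<not> prp j0)"
  proof (cases "\<exists>j\<in>{1..M}. \<not> prp j")
    case True
    then have "\<exists>j. j \<in> {1..M} \<and> \<not> prp j" by blast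
    from someI_ex[OF this] show ?thesis using True by (simp add: j0_def)
  qed (use M in \<open>simp add: j0_def\<close>)
  have \<phi>M: "\<phi> i \<in> {1..M}" for i using rep j0 by (simp add: \<phi>_def)
  have \<phi>f: "\<phi> i = \<phi> i'" if "f i = f i'" for i i' using that by (simp add: \<phi>_def)
  \<comment> \<open>The identity a v a = a on the level of labels. In the second case the block of
    \<open>N\<close> does not propagate, \<open>tp j\<close> is \<open>N\<close>, and both
    \<open>j\<close> and \<open>j0\<close> are tied to \<open>N\<close>.\<close>
  have tp\<phi>: "f (tp (\<phi> (tp j))) = f (tp j)" if j: "j \<in> {1..M}" for j
  proof (cases "f (tp j) \<in> g ` {1..M}")
    case True
    then have "prp (\<phi> (tp j))" "g (\<phi> (tp j)) = f (tp j)"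
      using rep[OF True] tpN[of j] by (auto simp: prp_def \<phi>_def)
    then show ?thesis using tp by simp
  next
    case False
    then have np: "\<not> prp j" using tp[of j] j by force
    then have "\<not> prp (\<phi> (tp j))" using j0 j False by (auto simp: \<phi>_def)
    then show ?thesis using tp' np by simp
  qed
  let ?a = "fib N M f (f \<circ> tp)"
  \<comment> \<open>The label \<open>None\<close> gathers the middle points that were tied to
    \<open>N\<close> by default and keeps them away from the bottom blocks, all of which carry
    labels of the form \<open>Some x\<close>.\<close>
  let ?\<rho> = "fib M M (\<lambda>j. if prp j then Some (g j) else None) (\<lambda>j. Some (g j))"
  let ?v = "fib M N id \<phi>"
  let ?\<sigma> = "fib M M id (\<phi> \<circ> tp)"
  show ?thesis
  proof
    have prpM: "prp M" if s using last[OF that] N by (auto simp: prp_def intro!: image_eqI[of _ _ N])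
    show "?a \<in> mor s N M" using tp[of M] prpM M N last by (intro fib_mor) auto
    show "?\<rho> \<in> mor s M M" using prpM M by (intro fib_mor) auto
    show "?v \<in> mor s M N" using last M N by (intro fib_mor) (auto simp: \<phi>_def rep_def)
    show "composes N M M ?a ?\<rho> 0 \<alpha>"
      unfolding fg
    proof (rule composesI[where \<rho> = "\<lambda>P Q. {j \<in> {1..M}. tp j \<in> P}"])
      fix P R Q :: "nat set" assume sub: "P \<subseteq> {1..N}" "R \<subseteq> {1..M}" "Q \<subseteq> {1..M}"
      show "sat ?a P R \<and> sat ?\<rho> R Q \<longleftrightarrow> sat (fib N M f g) P Q \<and> R = {j \<in> {1..M}. tp j \<in> P}"
      proof (intro iffI conjI; elim conjE)
        assume a: "sat ?a P R" and r: "sat ?\<rho> R Q"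
        from a obtain \<chi> where \<chi>: "\<And>i. i \<in> {1..N} \<Longrightarrow> i \<in> P \<longleftrightarrow> \<chi> (f i)"
          "\<And>j. j \<in> {1..M} \<Longrightarrow> j \<in> R \<longleftrightarrow> \<chi> (f (tp j))" by (elim sat_fibE) auto
        from r obtain \<psi> where \<psi>: "\<And>j. j \<in> {1..M} \<Longrightarrow> j \<in> R \<longleftrightarrow> \<psi> (if prp j then Some (g j) else None)"
          "\<And>j. j \<in> {1..M} \<Longrightarrow> j \<in> Q \<longleftrightarrow> \<psi> (Some (g j))" by (elim sat_fibE) auto
        show "R = {j \<in> {1..M}. tp j \<in> P}" using \<chi> tpN sub(2) by blast
        \<comment> \<open>Labels that occur on top follow \<open>\<chi>\<close>, those that occur
          only at the bottom follow \<open>\<psi>\<close>. On a propagating label the two agree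
          because its middle points belong to both factors.\<close>
        show "sat (fib N M f g) P Q"
        proof (rule sat_fibI[where \<chi> = "\<lambda>x. if x \<in> f ` {1..N} then \<chi> x else \<psi> (Some x)"])
          show "j \<in> Q \<longleftrightarrow> (if g j \<in> f ` {1..N} then \<chi> (g j) else \<psi> (Some (g j)))" if "j \<in> {1..M}" for j
            using \<chi>(2)[OF that] \<psi>[OF that] tp[of j] by (auto simp: prp_def)
        qed (use \<chi> in simp)
      next
        assume R: "R = {j \<in> {1..M}. tp j \<in> P}" and "sat (fib N M f g) P Q"
        then obtain \<chi> where \<chi>: "\<And>i. i \<in> {1..N} \<Longrightarrow> i \<in> P \<longleftrightarrow> \<chi> (f i)"
          "\<And>j. j \<in> {1..M} \<Longrightarrow> j \<in> Q \<longleftrightarrow> \<chi> (g j)" by (elim sat_fibE) auto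
        show "sat ?a P R" using \<chi>(1) tpN R by (intro sat_fibI[where \<chi> = \<chi>]) auto
        show "sat ?\<rho> R Q"
          using \<chi> tpN tp tp' R
          by (intro sat_fibI[where \<chi> = "\<lambda>x. case x of None \<Rightarrow> \<chi> (f N) | Some x \<Rightarrow> \<chi> x"]) auto
      qed
    qed auto
    show "composes M N M ?v ?a 0 ?\<sigma>"
    proof (rule composesI[where \<rho> = "\<lambda>P Q. {i \<in> {1..N}. \<phi> i \<in> P}"])
      fix P R Q :: "nat set" assume sub: "P \<subseteq> {1..M}" "R \<subseteq> {1..N}" "Q \<subseteq> {1..M}"
      show "sat ?v P R \<and> sat ?a R Q \<longleftrightarrow> sat ?\<sigma> P Q \<and> R = {i \<in> {1..N}. \<phi> i \<in> P}"
      proof (intro iffI conjI; elim conjE)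
        assume v: "sat ?v P R" and a: "sat ?a R Q"
        from v have R: "\<And>i. i \<in> {1..N} \<Longrightarrow> i \<in> R \<longleftrightarrow> \<phi> i \<in> P" using \<phi>M by (elim sat_fibE) auto
        from a have Q: "\<And>j. j \<in> {1..M} \<Longrightarrow> j \<in> Q \<longleftrightarrow> tp j \<in> R" using tpN by (elim sat_fibE) auto
        show "R = {i \<in> {1..N}. \<phi> i \<in> P}" using R sub(2) by blast
        show "sat ?\<sigma> P Q" using R Q tpN by (intro sat_fibI[where \<chi> = "\<lambda>j. j \<in> P"]) auto
      next
        assume R: "R = {i \<in> {1..N}. \<phi> i \<in> P}" and "sat ?\<sigma> P Q"
        then have Q: "\<And>j. j \<in> {1..M} \<Longrightarrow> j \<in> Q \<longleftrightarrow> \<phi> (tp j) \<in> P" using \<phi>M by (elim sat_fibE) auto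
        show "sat ?v P R" using R by (intro sat_fibI[where \<chi> = "\<lambda>j. j \<in> P"]) auto
        \<comment> \<open>\<open>\<phi>\<close> depends only on the label, so it can be evaluated at
          any point that carries it; this makes it a predicate on labels.\<close>
        have *: "\<phi> (SOME i. f i = f i') = \<phi> i'" for i'
          using \<phi>f someI[of "\<lambda>i. f i = f i'" i'] by blast
        show "sat ?a R Q"
          using R Q tpN * by (intro sat_fibI[where \<chi> = "\<lambda>x. \<phi> (SOME i. f i = x) \<in> P"]) auto
      qed
    qed auto
    show "composes N M M ?a ?\<sigma> 0 ?a"
    proof (rule composesI[where \<rho> = "\<lambda>P Q. {j \<in> {1..M}. tp j \<in> P}"])
      fix P R Q :: "nat set" assume sub: "P \<subseteq> {1..N}" "R \<subseteq> {1..M}" "Q \<subseteq> {1..M}"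
      show "sat ?a P R \<and> sat ?\<sigma> R Q \<longleftrightarrow> sat ?a P Q \<and> R = {j \<in> {1..M}. tp j \<in> P}"
      proof (intro iffI conjI; elim conjE)
        assume a: "sat ?a P R" and r: "sat ?\<sigma> R Q"
        from a obtain \<chi> where \<chi>: "\<And>i. i \<in> {1..N} \<Longrightarrow> i \<in> P \<longleftrightarrow> \<chi> (f i)"
          "\<And>j. j \<in> {1..M} \<Longrightarrow> j \<in> R \<longleftrightarrow> \<chi> (f (tp j))" by (elim sat_fibE) auto
        from r have Q: "\<And>j. j \<in> {1..M} \<Longrightarrow> j \<in> Q \<longleftrightarrow> \<phi> (tp j) \<in> R" using \<phi>M by (elim sat_fibE) auto
        show "R = {j \<in> {1..M}. tp j \<in> P}" using \<chi> tpN sub(2) by blast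
        show "sat ?a P Q"
          using \<chi> Q \<phi>M tp\<phi> by (intro sat_fibI[where \<chi> = \<chi>]) (auto simp del: atLeastAtMost_iff)
      next
        assume R: "R = {j \<in> {1..M}. tp j \<in> P}" and "sat ?a P Q"
        then obtain \<chi> where \<chi>: "\<And>i. i \<in> {1..N} \<Longrightarrow> i \<in> P \<longleftrightarrow> \<chi> (f i)"
          "\<And>j. j \<in> {1..M} \<Longrightarrow> j \<in> Q \<longleftrightarrow> \<chi> (f (tp j))" by (elim sat_fibE) auto
        show "sat ?a P R" using \<chi>(1) tpN R by (intro sat_fibI[where \<chi> = \<chi>]) auto
        show "sat ?\<sigma> R Q"
          using \<chi> tpN tp\<phi> R \<phi>M
          by (intro sat_fibI[where \<chi> = "\<lambda>j. j \<in> R"]) (auto simp del: atLeastAtMost_iff)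
      qed
    qed auto
  qed
qed

section \<open>Propagating number and factorization through fewer points\<close>

lemma pn_fib: "pn (fib a b f g) = card (f ` {1..a} \<inter> g ` {1..b})"
proof -
  let ?F = "\<lambda>x. rows {i \<in> {1..a}. f i = x} {j \<in> {1..b}. g j = x}"
  have "(\<exists>i. (0, i) \<in> ?F x) \<longleftrightarrow> x \<in> f ` {1..a}" "(\<exists>j. (1, j) \<in> ?F x) \<longleftrightarrow> x \<in> g ` {1..b}" for x
    by auto
  then have "{B \<in> fib a b f g. (\<exists>i. (0, i) \<in> B) \<and> (\<exists>j. (1, j) \<in> B)} = ?F ` (f ` {1..a} \<inter> g ` {1..b})"
    unfolding fib_def by blast
  moreover have "inj_on ?F (f ` {1..a} \<inter> g ` {1..b})"
  proof (rule inj_onI)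
    fix x y assume "x \<in> f ` {1..a} \<inter> g ` {1..b}" and eq: "?F x = ?F y"
    then obtain i where "i \<in> {1..a}" "f i = x" by blast
    then have "(0, i) \<in> ?F x" by simp
    then show "x = y" using \<open>f i = x\<close> unfolding eq by simp
  qed
  ultimately show ?thesis by (simp add: pn_def card_image)
qed

text \<open>Used to give every propagating block its own middle point, with the block of the last
  column passing through the last middle point so that both factors remain morphisms.\<close>

lemma ex_inj_on_with_value:
  assumes "finite L" and "card L \<le> M"
  obtains \<beta> where "inj_on \<beta> L" "\<beta> ` L \<subseteq> {1..M}" "x0 \<in> L \<Longrightarrow> \<beta> x0 = (M :: nat)"
proof -
  obtain h where h: "inj_on h L" "h ` L \<subseteq> {1..M}"
    using inj_on_iff_card_le[OF assms(1), of "{1..M}"] assms(2) by auto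
  \<comment> \<open>The transposition of \<open>h x0\<close> and \<open>M\<close>, applied after an
    arbitrary injection.\<close>
  define t where "t y = (if y = h x0 then M else if y = M then h x0 else y)" for y
  define \<beta> where "\<beta> = (if x0 \<in> L then t \<circ> h else h)"
  have "inj t" by (rule injI) (auto simp: t_def split: if_splits)
  show thesis
  proof
    show "inj_on \<beta> L"
      using h(1) inj_on_subset[OF \<open>inj t\<close>] by (auto simp: \<beta>_def intro: comp_inj_on)
    show "\<beta> ` L \<subseteq> {1..M}"
    proof (cases "x0 \<in> L")
      case True
      then have "h x0 \<in> {1..M}" using h(2) by blast
      then show ?thesis using h(2) True by (auto simp: \<beta>_def t_def image_subset_iff)
    qed (use h(2) in \<open>simp add: \<beta>_def\<close>)
  qed (simp add: \<beta>_def t_def)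
qed

text \<open>At most \<open>M\<close> blocks propagate, so each can be routed through a middle point
  of its own, chosen by \<open>\<beta>\<close>. The last conclusion recovers the left factor from
  \<open>d\<close> by a right multiplication; this makes it comparable with any other left factor of
  \<open>d\<close>.\<close>

lemma rank_factorization:
  assumes N: "N = Suc M" and d: "d \<in> mor s N N" and pn: "pn d \<le> M" and s: "s \<Longrightarrow> 1 \<le> M"
  obtains a c where "a \<in> mor s N M" "c \<in> mor s M N" "composes N M N a c 0 d"
    "1 \<le> M \<Longrightarrow> \<exists>w\<in>mor s N M. composes N N M d w 0 a"
proof -
  obtain f g :: "nat \<Rightarrow> vertex set" where fg: "d = fib N N f g" and last: "s \<Longrightarrow> f N = g N"
    using mor_cases[OF d] N by auto
  let ?L = "f ` {1..N} \<inter> g ` {1..N}"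
  obtain \<beta> where \<beta>: "inj_on \<beta> ?L" "\<beta> ` ?L \<subseteq> {1..M}" "f N \<in> ?L \<Longrightarrow> \<beta> (f N) = M"
    using ex_inj_on_with_value[of ?L M "f N"] pn by (auto simp: fg pn_fib)
  define used where "used j \<longleftrightarrow> j \<in> \<beta> ` ?L" for j
  define lab where "lab = inv_into ?L \<beta>"
  have lab: "lab j \<in> ?L" "\<beta> (lab j) = j" if "used j" for j
    using that unfolding used_def lab_def by (rule inv_into_into, rule f_inv_into_f)
  have lab\<beta>: "lab (\<beta> x) = x" "used (\<beta> x)" if "x \<in> ?L" for x
    using that inv_into_f_f[OF \<beta>(1)] unfolding used_def lab_def by blast+
  define tp where "tp j = (SOME i. i \<in> {1..N} \<and> f i = lab j)" for j
  \<comment> \<open>A middle point that no block uses stands alone in \<open>?a\<close> and is tied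
    in \<open>?c\<close> to the bottom block of \<open>N\<close>, so it is not removed.\<close>
  define bt where "bt j = (if used j then SOME i. i \<in> {1..N} \<and> g i = lab j else N)" for j
  \<comment> \<open>Bottom points outside the propagating blocks all go to the middle point 1.
    Otherwise their blocks would be removed components of the stack of \<open>d\<close> and
    \<open>?w\<close>; this is why the last conclusion asks for 1 \<le> M.\<close>
  define \<gamma> where "\<gamma> i = (if g i \<in> ?L then \<beta> (g i) else 1)" for i
  have tp: "tp j \<in> {1..N} \<and> f (tp j) = lab j" if "used j" for j
  proof -
    have "\<exists>i. i \<in> {1..N} \<and> f i = lab j" using lab(1)[OF that] by auto
    from someI_ex[OF this] show ?thesis by (simp add: tp_def)
  qed
  have bt: "bt j \<in> {1..N} \<and> g (bt j) = lab j" if "used j" for j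
  proof -
    have "\<exists>i. i \<in> {1..N} \<and> g i = lab j" using lab(1)[OF that] by auto
    from someI_ex[OF this] show ?thesis using that by (simp add: bt_def)
  qed
  have btN: "bt j \<in> {1..N}" for j using bt[of j] N by (cases "used j") (auto simp: bt_def)
  have usedM: "used M" "lab M = f N" "\<gamma> N = M" if s
  proof -
    have "f N \<in> ?L" using last[OF that] N by auto
    then show "used M" "lab M = f N" "\<gamma> N = M"
      using \<beta>(3) lab\<beta>[of "f N"] last[OF that] by (simp_all add: \<gamma>_def)
  qed
  let ?a = "fib N M (\<lambda>i. Inl (f i)) (\<lambda>j. if used j then Inl (lab j) else Inr j)"
  let ?c = "fib M N (g \<circ> bt) g"
  let ?w = "fib N M \<gamma> id"
  show ?thesis
  proof
    show "?a \<in> mor s N M" using usedM s N by (intro fib_mor) auto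
    show "?c \<in> mor s M N" using usedM last s N bt[of M] by (intro fib_mor) auto
    show "composes N M N ?a ?c 0 d"
      unfolding fg
    proof (rule composesI[where \<rho> = "\<lambda>P Q. {j \<in> {1..M}. bt j \<in> Q}"])
      fix P R Q :: "nat set" assume sub: "P \<subseteq> {1..N}" "R \<subseteq> {1..M}" "Q \<subseteq> {1..N}"
      show "sat ?a P R \<and> sat ?c R Q \<longleftrightarrow> sat (fib N N f g) P Q \<and> R = {j \<in> {1..M}. bt j \<in> Q}"
      proof (intro iffI conjI; elim conjE)
        assume a: "sat ?a P R" and c: "sat ?c R Q"
        from a obtain \<chi> where \<chi>: "\<And>i. i \<in> {1..N} \<Longrightarrow> i \<in> P \<longleftrightarrow> \<chi> (Inl (f i))"
          "\<And>j. j \<in> {1..M} \<Longrightarrow> j \<in> R \<longleftrightarrow> \<chi> (if used j then Inl (lab j) else Inr j)"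
          by (elim sat_fibE) auto
        from c obtain \<psi> where \<psi>: "\<And>j. j \<in> {1..M} \<Longrightarrow> j \<in> R \<longleftrightarrow> \<psi> (g (bt j))"
          "\<And>j. j \<in> {1..N} \<Longrightarrow> j \<in> Q \<longleftrightarrow> \<psi> (g j)" by (elim sat_fibE) auto
        show "R = {j \<in> {1..M}. bt j \<in> Q}" using \<psi> btN sub(2) by blast
        show "sat (fib N N f g) P Q"
        proof (rule sat_fibI[where \<chi> = "\<lambda>x. if x \<in> f ` {1..N} then \<chi> (Inl x) else \<psi> x"])
          fix j assume j: "j \<in> {1..N}"
          show "j \<in> Q \<longleftrightarrow> (if g j \<in> f ` {1..N} then \<chi> (Inl (g j)) else \<psi> (g j))"
          proof (cases "g j \<in> f ` {1..N}")
            case True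
            then have L: "g j \<in> ?L" using j by blast
            then have M: "\<beta> (g j) \<in> {1..M}" using \<beta>(2) by blast
            show ?thesis
              using True \<chi>(2)[OF M] \<psi>(1)[OF M] \<psi>(2)[OF j] lab\<beta>[OF L] bt[OF lab\<beta>(2)[OF L]] by simp
          qed (use \<psi>(2)[OF j] in simp)
        qed (use \<chi> in simp)
      next
        assume R: "R = {j \<in> {1..M}. bt j \<in> Q}" and "sat (fib N N f g) P Q"
        then obtain \<chi> where \<chi>: "\<And>i. i \<in> {1..N} \<Longrightarrow> i \<in> P \<longleftrightarrow> \<chi> (f i)"
          "\<And>j. j \<in> {1..N} \<Longrightarrow> j \<in> Q \<longleftrightarrow> \<chi> (g j)" by (elim sat_fibE) auto
        show "sat ?a P R"
          using \<chi> btN bt R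
          by (intro sat_fibI[where \<chi> = "\<lambda>x. case x of Inl y \<Rightarrow> \<chi> y | Inr j \<Rightarrow> j \<in> R"]) auto
        show "sat ?c R Q" using \<chi>(2) btN R by (intro sat_fibI[where \<chi> = \<chi>]) auto
      qed
    qed auto
    show "\<exists>w\<in>mor s N M. composes N N M d w 0 ?a" if M: "1 \<le> M"
    proof
      have \<gamma>M: "\<gamma> i \<in> {1..M}" for i
      using \<beta>(2) M unfolding \<gamma>_def by (cases "g i \<in> ?L") (simp_all add: image_subset_iff)
      have \<gamma>g: "\<gamma> i = \<gamma> i'" if "g i = g i'" for i i' using that by (simp add: \<gamma>_def)
      show "?w \<in> mor s N M" using usedM M N by (intro fib_mor) auto
      show "composes N N M d ?w 0 ?a"
        unfolding fg
      proof (rule composesI[where \<rho> = "\<lambda>P Q. {i \<in> {1..N}. \<gamma> i \<in> Q}"])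
        fix P R Q :: "nat set" assume sub: "P \<subseteq> {1..N}" "R \<subseteq> {1..N}" "Q \<subseteq> {1..M}"
        show "sat (fib N N f g) P R \<and> sat ?w R Q \<longleftrightarrow> sat ?a P Q \<and> R = {i \<in> {1..N}. \<gamma> i \<in> Q}"
        proof (intro iffI conjI; elim conjE)
          assume d: "sat (fib N N f g) P R" and w: "sat ?w R Q"
          from d obtain \<chi> where \<chi>: "\<And>i. i \<in> {1..N} \<Longrightarrow> i \<in> P \<longleftrightarrow> \<chi> (f i)"
            "\<And>j. j \<in> {1..N} \<Longrightarrow> j \<in> R \<longleftrightarrow> \<chi> (g j)" by (elim sat_fibE) auto
          from w have w: "\<And>i. i \<in> {1..N} \<Longrightarrow> i \<in> R \<longleftrightarrow> \<gamma> i \<in> Q" using \<gamma>M by (elim sat_fibE) auto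
          show "R = {i \<in> {1..N}. \<gamma> i \<in> Q}" using w sub(2) by blast
          show "sat ?a P Q"
          proof (rule sat_fibI[where \<chi> = "\<lambda>x. case x of Inl y \<Rightarrow> \<chi> y | Inr j \<Rightarrow> j \<in> Q"])
            fix j assume "j \<in> {1..M}"
            have "\<gamma> (bt j) = j" if "used j"
              using bt[OF that] lab[OF that] by (simp add: \<gamma>_def)
            then show "j \<in> Q \<longleftrightarrow> (case if used j then Inl (lab j) else Inr j of
                Inl y \<Rightarrow> \<chi> y | Inr j \<Rightarrow> j \<in> Q)"
              using \<chi>(2)[of "bt j"] w[of "bt j"] bt[of j] by (cases "used j") simp_all
          qed (use \<chi> in simp)
        next
          assume R: "R = {i \<in> {1..N}. \<gamma> i \<in> Q}" and "sat ?a P Q"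
          then obtain \<chi> where \<chi>: "\<And>i. i \<in> {1..N} \<Longrightarrow> i \<in> P \<longleftrightarrow> \<chi> (Inl (f i))"
            "\<And>j. j \<in> {1..M} \<Longrightarrow> j \<in> Q \<longleftrightarrow> \<chi> (if used j then Inl (lab j) else Inr j)"
            by (elim sat_fibE) auto
          \<comment> \<open>A label that occurs only at the bottom takes the status of the point 1,
            to which \<open>\<gamma>\<close> ties it.\<close>
          show "sat (fib N N f g) P R"
          proof (rule sat_fibI[where \<chi> = "\<lambda>x. if x \<in> f ` {1..N} then \<chi> (Inl x) else 1 \<in> Q"])
            fix j assume j: "j \<in> {1..N}"
            show "j \<in> R \<longleftrightarrow> (if g j \<in> f ` {1..N} then \<chi> (Inl (g j)) else 1 \<in> Q)"
            proof (cases "g j \<in> f ` {1..N}")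
              case True
              then have L: "g j \<in> ?L" using j by blast
              then have "\<gamma> j = \<beta> (g j)" by (simp add: \<gamma>_def)
              then show ?thesis using True R j \<chi>(2)[OF \<gamma>M[of j]] lab\<beta>[OF L] by simp
            qed (use R j in \<open>simp add: \<gamma>_def\<close>)
          qed (use \<chi> in simp)
          show "sat ?w R Q" using R by (intro sat_fibI[where \<chi> = "\<lambda>j. j \<in> Q"]) auto
        qed
      qed auto
    qed
  qed
qed

lemma closed_under_Diff: "closed_under \<B> S \<Longrightarrow> closed_under \<B> T \<Longrightarrow> closed_under \<B> (S - T)"
  unfolding closed_under_def by blast

lemma closed_under_UN: "(\<And>x. x \<in> X \<Longrightarrow> closed_under \<B> (S x)) \<Longrightarrow> closed_under \<B> (\<Union>x\<in>X. S x)"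
  unfolding closed_under_def by blast

lemma sat_Diff_UN:
  assumes "sat d P Q" and "\<And>x. x \<in> X \<Longrightarrow> sat d (S x) (T x)"
  shows "sat d (P - (\<Union>x\<in>X. S x)) (Q - (\<Union>x\<in>X. T x))"
proof -
  have "rows (P - (\<Union>x\<in>X. S x)) (Q - (\<Union>x\<in>X. T x)) = rows P Q - (\<Union>x\<in>X. rows (S x) (T x))"
    by (auto simp: rows_def)
  then show ?thesis
    using assms unfolding sat_def by (auto intro!: closed_under_Diff closed_under_UN)
qed

text \<open>
  Distinct propagating blocks of a composite leave disjoint nonempty traces in the middle row.
\<close>

lemma pn_diag_comp_le:
  assumes d1: "d1 \<in> dgms a b" and d2: "d2 \<in> dgms b c"
  shows "pn (diag_comp d1 d2) \<le> b"
proof -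
  obtain f g :: "nat \<Rightarrow> vertex set" where fg: "diag_comp d1 d2 = fib a c f g"
    using dgm_cases[OF diag_comp_dgms[OF d1 d2]] by blast
  let ?L = "f ` {1..a} \<inter> g ` {1..c}"
  let ?P = "\<lambda>x. {i \<in> {1..a}. f i = x}" and ?Q = "\<lambda>x. {j \<in> {1..c}. g j = x}"
  have "sat (diag_comp d1 d2) (?P x) (?Q x)" for x
    unfolding fg by (rule sat_fibI[where \<chi> = "\<lambda>y. y = x"]) auto
  then have "\<forall>x. \<exists>R\<subseteq>{1..b}. sat d1 (?P x) R \<and> sat d2 R (?Q x)"
    using exists_middle_iff[OF d1 d2] by blast
  from choice[OF this] obtain R
    where R: "\<And>x. R x \<subseteq> {1..b}" "\<And>x. sat d1 (?P x) (R x)" "\<And>x. sat d2 (R x) (?Q x)"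
    by blast
  \<comment> \<open>Taking away the traces of the other blocks makes the traces disjoint. The top
    parts of different blocks are already disjoint, so \<open>R' x\<close> is still matched with the
    top part of \<open>x\<close>.\<close>
  define R' where "R' x = R x - (\<Union>y\<in>?L - {x}. R y)" for x
  have "\<exists>j. j \<in> R' x" if x: "x \<in> ?L" for x
  proof (rule ccontr)
    assume "\<nexists>j. j \<in> R' x"
    \<comment> \<open>With an empty trace the top part of \<open>x\<close> would be saturated for
      the composite together with no bottom point at all, although \<open>x\<close> also labels a
      bottom point.\<close>
    then have 1: "R' x = {}" by blast
    have 2: "?P x - (\<Union>y\<in>?L - {x}. ?P y) = ?P x" by auto
    have "sat d1 (?P x - (\<Union>y\<in>?L - {x}. ?P y)) (R' x)"
      unfolding R'_def by (intro sat_Diff_UN R(2))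
    then have "sat d1 (?P x) {}" by (simp only: 1 2)
    then have "sat (diag_comp d1 d2) (?P x) {}"
      unfolding exists_middle_iff[OF d1 d2] by (intro exI[of _ "{}"]) simp
    then obtain \<chi> where \<chi>: "\<And>i. i \<in> {1..a} \<Longrightarrow> i \<in> ?P x \<longleftrightarrow> \<chi> (f i)"
      "\<And>j. j \<in> {1..c} \<Longrightarrow> j \<in> {} \<longleftrightarrow> \<chi> (g j)" unfolding fg by (elim sat_fibE) auto
    obtain i j where "i \<in> {1..a}" "f i = x" "j \<in> {1..c}" "g j = x" using x by auto
    then show False using \<chi>(1)[of i] \<chi>(2)[of j] by simp
  qed
  then have "\<forall>x\<in>?L. \<exists>j. j \<in> R' x" by blast
  from bchoice[OF this] obtain r where r: "\<And>x. x \<in> ?L \<Longrightarrow> r x \<in> R' x" by blast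
  have "inj_on r ?L"
  proof (rule inj_onI)
    fix x y assume xy: "x \<in> ?L" "y \<in> ?L" "r x = r y"
    then show "x = y" using r[OF xy(1)] r[OF xy(2)] unfolding R'_def by auto
  qed
  moreover have "r ` ?L \<subseteq> {1..b}" using r R(1) unfolding R'_def by blast
  ultimately have "card ?L \<le> card {1..b}" by (intro card_inj_on_le) auto
  then show ?thesis by (simp add: fg pn_fib)
qed

section \<open>Comparison of consecutive algebras\<close>

definition strand :: "nat \<Rightarrow> diagram \<Rightarrow> diagram" where
  "strand M d = insert (vpair (Suc M)) d"

lemma vpair_rows: "vpair i = rows {i} {i}"
  by (auto simp: vpair_def rows_def)

lemma strand_dgms:
  assumes "d \<in> dgms M M" shows "strand M d \<in> dgms (Suc M) (Suc M)"
proof -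
  have p: "partition_on (rows {1..M} {1..M}) d" using assms by (simp add: dgms_def)
  have "disjnt (vpair (Suc M)) (\<Union>d)"
    unfolding partition_onD1[OF p, symmetric] by (auto simp: disjnt_def vpair_rows rows_def)
  moreover have "rows {1..Suc M} {1..Suc M} - vpair (Suc M) = rows {1..M} {1..M}"
    by (auto simp: vpair_rows rows_def)
  moreover have "vpair (Suc M) \<subseteq> rows {1..Suc M} {1..Suc M}" "vpair (Suc M) \<noteq> {}"
    by (auto simp: vpair_rows rows_def)
  ultimately show ?thesis
    unfolding dgms_def strand_def mem_Collect_eq by (simp only: partition_on_insert p simp_thms)
qed

lemma sat_strand:
  assumes "d \<in> dgms M M"
  shows "sat (strand M d) P Q \<longleftrightarrow>
    (Suc M \<in> P \<longleftrightarrow> Suc M \<in> Q) \<and> sat d (P \<inter> {1..M}) (Q \<inter> {1..M})"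
proof -
  have "closed_under d (rows P Q) \<longleftrightarrow> closed_under d (rows (P \<inter> {1..M}) (Q \<inter> {1..M}))"
  proof (rule closed_under_cong)
    fix B u assume "B \<in> d" "u \<in> B"
    then have "u \<in> rows {1..M} {1..M}" using assms by (auto simp only: dgms_def partition_on_def)
    then show "u \<in> rows P Q \<longleftrightarrow> u \<in> rows (P \<inter> {1..M}) (Q \<inter> {1..M})" by (auto simp: rows_def)
  qed
  moreover have "closed_under {vpair (Suc M)} (rows P Q) \<longleftrightarrow> (Suc M \<in> P \<longleftrightarrow> Suc M \<in> Q)"
    by (auto simp: closed_under_def vpair_def)
  ultimately show ?thesis
    using closed_under_Un[of "{vpair (Suc M)}" d "rows P Q"] by (simp add: sat_def strand_def)
qed

lemma flip_strand: "flip (strand M d) = strand M (flip d)"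
  by (simp add: flip_def strand_def vpair_rows flip_vertex_image del: One_nat_def)

lemma strand_mor: "d \<in> dgms M M \<Longrightarrow> strand M d \<in> mor s (Suc M) (Suc M)"
  using strand_dgms by (auto simp: mor_def strand_def vpair_def)

text \<open>The middle point of the new strand lies in \<open>R\<close> exactly when its top end
  lies in \<open>P\<close>. This forced point leaves the number of middle sets unchanged, so no
  component is gained or lost.\<close>

lemma composes_strand:
  assumes d: "d1 \<in> dgms M M" "d2 \<in> dgms M M"
  shows "composes (Suc M) (Suc M) (Suc M) (strand M d1) (strand M d2)
    (removed d1 d2) (strand M (diag_comp d1 d2))"
  unfolding composes_def
proof (intro conjI allI impI)
  fix P Q :: "nat set" assume PQ: "P \<subseteq> {1..Suc M}" "Q \<subseteq> {1..Suc M}"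
  let ?S = "{R. R \<subseteq> {1..Suc M} \<and> sat (strand M d1) P R \<and> sat (strand M d2) R Q}"
  let ?T = "{R. R \<subseteq> {1..M} \<and> sat d1 (P \<inter> {1..M}) R \<and> sat d2 R (Q \<inter> {1..M})}"
  let ?f = "\<lambda>R. R \<union> (P \<inter> {Suc M})"
  have S: "?S = (if Suc M \<in> P \<longleftrightarrow> Suc M \<in> Q then ?f ` ?T else {})"
  proof (rule set_eqI)
    fix R
    have "R \<in> ?S \<longleftrightarrow> R \<subseteq> {1..Suc M} \<and> (Suc M \<in> P \<longleftrightarrow> Suc M \<in> R) \<and> (Suc M \<in> R \<longleftrightarrow> Suc M \<in> Q) \<and>
        R \<inter> {1..M} \<in> ?T"
      unfolding mem_Collect_eq sat_strand[OF d(1)] sat_strand[OF d(2)] by (simp only: Int_lower2) blast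
    also have "\<dots> \<longleftrightarrow> (Suc M \<in> P \<longleftrightarrow> Suc M \<in> Q) \<and> R \<in> ?f ` ?T"
    proof
      assume R: "R \<subseteq> {1..Suc M} \<and> (Suc M \<in> P \<longleftrightarrow> Suc M \<in> R) \<and> (Suc M \<in> R \<longleftrightarrow> Suc M \<in> Q) \<and>
        R \<inter> {1..M} \<in> ?T"
      then have "R = ?f (R \<inter> {1..M})" by (auto simp: le_Suc_eq)
      then show "(Suc M \<in> P \<longleftrightarrow> Suc M \<in> Q) \<and> R \<in> ?f ` ?T" using R by blast
    next
      assume R: "(Suc M \<in> P \<longleftrightarrow> Suc M \<in> Q) \<and> R \<in> ?f ` ?T"
      then obtain R0 where R0: "R0 \<in> ?T" "R = ?f R0" by blast
      then have "R \<inter> {1..M} = R0" "Suc M \<notin> R0" by auto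
      then show "R \<subseteq> {1..Suc M} \<and> (Suc M \<in> P \<longleftrightarrow> Suc M \<in> R) \<and> (Suc M \<in> R \<longleftrightarrow> Suc M \<in> Q) \<and>
        R \<inter> {1..M} \<in> ?T" using R R0 by auto
    qed
    finally show "R \<in> ?S \<longleftrightarrow> R \<in> (if Suc M \<in> P \<longleftrightarrow> Suc M \<in> Q then ?f ` ?T else {})" by simp
  qed
  have inj: "inj_on ?f ?T"
  proof (rule inj_onI)
    fix R R' assume "R \<in> ?T" "R' \<in> ?T" and eq: "?f R = ?f R'"
    then have "?f R \<inter> {1..M} = R" "?f R' \<inter> {1..M} = R'" by auto
    then show "R = R'" using eq by simp
  qed
  show "card ?S = (if sat (strand M (diag_comp d1 d2)) P Q then 2 ^ removed d1 d2 else 0)"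
    unfolding S sat_strand[OF diag_comp_dgms[OF d]]
    by (cases "Suc M \<in> P \<longleftrightarrow> Suc M \<in> Q")
      (simp_all only: if_True if_False card_image[OF inj] card_sat[OF d] simp_thms card.empty)
qed (use d strand_dgms diag_comp_dgms in blast)+

text \<open>For half-integral indices \<open>min M\<close> joins the last two top points to the last
  bottom point. For integral ones the label \<open>Suc M\<close> has no counterpart below, so the
  last top point is isolated.\<close>

definition proj :: "bool \<Rightarrow> nat \<Rightarrow> diagram" where
  "proj s M = fib (Suc M) M (if s then min M else id) id"

lemma proj_mor: "(s \<longrightarrow> 1 \<le> M) \<Longrightarrow> proj s M \<in> mor s (Suc M) M"
  unfolding proj_def by (intro fib_mor) auto

lemma sat_proj:
  assumes "P \<subseteq> {1..Suc M}" and "Q \<subseteq> {1..M}" and s: "s \<longrightarrow> 1 \<le> M"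
  shows "sat (proj s M) P Q \<longleftrightarrow> Q = P \<inter> {1..M} \<and> (s \<longrightarrow> (Suc M \<in> P \<longleftrightarrow> M \<in> P))"
proof
  assume "sat (proj s M) P Q"
  then obtain \<chi> where \<chi>: "\<And>i. i \<in> {1..Suc M} \<Longrightarrow> i \<in> P \<longleftrightarrow> \<chi> ((if s then min M else id) i)"
    "\<And>j. j \<in> {1..M} \<Longrightarrow> j \<in> Q \<longleftrightarrow> \<chi> j" unfolding proj_def by (elim sat_fibE) auto
  have "j \<in> Q \<longleftrightarrow> j \<in> P" if "j \<in> {1..M}" for j
    using \<chi>(1)[of j] \<chi>(2)[OF that] that by (auto simp: min_def)
  moreover have "Suc M \<in> P \<longleftrightarrow> M \<in> P" if s
    using \<chi>(1)[of M] \<chi>(1)[of "Suc M"] that s by simp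
  ultimately show "Q = P \<inter> {1..M} \<and> (s \<longrightarrow> (Suc M \<in> P \<longleftrightarrow> M \<in> P))" using assms(2) by blast
next
  assume R: "Q = P \<inter> {1..M} \<and> (s \<longrightarrow> (Suc M \<in> P \<longleftrightarrow> M \<in> P))"
  show "sat (proj s M) P Q"
    unfolding proj_def
  proof (rule sat_fibI[where \<chi> = "\<lambda>j. j \<in> P"])
    fix i assume "i \<in> {1..Suc M}"
    then show "i \<in> P \<longleftrightarrow> (if s then min M else id) i \<in> P"
      using R by (cases "i = Suc M") (simp_all add: min_absorb1 min_absorb2)
  qed (use R in auto)
qed

lemma sat_flip_proj:
  assumes "P \<subseteq> {1..Suc M}" and "Q \<subseteq> {1..M}" and s: "s \<longrightarrow> 1 \<le> M"
  shows "sat (flip (proj s M)) Q P \<longleftrightarrow> Q = P \<inter> {1..M} \<and> (s \<longrightarrow> (Suc M \<in> P \<longleftrightarrow> M \<in> P))"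
  using sat_flip[of "proj s M" "Suc M" M] sat_proj[OF assms] by (simp add: proj_def)

text \<open>
  \<open>half_dgms s M\<close> is the basis of the algebra with index \<open>k - 1/2\<close>, where \<open>k = M + 1\<close> or
  \<open>k = M + 1/2\<close>, and \<open>lift\<close> is its inclusion into the basis of the algebra with index \<open>k\<close>.
\<close>

definition half_dgms :: "bool \<Rightarrow> nat \<Rightarrow> diagram set" where
  "half_dgms s M = (if s then dgms M M else mor True (Suc M) (Suc M))"

definition lift :: "bool \<Rightarrow> nat \<Rightarrow> diagram \<Rightarrow> diagram" where
  "lift s M d = (if s then strand M d else d)"

text \<open>The flag is \<open>True\<close> whatever \<open>s\<close> is: a diagram of index k -
  1/2, seen at index k, always joins the two ends of the last column. Hence the top row decides
  whether the last middle point is in \<open>R\<close>.\<close>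

lemma lift_mor: "d \<in> half_dgms s M \<Longrightarrow> lift s M d \<in> mor True (Suc M) (Suc M)"
  by (auto simp: half_dgms_def lift_def strand_mor split: if_splits)

lemma lift_mor': "d \<in> half_dgms s M \<Longrightarrow> lift s M d \<in> mor s (Suc M) (Suc M)"
  using lift_mor[of d s M] unfolding mor_def by blast

lemma flip_half_dgms: "d \<in> half_dgms s M \<Longrightarrow> flip d \<in> half_dgms s M"
  by (auto simp: half_dgms_def flip_dgms flip_mor split: if_splits)

lemma flip_flip_half_dgms: "d \<in> half_dgms s M \<Longrightarrow> flip (flip d) = d"
  unfolding half_dgms_def using flip_flip mor_dgms by (metis (full_types))

lemma flip_lift: "flip (lift s M d) = lift s M (flip d)"
  by (simp add: lift_def flip_strand)

lemma half_dgms_last: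
  assumes "b \<in> half_dgms s M" and "sat (lift s M b) P R"
  shows "Suc M \<in> P \<longleftrightarrow> Suc M \<in> R"
  using mor_last[OF lift_mor] assms by blast

text \<open>
  Multiplication by \<open>proj\<close> identifies \<open>half_dgms s M\<close> with the morphisms from \<open>M + 1\<close> to \<open>M\<close>.
\<close>

definition hat :: "bool \<Rightarrow> nat \<Rightarrow> diagram \<Rightarrow> diagram" where
  "hat s M b = diag_comp (lift s M b) (proj s M)"

text \<open>The only possible middle set. Its part below \<open>Suc M\<close> is copied from
  \<open>Q\<close> by \<open>proj\<close>; the point \<open>Suc M\<close> is governed by
  \<open>proj\<close> if \<open>s\<close> holds, and by the last column of \<open>b\<close>
  otherwise.\<close>

definition hat_mid :: "bool \<Rightarrow> nat \<Rightarrow> nat set \<Rightarrow> nat set \<Rightarrow> nat set" where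
  "hat_mid s M P Q = Q \<union> {i. i = Suc M \<and> (if s then M \<in> Q else Suc M \<in> P)}"

lemma hat_mid_iff:
  assumes s: "s \<longrightarrow> 1 \<le> M" and b: "b \<in> half_dgms s M"
    and R: "R \<subseteq> {1..Suc M}" and Q: "Q \<subseteq> {1..M}"
  shows "sat (lift s M b) P R \<and> sat (proj s M) R Q \<longleftrightarrow>
    sat (lift s M b) P (hat_mid s M P Q) \<and> R = hat_mid s M P Q"
proof
  assume L: "sat (lift s M b) P R \<and> sat (proj s M) R Q"
  then have "Q = R \<inter> {1..M}" "s \<longrightarrow> (Suc M \<in> R \<longleftrightarrow> M \<in> R)" "Suc M \<in> P \<longleftrightarrow> Suc M \<in> R"
    using sat_proj[OF R Q s] half_dgms_last[OF b] by auto
  then have "R = hat_mid s M P Q"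
    using R s unfolding hat_mid_def by (auto simp: le_Suc_eq)
  then show "sat (lift s M b) P (hat_mid s M P Q) \<and> R = hat_mid s M P Q" using L by blast
next
  assume L: "sat (lift s M b) P (hat_mid s M P Q) \<and> R = hat_mid s M P Q"
  then have "Q = R \<inter> {1..M}" "s \<longrightarrow> (Suc M \<in> R \<longleftrightarrow> M \<in> R)"
    using Q unfolding hat_mid_def by auto
  then have "sat (proj s M) R Q" unfolding sat_proj[OF R Q s] by (rule conjI)
  then show "sat (lift s M b) P R \<and> sat (proj s M) R Q" using L by simp
qed

lemma hat_mid_subset: "Q \<subseteq> {1..M} \<Longrightarrow> hat_mid s M P Q \<subseteq> {1..Suc M}"
  by (auto simp: hat_mid_def)

lemma sat_hat:
  assumes "s \<longrightarrow> 1 \<le> M" and b: "b \<in> half_dgms s M" and "Q \<subseteq> {1..M}"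
  shows "sat (hat s M b) P Q \<longleftrightarrow> sat (lift s M b) P (hat_mid s M P Q)"
  unfolding hat_def exists_middle_iff[OF mor_dgms[OF lift_mor[OF b]] mor_dgms[OF proj_mor[OF assms(1)]]]
  using hat_mid_iff[OF assms(1,2) _ assms(3)] hat_mid_subset[OF assms(3)] by blast

lemma composes_hat:
  assumes s: "s \<longrightarrow> 1 \<le> M" and b: "b \<in> half_dgms s M"
  shows "composes (Suc M) (Suc M) M (lift s M b) (proj s M) 0 (hat s M b)"
proof (rule composesI[where \<rho> = "hat_mid s M"])
  show "lift s M b \<in> dgms (Suc M) (Suc M)" "proj s M \<in> dgms (Suc M) M"
    using mor_dgms[OF lift_mor[OF b]] mor_dgms[OF proj_mor[OF s]] by auto
  then show "hat s M b \<in> dgms (Suc M) M" unfolding hat_def by (rule diag_comp_dgms)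
  fix P R Q :: "nat set" assume "P \<subseteq> {1..Suc M}" "R \<subseteq> {1..Suc M}" "Q \<subseteq> {1..M}"
  then show "sat (lift s M b) P R \<and> sat (proj s M) R Q \<longleftrightarrow> sat (hat s M b) P Q \<and> R = hat_mid s M P Q"
    using hat_mid_iff[OF s b] sat_hat[OF s b] by blast
qed (use hat_mid_subset in blast)

lemma hat_mor: "(s \<longrightarrow> 1 \<le> M) \<Longrightarrow> b \<in> half_dgms s M \<Longrightarrow> hat s M b \<in> mor s (Suc M) M"
  unfolding hat_def by (rule diag_comp_mor[OF lift_mor' proj_mor]) auto

lemma hat_surj:
  assumes s: "s \<longrightarrow> 1 \<le> M" and \<alpha>: "\<alpha> \<in> mor s (Suc M) M"
  obtains b where "b \<in> half_dgms s M" "hat s M b = \<alpha>"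
proof -
  obtain f g :: "nat \<Rightarrow> vertex set" where fg: "\<alpha> = fib (Suc M) M f g"
    and last: "s \<Longrightarrow> f (Suc M) = g M"
    using mor_cases[OF \<alpha>] s by auto
  \<comment> \<open>For half-integral indices the last top label is dropped, which loses nothing as
    it equals the last bottom label. For integral ones the new bottom point receives the label of
    the last top point.\<close>
  define b where "b = (if s then fib M M f g else fib (Suc M) (Suc M) f (g(Suc M := f (Suc M))))"
  have b: "b \<in> half_dgms s M"
    by (auto simp: b_def half_dgms_def intro!: fib_mor)
  moreover have "hat s M b = \<alpha>"
  proof (rule sat_inject)
    show "hat s M b \<in> dgms (Suc M) M" "\<alpha> \<in> dgms (Suc M) M"
      using mor_dgms[OF hat_mor[OF s b]] mor_dgms[OF \<alpha>] by auto
    fix P Q :: "nat set" assume P: "P \<subseteq> {1..Suc M}" and Q: "Q \<subseteq> {1..M}"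
    show "sat (hat s M b) P Q \<longleftrightarrow> sat \<alpha> P Q"
      unfolding sat_hat[OF s b Q] fg
    proof (cases s)
      case True
      have Q': "hat_mid s M P Q \<inter> {1..M} = Q" "Suc M \<in> hat_mid s M P Q \<longleftrightarrow> M \<in> Q"
        using Q True by (auto simp: hat_mid_def)
      have "lift s M b = strand M (fib M M f g)" using True by (simp add: lift_def b_def)
      then have "sat (lift s M b) P (hat_mid s M P Q) \<longleftrightarrow> (Suc M \<in> P \<longleftrightarrow> M \<in> Q) \<and>
          sat (fib M M f g) (P \<inter> {1..M}) Q"
        by (simp only: sat_strand[OF fib_dgms] Q')
      also have "\<dots> \<longleftrightarrow> sat (fib (Suc M) M f g) P Q"
      proof
        assume L: "(Suc M \<in> P \<longleftrightarrow> M \<in> Q) \<and> sat (fib M M f g) (P \<inter> {1..M}) Q"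
        then obtain \<chi> where \<chi>: "\<And>i. i \<in> {1..M} \<Longrightarrow> i \<in> P \<inter> {1..M} \<longleftrightarrow> \<chi> (f i)"
          "\<And>j. j \<in> {1..M} \<Longrightarrow> j \<in> Q \<longleftrightarrow> \<chi> (g j)" by (elim conjE sat_fibE) blast
        show "sat (fib (Suc M) M f g) P Q"
        proof (rule sat_fibI[where \<chi> = \<chi>])
          fix i assume "i \<in> {1..Suc M}"
          then show "i \<in> P \<longleftrightarrow> \<chi> (f i)"
            using \<chi>(1)[of i] \<chi>(2)[of M] L last s True by (cases "i = Suc M") auto
        qed (use \<chi> in blast)
      next
        assume "sat (fib (Suc M) M f g) P Q"
        then obtain \<chi> where \<chi>: "\<And>i. i \<in> {1..Suc M} \<Longrightarrow> i \<in> P \<longleftrightarrow> \<chi> (f i)"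
          "\<And>j. j \<in> {1..M} \<Longrightarrow> j \<in> Q \<longleftrightarrow> \<chi> (g j)" by (elim sat_fibE) blast
        have "sat (fib M M f g) (P \<inter> {1..M}) Q" using \<chi> by (intro sat_fibI[where \<chi> = \<chi>]) auto
        then show "(Suc M \<in> P \<longleftrightarrow> M \<in> Q) \<and> sat (fib M M f g) (P \<inter> {1..M}) Q"
          using \<chi>(1)[of "Suc M"] \<chi>(2)[of M] last s True by simp
      qed
      finally show "sat (lift s M b) P (hat_mid s M P Q) \<longleftrightarrow> sat (fib (Suc M) M f g) P Q" .
    next
      case False
      have Q': "j \<in> hat_mid s M P Q \<longleftrightarrow> (if j = Suc M then Suc M \<in> P else j \<in> Q)" for j
        using Q False by (auto simp: hat_mid_def)
      have "sat (lift s M b) P (hat_mid s M P Q) \<longleftrightarrow>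
          sat (fib (Suc M) (Suc M) f (g(Suc M := f (Suc M)))) P (hat_mid s M P Q)"
        using False by (simp add: lift_def b_def)
      also have "\<dots> \<longleftrightarrow> sat (fib (Suc M) M f g) P Q"
      proof
        assume "sat (fib (Suc M) (Suc M) f (g(Suc M := f (Suc M)))) P (hat_mid s M P Q)"
        then obtain \<chi> where \<chi>: "\<And>i. i \<in> {1..Suc M} \<Longrightarrow> i \<in> P \<longleftrightarrow> \<chi> (f i)"
          "\<And>j. j \<in> {1..Suc M} \<Longrightarrow> j \<in> hat_mid s M P Q \<longleftrightarrow> \<chi> ((g(Suc M := f (Suc M))) j)"
          by (elim sat_fibE) blast
        have "j \<in> Q \<longleftrightarrow> \<chi> (g j)" if "j \<in> {1..M}" for j using \<chi>(2)[of j] that by (simp add: Q')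
        then show "sat (fib (Suc M) M f g) P Q" using \<chi>(1) by (intro sat_fibI[where \<chi> = \<chi>])
      next
        assume "sat (fib (Suc M) M f g) P Q"
        then obtain \<chi> where \<chi>: "\<And>i. i \<in> {1..Suc M} \<Longrightarrow> i \<in> P \<longleftrightarrow> \<chi> (f i)"
          "\<And>j. j \<in> {1..M} \<Longrightarrow> j \<in> Q \<longleftrightarrow> \<chi> (g j)" by (elim sat_fibE) blast
        then show "sat (fib (Suc M) (Suc M) f (g(Suc M := f (Suc M)))) P (hat_mid s M P Q)"
          by (intro sat_fibI[where \<chi> = \<chi>]) (auto simp: Q')
      qed
      finally show "sat (lift s M b) P (hat_mid s M P Q) \<longleftrightarrow> sat (fib (Suc M) M f g) P Q" .
    qed
  qed
  ultimately show thesis by (rule that)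
qed

text \<open>Composition with \<open>proj\<close> only tests some pairs of sets, but enough of them.
  If \<open>s\<close> holds, a test pair for \<open>b\<close> is extended to the last column
  according to whether \<open>M\<close> lies in \<open>Q\<close>; otherwise any saturated pair
  already agrees on the last column.\<close>

lemma hat_inj:
  assumes s: "s \<longrightarrow> 1 \<le> M" and b: "b \<in> half_dgms s M" and b': "b' \<in> half_dgms s M"
    and eq: "hat s M b = hat s M b'"
  shows "b = b'"
proof -
  have *: "sat (lift s M b) P R \<longleftrightarrow> sat (lift s M b') P R"
    if "R \<subseteq> {1..Suc M}" "Suc M \<in> P \<longleftrightarrow> Suc M \<in> R" "s \<longrightarrow> (Suc M \<in> R \<longleftrightarrow> M \<in> R)" for P R
  proof -
    have "R = hat_mid s M P (R \<inter> {1..M})"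
      using that s unfolding hat_mid_def by (auto simp: le_Suc_eq)
    then show ?thesis
      using sat_hat[OF s b, of "R \<inter> {1..M}" P] sat_hat[OF s b', of "R \<inter> {1..M}" P] eq by simp
  qed
  show ?thesis
  proof (cases s)
    case True
    then have d: "b \<in> dgms M M" "b' \<in> dgms M M" using b b' by (auto simp: half_dgms_def)
    then show ?thesis
    proof (rule sat_inject)
      fix P Q :: "nat set" assume P: "P \<subseteq> {1..M}" and Q: "Q \<subseteq> {1..M}"
      let ?Z = "{i. i = Suc M \<and> M \<in> Q}"
      have 1: "(P \<union> ?Z) \<inter> {1..M} = P" "(Q \<union> ?Z) \<inter> {1..M} = Q" using P Q by auto
      have 2: "Suc M \<in> P \<union> ?Z \<longleftrightarrow> Suc M \<in> Q \<union> ?Z" using P Q by auto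
      have "sat (lift s M b) (P \<union> ?Z) (Q \<union> ?Z) \<longleftrightarrow> sat (lift s M b') (P \<union> ?Z) (Q \<union> ?Z)"
        using P Q by (intro *) auto
      then show "sat b P Q \<longleftrightarrow> sat b' P Q"
        using True by (simp only: lift_def if_True sat_strand[OF d(1)] sat_strand[OF d(2)] 1 2 simp_thms)
    qed
  next
    case False
    then have d: "b \<in> mor True (Suc M) (Suc M)" "b' \<in> mor True (Suc M) (Suc M)"
      using b b' by (auto simp: half_dgms_def)
    show ?thesis
    proof (rule sat_inject[OF mor_dgms[OF d(1)] mor_dgms[OF d(2)]])
      fix P Q :: "nat set" assume "P \<subseteq> {1..Suc M}" and Q: "Q \<subseteq> {1..Suc M}"
      then show "sat b P Q \<longleftrightarrow> sat b' P Q"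
        using *[OF Q, of P] mor_last[OF d(1), of P Q] mor_last[OF d(2), of P Q] False
        by (auto simp: lift_def)
    qed
  qed
qed

text \<open>The inclusion from index k - 1 into index k - 1/2 on basis diagrams. On the way to index
  k one strand is added in all cases, either here or by \<open>lift\<close>.\<close>

definition half_incl :: "bool \<Rightarrow> nat \<Rightarrow> diagram \<Rightarrow> diagram" where
  "half_incl s M r = (if s then r else strand M r)"

lemma half_incl_half_dgms: "r \<in> mor s M M \<Longrightarrow> half_incl s M r \<in> half_dgms s M"
  using mor_dgms strand_mor by (simp add: half_incl_def half_dgms_def)

lemma lift_half_incl: "lift s M (half_incl s M r) = strand M r"
  by (simp add: lift_def half_incl_def)

text \<open>Lets \<open>r\<close> slide past \<open>proj\<close>, so that the module action of index
  k - 1 becomes plain composition at the \<open>M\<close> points. If \<open>s\<close> holds, the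
  conditions on the last column agree because \<open>r\<close> itself joins the two points labelled
  \<open>M\<close>.\<close>

lemma composes_proj_hat:
  assumes s: "s \<longrightarrow> 1 \<le> M" and r: "r \<in> mor s M M"
  shows "composes (Suc M) M M (proj s M) r 0 (hat s M (half_incl s M r))"
proof (rule composesI[where \<rho> = "\<lambda>P Q. P \<inter> {1..M}"])
  have h: "half_incl s M r \<in> half_dgms s M" by (rule half_incl_half_dgms[OF r])
  show "proj s M \<in> dgms (Suc M) M" "r \<in> dgms M M" "hat s M (half_incl s M r) \<in> dgms (Suc M) M"
    using mor_dgms[OF proj_mor[OF s]] mor_dgms[OF r] mor_dgms[OF hat_mor[OF s h]] by auto
  fix P R Q :: "nat set" assume P: "P \<subseteq> {1..Suc M}" and R: "R \<subseteq> {1..M}" and Q: "Q \<subseteq> {1..M}"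
  have "hat_mid s M P Q \<inter> {1..M} = Q" "Suc M \<in> hat_mid s M P Q \<longleftrightarrow> (if s then M \<in> Q else Suc M \<in> P)"
    using Q by (auto simp: hat_mid_def)
  then have 1: "sat (hat s M (half_incl s M r)) P Q \<longleftrightarrow>
      (s \<longrightarrow> (Suc M \<in> P \<longleftrightarrow> M \<in> Q)) \<and> sat r (P \<inter> {1..M}) Q"
    unfolding sat_hat[OF s h Q] lift_half_incl sat_strand[OF mor_dgms[OF r]] by simp
  have 2: "M \<in> P \<longleftrightarrow> M \<in> Q" if s "sat r (P \<inter> {1..M}) Q"
    using mor_last[of r M M "P \<inter> {1..M}" Q] that r s by simp
  show "sat (proj s M) P R \<and> sat r R Q \<longleftrightarrow>
      sat (hat s M (half_incl s M r)) P Q \<and> R = P \<inter> {1..M}"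
    unfolding 1 sat_proj[OF P R s] using 2 by blast
qed auto

section \<open>The maps eps as compressions by \<open>proj\<close>\<close>

definition eps_dgm :: "bool \<Rightarrow> nat \<Rightarrow> diagram \<Rightarrow> diagram" where
  "eps_dgm s M x = (if s then {B \<in> x. B \<inter> vpair M = {}} \<union> {\<Union>{B \<in> x. B \<inter> vpair M \<noteq> {}}}
    else (\<lambda>B. B - vpair (Suc M)) ` x - {{}})"

text \<open>The exponent of n. Deleting a column loses a block exactly when that column is a block
  by itself, and this block is then the removed component of the compression.\<close>

definition eps_loops :: "bool \<Rightarrow> nat \<Rightarrow> diagram \<Rightarrow> nat" where
  "eps_loops s M x = (if \<not> s \<and> card (eps_dgm s M x) < card x then 1 else 0)"

lemma eps_dgm_dgms:
  assumes s: "s \<longrightarrow> 1 \<le> M" and x: "x \<in> half_dgms s M"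
  shows "eps_dgm s M x \<in> dgms M M"
proof (cases s)
  case True
  then have p: "partition_on (rows {1..M} {1..M}) x" using x by (simp add: half_dgms_def dgms_def)
  let ?U = "\<Union>{B \<in> x. B \<inter> vpair M \<noteq> {}}"
  have "(0, M) \<in> rows {1..M} {1..M}" using s True by simp
  then obtain B where "B \<in> x" "(0, M) \<in> B" using partition_onD1[OF p] by blast
  then have "(0, M) \<in> ?U" by (auto simp: vpair_def)
  have "partition_on (rows {1..M} {1..M}) ({B \<in> x. B \<inter> vpair M = {}} \<union> {?U})"
  proof (rule partition_onI)
    show "\<Union>({B \<in> x. B \<inter> vpair M = {}} \<union> {?U}) = rows {1..M} {1..M}"
      unfolding partition_onD1[OF p] by blast
    show "{} \<notin> {B \<in> x. B \<inter> vpair M = {}} \<union> {?U}"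
      using \<open>(0, M) \<in> ?U\<close> partition_onD3[OF p] by blast
    have U: "disjnt B ?U" if "B \<in> x" "B \<inter> vpair M = {}" for B
      using disjointD[OF partition_onD2[OF p] that(1)] that(2) unfolding disjnt_def by blast
    fix q q' assume "q \<in> {B \<in> x. B \<inter> vpair M = {}} \<union> {?U}" "q' \<in> {B \<in> x. B \<inter> vpair M = {}} \<union> {?U}"
      and ne: "q \<noteq> q'"
    then consider "q \<in> x" "q' \<in> x" | "q \<in> x" "q \<inter> vpair M = {}" "q' = ?U"
      | "q' \<in> x" "q' \<inter> vpair M = {}" "q = ?U" by blast
    then show "disjnt q q'"
    proof cases
      case 1 then show ?thesis using disjointD[OF partition_onD2[OF p]] ne by (simp add: disjnt_def)
    next
      case 2 then show ?thesis using U by simp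
    next
      case 3 then show ?thesis using U disjnt_sym by metis
    qed
  qed
  then show ?thesis using True by (simp add: eps_dgm_def dgms_def)
next
  case False
  then have p: "partition_on (rows {1..Suc M} {1..Suc M}) x"
    using x by (simp add: half_dgms_def dgms_def mor_def)
  have "partition_on (rows {1..Suc M} {1..Suc M} - vpair (Suc M))
      ((\<lambda>B. B - vpair (Suc M)) ` x - {{}})"
    by (rule partition_on_transform[OF p]) (auto simp: disjnt_def)
  moreover have "rows {1..Suc M} {1..Suc M} - vpair (Suc M) = rows {1..M} {1..M}"
    by (auto simp: vpair_rows rows_def)
  ultimately have "partition_on (rows {1..M} {1..M}) ((\<lambda>B. B - vpair (Suc M)) ` x - {{}})"
    by metis
  then show ?thesis using False by (simp add: eps_dgm_def dgms_def)
qed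

text \<open>The merged block contains both ends of column \<open>M\<close>, so all its vertices
  share their status; merging adds the single condition that these two ends agree.\<close>

lemma sat_eps_dgm_merge:
  assumes "1 \<le> M" and x: "x \<in> dgms M M"
  shows "sat (eps_dgm True M x) P Q \<longleftrightarrow> sat x P Q \<and> (M \<in> P \<longleftrightarrow> M \<in> Q)"
proof
  let ?S = "rows P Q"
  let ?U = "\<Union>{B \<in> x. B \<inter> vpair M \<noteq> {}}"
  have p: "partition_on (rows {1..M} {1..M}) x" using x by (simp add: dgms_def)
  have v: "vpair M \<subseteq> ?U"
  proof
    fix u assume u: "u \<in> vpair M"
    then have "u \<in> rows {1..M} {1..M}" using assms(1) by (auto simp: vpair_def)
    then show "u \<in> ?U" using partition_onD1[OF p] u by blast
  qed
  {
    assume L: "sat (eps_dgm True M x) P Q"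
    have U: "closed_under {?U} ?S" and R: "closed_under {B \<in> x. B \<inter> vpair M = {}} ?S"
      using L unfolding sat_def eps_dgm_def if_True closed_under_Un by blast+
    have UU: "u \<in> ?S \<longleftrightarrow> w \<in> ?S" if "u \<in> ?U" "w \<in> ?U" for u w
      by (rule closed_underD[OF U insertI1 that])
    have "closed_under x ?S"
      unfolding closed_under_def
    proof (intro ballI)
      fix B u w assume B: "B \<in> x" "u \<in> B" "w \<in> B"
      show "u \<in> ?S \<longleftrightarrow> w \<in> ?S"
      proof (cases "B \<inter> vpair M = {}")
        case True then show ?thesis using R B unfolding closed_under_def by blast
      next
        case False
        then have "u \<in> ?U" "w \<in> ?U" using B by blast+
        then show ?thesis by (rule UU)
      qed
    qed
    moreover have "(0, M) \<in> ?S \<longleftrightarrow> (1, M) \<in> ?S"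
      using v by (intro UU) (auto simp: vpair_def)
    ultimately show "sat x P Q \<and> (M \<in> P \<longleftrightarrow> M \<in> Q)" by (simp add: sat_def)
  }
  assume R: "sat x P Q \<and> (M \<in> P \<longleftrightarrow> M \<in> Q)"
  have "u \<in> ?S \<longleftrightarrow> M \<in> P" if u: "u \<in> ?U" for u
  proof -
    obtain B w where B: "B \<in> x" "u \<in> B" "w \<in> B" "w \<in> vpair M" using u by blast
    then have "u \<in> ?S \<longleftrightarrow> w \<in> ?S" using R unfolding sat_def closed_under_def by blast
    then show ?thesis using B(4) R by (auto simp: vpair_def)
  qed
  then have "closed_under {?U} ?S" unfolding closed_under_def by blast
  moreover have "closed_under {B \<in> x. B \<inter> vpair M = {}} ?S"
    using R unfolding sat_def closed_under_def by blast
  ultimately show "sat (eps_dgm True M x) P Q"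
    unfolding sat_def eps_dgm_def if_True closed_under_Un by blast
qed

text \<open>The reflected \<open>proj\<close> equates the status of \<open>Suc M\<close> in
  \<open>R\<close> with that of \<open>M\<close> in \<open>P\<close>, and the strand added by
  \<open>lift\<close> equates it with that of \<open>M\<close> in \<open>Q\<close>. Together they
  give the merging condition.\<close>

lemma composes_eps_merge:
  assumes M: "1 \<le> M" and x: "x \<in> dgms M M"
  shows "composes M (Suc M) M (flip (proj True M)) (hat True M x) 0 (eps_dgm True M x)"
proof (rule composesI[where \<rho> = "\<lambda>P Q. P \<union> {i. i = Suc M \<and> M \<in> P}"])
  have h: "x \<in> half_dgms True M" using x by (simp add: half_dgms_def)
  have s: "True \<longrightarrow> 1 \<le> M" using M by simp
  show "flip (proj True M) \<in> dgms M (Suc M)" "hat True M x \<in> dgms (Suc M) M"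
    "eps_dgm True M x \<in> dgms M M"
    using flip_dgms[OF mor_dgms[OF proj_mor[OF s]]] mor_dgms[OF hat_mor[OF s h]]
      eps_dgm_dgms[OF s h] by auto
  fix P R Q :: "nat set" assume P: "P \<subseteq> {1..M}" and R: "R \<subseteq> {1..Suc M}" and Q: "Q \<subseteq> {1..M}"
  have "hat_mid True M R Q \<inter> {1..M} = Q" "Suc M \<in> hat_mid True M R Q \<longleftrightarrow> M \<in> Q"
    using Q by (auto simp: hat_mid_def)
  then have 1: "sat (hat True M x) R Q \<longleftrightarrow> (Suc M \<in> R \<longleftrightarrow> M \<in> Q) \<and> sat x (R \<inter> {1..M}) Q"
    unfolding sat_hat[OF s h Q] lift_def if_True sat_strand[OF x] by simp
  have 2: "P = R \<inter> {1..M} \<and> (Suc M \<in> R \<longleftrightarrow> M \<in> R) \<longleftrightarrow> R = P \<union> {i. i = Suc M \<and> M \<in> P}"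
    using P R M by (auto simp: le_Suc_eq)
  have 3: "sat (flip (proj True M)) P R \<longleftrightarrow> P = R \<inter> {1..M} \<and> (Suc M \<in> R \<longleftrightarrow> M \<in> R)"
    using sat_flip_proj[OF R P s] by simp
  have 4: "M \<in> R \<longleftrightarrow> M \<in> P" if "P = R \<inter> {1..M}" using that M by simp
  show "sat (flip (proj True M)) P R \<and> sat (hat True M x) R Q \<longleftrightarrow>
      sat (eps_dgm True M x) P Q \<and> R = P \<union> {i. i = Suc M \<and> M \<in> P}"
    unfolding 1 3 sat_eps_dgm_merge[OF M x] 2[symmetric] using 4 by auto
qed auto

text \<open>A middle set must restrict to \<open>P\<close>, so only the status of
  \<open>Suc M\<close> is open. Both choices are saturated precisely when the block of the last
  column has no further vertex; this is the factor 2 that corresponds to one removed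
  component.\<close>

lemma composes_eps_delete:
  assumes x: "x \<in> mor True (Suc M) (Suc M)"
  shows "composes M (Suc M) M (flip (proj False M)) (hat False M x)
    (eps_loops False M x) (eps_dgm False M x)"
  unfolding composes_def
proof (intro conjI allI impI)
  have h: "x \<in> half_dgms False M" using x by (simp add: half_dgms_def)
  have s: "False \<longrightarrow> 1 \<le> M" by simp
  show "flip (proj False M) \<in> dgms M (Suc M)" "hat False M x \<in> dgms (Suc M) M"
    "eps_dgm False M x \<in> dgms M M"
    using flip_dgms[OF mor_dgms[OF proj_mor[OF s]]] mor_dgms[OF hat_mor[OF s h]]
      eps_dgm_dgms[OF s h] by auto
  fix P Q :: "nat set" assume P: "P \<subseteq> {1..M}" and Q: "Q \<subseteq> {1..M}"
  let ?V = "vpair (Suc M)" and ?S = "rows P Q"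
  let ?P' = "insert (Suc M) P" and ?Q' = "insert (Suc M) Q"
  let ?RR = "{R. R \<subseteq> {1..Suc M} \<and> sat (flip (proj False M)) P R \<and> sat (hat False M x) R Q}"
  have S': "rows ?P' ?Q' = ?S \<union> ?V" by (auto simp: vpair_rows rows_def)
  have disj: "?S \<inter> ?V = {}" using P Q by (auto simp: vpair_rows rows_def)
  have p: "partition_on (rows {1..Suc M} {1..Suc M}) x" using x by (simp add: dgms_def mor_def)
  obtain C where C: "C \<in> x" "?V \<subseteq> C" using x by (auto simp: mor_def vpair_def)
  have other: "B \<inter> ?V = {}" if "B \<in> x" "B \<noteq> C" for B
    using disjointD[OF partition_onD2[OF p] that(1) C(1) that(2)] C(2) by blast
  have eps: "sat (eps_dgm False M x) P Q \<longleftrightarrow>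
      (\<forall>B\<in>x. \<forall>u\<in>B - ?V. \<forall>v\<in>B - ?V. u \<in> ?S \<longleftrightarrow> v \<in> ?S)"
  proof -
    have "closed_under (F - {{}}) ?S \<longleftrightarrow> (\<forall>B\<in>F. \<forall>u\<in>B. \<forall>v\<in>B. u \<in> ?S \<longleftrightarrow> v \<in> ?S)" for F
      unfolding closed_under_def by blast
    then show ?thesis unfolding sat_def eps_dgm_def if_False by (simp only: ball_simps)
  qed
  \<comment> \<open>Leaving out the last column means that its block \<open>C\<close> contributes no
    vertex; \<open>sat1\<close> is the opposite choice, where all of \<open>C\<close> is
    included.\<close>
  have sat0: "sat x P Q \<longleftrightarrow> sat (eps_dgm False M x) P Q \<and> (C - ?V) \<inter> ?S = {}"
  proof
    assume L: "sat x P Q"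
    note cl = closed_underD[OF L[unfolded sat_def]]
    have "u \<notin> ?S" if "u \<in> C" for u
    proof -
      have "(0, Suc M) \<in> C" "(0, Suc M) \<notin> ?S" using C P by (auto simp: vpair_def)
      then show ?thesis using cl[OF C(1) that] by blast
    qed
    then have "(C - ?V) \<inter> ?S = {}" by blast
    moreover have "sat (eps_dgm False M x) P Q"
      unfolding eps by (intro ballI cl) auto
    ultimately show "sat (eps_dgm False M x) P Q \<and> (C - ?V) \<inter> ?S = {}" by blast
  next
    assume R: "sat (eps_dgm False M x) P Q \<and> (C - ?V) \<inter> ?S = {}"
    show "sat x P Q"
      unfolding sat_def closed_under_def
    proof (intro ballI)
      fix B u v assume B: "B \<in> x" "u \<in> B" "v \<in> B"
      show "u \<in> ?S \<longleftrightarrow> v \<in> ?S"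
      proof (cases "B = C")
        case True then show ?thesis using R B disj by blast
      next
        case False then show ?thesis using other[OF B(1)] R B unfolding eps by blast
      qed
    qed
  qed
  have sat1: "sat x ?P' ?Q' \<longleftrightarrow> sat (eps_dgm False M x) P Q \<and> C - ?V \<subseteq> ?S"
  proof
    assume L: "sat x ?P' ?Q'"
    then have cl: "u \<in> ?S \<union> ?V \<longleftrightarrow> v \<in> ?S \<union> ?V" if "B \<in> x" "u \<in> B" "v \<in> B" for B u v
      using that unfolding sat_def closed_under_def S' by blast
    have "(0, Suc M) \<in> C" "(0, Suc M) \<in> ?V" using C by (auto simp: vpair_def)
    then have "C - ?V \<subseteq> ?S" using cl[OF C(1)] by blast
    moreover have "sat (eps_dgm False M x) P Q" unfolding eps using cl by blast
    ultimately show "sat (eps_dgm False M x) P Q \<and> C - ?V \<subseteq> ?S" by blast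
  next
    assume R: "sat (eps_dgm False M x) P Q \<and> C - ?V \<subseteq> ?S"
    show "sat x ?P' ?Q'"
      unfolding sat_def closed_under_def S'
    proof (intro ballI)
      fix B u v assume B: "B \<in> x" "u \<in> B" "v \<in> B"
      show "u \<in> ?S \<union> ?V \<longleftrightarrow> v \<in> ?S \<union> ?V"
      proof (cases "B = C")
        case True then show ?thesis using R B by blast
      next
        case False then show ?thesis using other[OF B(1)] R B unfolding eps by blast
      qed
    qed
  qed
  have "?RR = (if sat x P Q then {P} else {}) \<union> (if sat x ?P' ?Q' then {?P'} else {})"
  proof (rule set_eqI)
    fix R
    have 2: "R \<subseteq> {1..Suc M} \<and> P = R \<inter> {1..M} \<longleftrightarrow> R = P \<or> R = ?P'"
      using P by (auto simp: le_Suc_eq)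
    have "hat_mid False M P Q = Q" "hat_mid False M ?P' Q = ?Q'"
      using P by (auto simp: hat_mid_def)
    then have 3: "sat (hat False M x) P Q \<longleftrightarrow> sat x P Q" "sat (hat False M x) ?P' Q \<longleftrightarrow> sat x ?P' ?Q'"
      unfolding sat_hat[OF s h Q] by (simp_all add: lift_def)
    have "R \<in> ?RR \<longleftrightarrow> (R = P \<or> R = ?P') \<and> sat (hat False M x) R Q"
      unfolding 2[symmetric] using sat_flip_proj[OF _ P s, of R] by auto
    also have "\<dots> \<longleftrightarrow> R \<in> (if sat x P Q then {P} else {}) \<union> (if sat x ?P' ?Q' then {?P'} else {})"
      using 3 by auto
    finally show "R \<in> ?RR \<longleftrightarrow> R \<in> (if sat x P Q then {P} else {}) \<union> (if sat x ?P' ?Q' then {?P'} else {})" .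
  qed
  moreover have "P \<noteq> ?P'" using P by auto
  ultimately have card: "card ?RR = (if sat x P Q then 1 else 0) + (if sat x ?P' ?Q' then 1 else 0)"
    by simp
  have finx: "finite x" using finite_dgm[OF mor_dgms[OF x]] .
  show "card ?RR = (if sat (eps_dgm False M x) P Q then 2 ^ eps_loops False M x else 0)"
  proof (cases "C = ?V")
    case True
    have im: "B - ?V = B" if "B \<in> x - {C}" for B using other[of B] that by blast
    have "(\<lambda>B. B - ?V) ` x = insert {} (x - {C})"
    proof -
      have "x = insert C (x - {C})" using C(1) by blast
      then have "(\<lambda>B. B - ?V) ` x = insert (C - ?V) ((\<lambda>B. B - ?V) ` (x - {C}))" by blast
      moreover have "(\<lambda>B. B - ?V) ` (x - {C}) = x - {C}" using im by force
      ultimately show ?thesis using True by simp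
    qed
    then have "eps_dgm False M x = x - {C}"
      using partition_onD3[OF p] by (auto simp: eps_dgm_def)
    then have "eps_loops False M x = 1"
      using card_Diff1_less[OF finx C(1)] by (simp only: eps_loops_def simp_thms if_True)
    then show ?thesis using card sat0 sat1 True by simp
  next
    case False
    then obtain w where w: "w \<in> C - ?V" using C(2) by blast
    have ne: "B - ?V \<noteq> {}" if "B \<in> x" for B
    proof (cases "B = C")
      case True then show ?thesis using w by blast
    next
      case False
      have "B \<noteq> {}" using partition_onD3[OF p] that by blast
      then show ?thesis using other[OF that False] by blast
    qed
    have "inj_on (\<lambda>B. B - ?V) x"
    proof (rule inj_onI)
      fix B B' assume B: "B \<in> x" "B' \<in> x" "B - ?V = B' - ?V"
      then show "B = B'" using ne[OF B(1)] disjointD[OF partition_onD2[OF p] B(1,2)] by blast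
    qed
    moreover have "eps_dgm False M x = (\<lambda>B. B - ?V) ` x" using ne by (auto simp: eps_dgm_def)
    ultimately have "eps_loops False M x = 0" by (simp add: eps_loops_def card_image)
    moreover have "sat (eps_dgm False M x) P Q \<Longrightarrow> (C - ?V) \<inter> ?S = {} \<or> C - ?V \<subseteq> ?S"
      unfolding eps using C(1) by blast
    moreover have "\<not> ((C - ?V) \<inter> ?S = {} \<and> C - ?V \<subseteq> ?S)" using w by blast
    ultimately show ?thesis using card sat0 sat1 by auto
  qed
qed

lemma composes_eps:
  assumes "s \<longrightarrow> 1 \<le> M" and "x \<in> half_dgms s M"
  shows "composes M (Suc M) M (flip (proj s M)) (hat s M x) (eps_loops s M x) (eps_dgm s M x)"
  using assms composes_eps_merge[of M x] composes_eps_delete[of x M]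
  by (cases s) (simp_all add: half_dgms_def eps_loops_def)

lemma eps_dgm_mor:
  assumes "s \<longrightarrow> 1 \<le> M" and "x \<in> half_dgms s M" shows "eps_dgm s M x \<in> mor s M M"
  by (rule composes_mor[OF composes_eps[OF assms] flip_mor[OF proj_mor[OF assms(1)]]
        hat_mor[OF assms]]) (use assms in simp)

section \<open>The diagram \<open>p_k\<close> and its factorization\<close>

definition cut_dgm :: "bool \<Rightarrow> nat \<Rightarrow> diagram" where
  "cut_dgm s M = (if s then {vpair M \<union> vpair (M + 1)} \<union> vpair ` {1..<M}
    else {{(0, Suc M)}, {(1, Suc M)}} \<union> vpair ` {1..<Suc M})"

lemma cut_dgm_dgms:
  assumes "s \<longrightarrow> 1 \<le> M" shows "cut_dgm s M \<in> dgms (Suc M) (Suc M)"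
proof (cases s)
  case True
  have "partition_on (rows {1..Suc M} {1..Suc M}) ({vpair M \<union> vpair (M + 1)} \<union> vpair ` {1..<M})"
  proof (rule partition_onI)
    show "\<Union>({vpair M \<union> vpair (M + 1)} \<union> vpair ` {1..<M}) = rows {1..Suc M} {1..Suc M}"
      using assms True by (auto simp: vpair_rows rows_def le_Suc_eq nat_less_le)
  qed (auto simp: vpair_def disjnt_def)
  then show ?thesis using True by (simp add: cut_dgm_def dgms_def)
next
  case False
  have "partition_on (rows {1..Suc M} {1..Suc M})
      ({{(0, Suc M)}, {(1, Suc M)}} \<union> vpair ` {1..<Suc M})"
  proof (rule partition_onI)
    show "\<Union>({{(0, Suc M)}, {(1, Suc M)}} \<union> vpair ` {1..<Suc M}) = rows {1..Suc M} {1..Suc M}"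
      by (auto simp: vpair_rows rows_def le_Suc_eq less_Suc_eq_le)
  qed (auto simp: vpair_def disjnt_def)
  then show ?thesis using False by (simp add: cut_dgm_def dgms_def)
qed

lemma sat_cut_dgm:
  assumes "s \<longrightarrow> 1 \<le> M"
  shows "sat (cut_dgm s M) P Q \<longleftrightarrow> P \<inter> {1..M} = Q \<inter> {1..M} \<and>
    (s \<longrightarrow> (Suc M \<in> P \<longleftrightarrow> M \<in> P) \<and> (Suc M \<in> Q \<longleftrightarrow> M \<in> Q))"
proof -
  have strands: "closed_under (vpair ` I) (rows P Q) \<longleftrightarrow> P \<inter> I = Q \<inter> I" for I
    unfolding closed_under_def by (auto simp: vpair_def set_eq_iff)
  show ?thesis
  proof (cases s)
    case True
    have join: "closed_under {vpair M \<union> vpair (M + 1)} (rows P Q) \<longleftrightarrow>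
        (M \<in> P \<longleftrightarrow> M \<in> Q) \<and> (Suc M \<in> P \<longleftrightarrow> M \<in> P) \<and> (Suc M \<in> Q \<longleftrightarrow> M \<in> Q)"
      by (auto simp: closed_under_def vpair_def)
    have "cut_dgm s M = {vpair M \<union> vpair (M + 1)} \<union> vpair ` {1..<M}" using True by (simp add: cut_dgm_def)
    then have 1: "sat (cut_dgm s M) P Q \<longleftrightarrow> ((M \<in> P \<longleftrightarrow> M \<in> Q) \<and> (Suc M \<in> P \<longleftrightarrow> M \<in> P) \<and>
        (Suc M \<in> Q \<longleftrightarrow> M \<in> Q)) \<and> P \<inter> {1..<M} = Q \<inter> {1..<M}"
      by (simp only: sat_def closed_under_Un strands join)
    have "{1..M} = insert M {1..<M}" using assms True by auto
    then have "P \<inter> {1..M} = Q \<inter> {1..M} \<longleftrightarrow> (M \<in> P \<longleftrightarrow> M \<in> Q) \<and> P \<inter> {1..<M} = Q \<inter> {1..<M}"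
      by (simp only: set_eq_iff Int_iff insert_iff atLeastLessThan_iff) auto
    then show ?thesis unfolding 1 using True by blast
  next
    case False
    have "closed_under {{(0, Suc M)}, {(1, Suc M)}} (rows P Q) \<longleftrightarrow> True"
      by (auto simp: closed_under_def)
    moreover have "cut_dgm s M = {{(0, Suc M)}, {(1, Suc M)}} \<union> vpair ` {1..M}"
      using False by (simp add: cut_dgm_def atLeastLessThanSuc_atLeastAtMost del: One_nat_def)
    ultimately show ?thesis
      using False by (simp only: sat_def closed_under_Un strands simp_thms)
  qed
qed

lemma composes_cut_dgm:
  assumes s: "s \<longrightarrow> 1 \<le> M"
  shows "composes (Suc M) M (Suc M) (proj s M) (flip (proj s M)) 0 (cut_dgm s M)"
proof (rule composesI[where \<rho> = "\<lambda>P Q. P \<inter> {1..M}"])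
  show "proj s M \<in> dgms (Suc M) M" "flip (proj s M) \<in> dgms M (Suc M)" "cut_dgm s M \<in> dgms (Suc M) (Suc M)"
    using mor_dgms[OF proj_mor[OF s]] flip_dgms cut_dgm_dgms[OF s] by auto
  fix P R Q :: "nat set" assume P: "P \<subseteq> {1..Suc M}" and R: "R \<subseteq> {1..M}" and Q: "Q \<subseteq> {1..Suc M}"
  show "sat (proj s M) P R \<and> sat (flip (proj s M)) R Q \<longleftrightarrow> sat (cut_dgm s M) P Q \<and> R = P \<inter> {1..M}"
    unfolding sat_proj[OF P R s] sat_flip_proj[OF Q R s] sat_cut_dgm[OF s] by blast
qed auto

section \<open>Linear extension\<close>

lemma lin_ext_superset:
  assumes "finite A" and "Poly_Mapping.keys x \<subseteq> A"
  shows "lin_ext h x = (\<Sum>u\<in>A. cscale (Poly_Mapping.lookup x u) (h u))"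
  unfolding lin_ext_def
  by (rule sum.mono_neutral_left) (use assms in \<open>auto simp: in_keys_iff\<close>)

lemma lin_ext_add: "lin_ext h (x + y) = lin_ext h x + lin_ext h y"
proof -
  let ?A = "Poly_Mapping.keys x \<union> Poly_Mapping.keys y"
  have "Poly_Mapping.keys (x + y) \<subseteq> ?A" by (rule Poly_Mapping.keys_add)
  then show ?thesis
    using lin_ext_superset[of ?A x h] lin_ext_superset[of ?A y h] lin_ext_superset[of ?A "x + y" h]
    by (simp add: lookup_add fcomb.scale_left_distrib sum.distrib)
qed

lemma keys_cscale: "Poly_Mapping.keys (cscale c x) \<subseteq> Poly_Mapping.keys x"
  by (auto simp: in_keys_iff)

lemma lin_ext_cscale: "lin_ext h (cscale c x) = cscale c (lin_ext h x)"
  using lin_ext_superset[OF _ keys_cscale, of x h c]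
  by (simp add: lin_ext_def fcomb.scale_sum_right)

lemma lin_ext_zero [simp]: "lin_ext h 0 = 0"
  by (simp add: lin_ext_def)

lemma lin_ext_diff: "lin_ext h (x - y) = lin_ext h x - lin_ext h y"
  using lin_ext_add[of h "x - y" y] by (simp add: algebra_simps)

lemma lin_ext_basis [simp]: "lin_ext h (basis u) = h u"
  by (simp add: lin_ext_def basis_def)

lemma keys_basis [simp]: "Poly_Mapping.keys (basis u) = {u}"
  by (simp add: basis_def)

lemma basis_in_free_space [simp]: "basis u \<in> free_space S \<longleftrightarrow> u \<in> S"
  by (simp add: free_space_def)

lemma zero_in_free_space [simp]: "0 \<in> free_space S"
  by (simp add: free_space_def)

lemma add_in_free_space: "x \<in> free_space S \<Longrightarrow> y \<in> free_space S \<Longrightarrow> x + y \<in> free_space S"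
  unfolding free_space_def using Poly_Mapping.keys_add[of x y] by blast

lemma cscale_in_free_space: "x \<in> free_space S \<Longrightarrow> cscale c x \<in> free_space S"
  unfolding free_space_def using keys_cscale[of c x] by blast

lemma diff_in_free_space: "x \<in> free_space S \<Longrightarrow> y \<in> free_space S \<Longrightarrow> x - y \<in> free_space S"
  using add_in_free_space[OF _ cscale_in_free_space[of y S "-1"], of x] by simp

lemma free_space_mono: "S \<subseteq> T \<Longrightarrow> x \<in> free_space S \<Longrightarrow> x \<in> free_space T"
  by (auto simp: free_space_def)

lemma lin_ext_basis_id: "lin_ext basis x = x"
proof (rule poly_mapping_eqI)
  fix v
  have "Poly_Mapping.lookup (lin_ext basis x) v =
      (\<Sum>u\<in>Poly_Mapping.keys x. if u = v then Poly_Mapping.lookup x u else 0)"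
    unfolding lin_ext_def lookup_sum by (rule sum.cong) (auto simp: basis_def lookup_single when_def)
  also have "\<dots> = Poly_Mapping.lookup x v"
    by (simp add: in_keys_iff)
  finally show "Poly_Mapping.lookup (lin_ext basis x) v = Poly_Mapping.lookup x v" .
qed

text \<open>Reduces a linear or multilinear identity to diagrams while keeping track of the
  subspace, since most identities below hold only for morphisms of the right type.\<close>

lemma free_space_induct [consumes 1, case_names zero add scale basis]:
  assumes x: "x \<in> free_space S" and zero: "P 0"
    and add: "\<And>x y. x \<in> free_space S \<Longrightarrow> y \<in> free_space S \<Longrightarrow> P x \<Longrightarrow> P y \<Longrightarrow> P (x + y)"
    and scale: "\<And>c x. x \<in> free_space S \<Longrightarrow> P x \<Longrightarrow> P (cscale c x)"
    and basis: "\<And>u. u \<in> S \<Longrightarrow> P (basis u)"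
  shows "P x"
proof -
  have "(\<Sum>u\<in>A. cscale (f u) (basis u)) \<in> free_space S \<and> P (\<Sum>u\<in>A. cscale (f u) (basis u))"
    if "finite A" "A \<subseteq> S" for A and f
    using that
  proof (induction A rule: finite_induct)
    case (insert u A)
    then have "basis u \<in> free_space S" "P (basis u)" using basis by auto
    then have "cscale (f u) (basis u) \<in> free_space S" "P (cscale (f u) (basis u))"
      using scale cscale_in_free_space by blast+
    then show ?case using insert add by (simp add: add_in_free_space)
  qed (simp add: zero)
  then have "P (lin_ext basis x)"
    unfolding lin_ext_def using x by (simp add: free_space_def)
  then show ?thesis by (simp add: lin_ext_basis_id)
qed

lemma lin_ext_free_space:
  assumes "x \<in> free_space S" and "\<And>u. u \<in> S \<Longrightarrow> h u \<in> free_space T"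
  shows "lin_ext h x \<in> free_space T"
  using assms
  by (induction rule: free_space_induct)
    (auto simp: lin_ext_add lin_ext_cscale intro: add_in_free_space cscale_in_free_space)

lemma lin_ext_basis_inj:
  assumes "inj_on h S" and x: "x \<in> free_space S" and "lin_ext (\<lambda>u. basis (h u)) x = 0"
  shows "x = 0"
proof (rule poly_mapping_eqI)
  fix v
  show "Poly_Mapping.lookup x v = Poly_Mapping.lookup 0 v"
  proof (cases "v \<in> S")
    case True
    have "Poly_Mapping.lookup (lin_ext (\<lambda>u. basis (h u)) x) (h v) =
        (\<Sum>u\<in>Poly_Mapping.keys x. if u = v then Poly_Mapping.lookup x u else 0)"
      unfolding lin_ext_def lookup_sum
    proof (rule sum.cong)
      fix u assume "u \<in> Poly_Mapping.keys x"
      then have "h u = h v \<longleftrightarrow> u = v" using assms(1) x True by (auto simp: free_space_def inj_on_def)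
      then show "Poly_Mapping.lookup (cscale (Poly_Mapping.lookup x u) (basis (h u))) (h v) =
          (if u = v then Poly_Mapping.lookup x u else 0)"
        by (simp add: basis_def lookup_single when_def)
    qed simp
    then show ?thesis using assms(3) by (simp add: in_keys_iff split: if_splits)
  next
    case False
    then have "v \<notin> Poly_Mapping.keys x" using x by (auto simp: free_space_def)
    then show ?thesis by (simp add: in_keys_iff)
  qed
qed

lemma lin_ext_fun_add: "lin_ext (\<lambda>u. f u + g u) x = lin_ext f x + lin_ext g x"
  by (simp add: lin_ext_def fcomb.scale_right_distrib sum.distrib)

lemma lin_ext_fun_cscale: "lin_ext (\<lambda>u. cscale c (f u)) x = cscale c (lin_ext f x)"
  by (simp add: lin_ext_def fcomb.scale_sum_right mult.commute)

lemma bilin_ext_basis: "bilin_ext h (basis u) (basis v) = h u v"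
  by (simp add: bilin_ext_def)

lemma bilin_ext_linear:
  "bilin_ext h (x + x') y = bilin_ext h x y + bilin_ext h x' y"
  "bilin_ext h x (y + y') = bilin_ext h x y + bilin_ext h x y'"
  "bilin_ext h (cscale c x) y = cscale c (bilin_ext h x y)"
  "bilin_ext h x (cscale c y) = cscale c (bilin_ext h x y)"
  "bilin_ext h 0 y = 0" "bilin_ext h x 0 = 0"
  unfolding bilin_ext_def
  by (simp_all add: lin_ext_add lin_ext_cscale lin_ext_fun_add lin_ext_fun_cscale)
    (simp add: lin_ext_def)

section \<open>Multiplication of formal combinations of diagrams\<close>

lemmas pmult_linear = bilin_ext_linear
  [where h = "\<lambda>d1 d2. cscale (n ^ removed d1 d2) (basis (diag_comp d1 d2))" for n,
   folded pmult_def]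

lemma pmult_basis:
  "pmult n (basis d1) (basis d2) = cscale (n ^ removed d1 d2) (basis (diag_comp d1 d2))"
  by (simp add: pmult_def bilin_ext_basis)

lemma pmult_composes:
  "composes a b c d1 d2 l d3 \<Longrightarrow> pmult n (basis d1) (basis d2) = cscale (n ^ l) (basis d3)"
  by (simp add: pmult_basis composesD)

lemma pmult_composes_0:
  "composes a b c d1 d2 0 d3 \<Longrightarrow> pmult n (basis d1) (basis d2) = basis d3"
  by (simp add: pmult_composes)

lemma pmult_free_space:
  assumes x: "x \<in> free_space S" and y: "y \<in> free_space T"
    and ST: "\<And>u v. u \<in> S \<Longrightarrow> v \<in> T \<Longrightarrow> diag_comp u v \<in> W"
  shows "pmult n x y \<in> free_space W"
  using x
proof (induction rule: free_space_induct)
  case (basis u)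
  show ?case using y
    by (induction rule: free_space_induct)
      (auto simp: pmult_linear pmult_basis ST basis intro: add_in_free_space cscale_in_free_space)
qed (auto simp: pmult_linear intro: add_in_free_space cscale_in_free_space)

lemma pmult_mor:
  assumes "x \<in> free_space (mor s a b)" and "y \<in> free_space (mor s b c)" and "s \<Longrightarrow> 1 \<le> a"
  shows "pmult n x y \<in> free_space (mor s a c)"
  using assms diag_comp_mor by (intro pmult_free_space) auto

lemma pmult_assoc:
  assumes x: "x \<in> free_space (dgms a b)" and y: "y \<in> free_space (dgms b c)"
    and z: "z \<in> free_space (dgms c e)"
  shows "pmult n (pmult n x y) z = pmult n x (pmult n y z)"
  using x
proof (induction rule: free_space_induct)
  case (basis d1)
  note d1 = basis
  show ?case using y
  proof (induction rule: free_space_induct)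
    case (basis d2)
    note d2 = basis
    show ?case using z
    proof (induction rule: free_space_induct)
      case (basis d3)
      show ?case
        using diag_comp_assoc[OF d1 d2 basis]
        by (simp add: pmult_linear pmult_basis flip: power_add)
    qed (simp_all add: pmult_linear)
  qed (simp_all add: pmult_linear)
qed (simp_all add: pmult_linear)

lemma free_space_dgms: "x \<in> free_space (mor s a b) \<Longrightarrow> x \<in> free_space (dgms a b)"
  by (rule free_space_mono[rotated]) (auto simp: mor_def)

text \<open>Every axiom that is an equation can be checked after applying the injective
  \<open>f\<close>. The existence of additive inverses is the one axiom that needs
  surjectivity.\<close>

lemma complex_algebra_transport:
  assumes B: "complex_algebra B" and bij: "bij_betw f (carr A) (carr B)"
    and closed: "\<And>x y. x \<in> carr A \<Longrightarrow> y \<in> carr A \<Longrightarrow> vadd A x y \<in> carr A"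
      "vzero A \<in> carr A" "\<And>c x. x \<in> carr A \<Longrightarrow> vscale A c x \<in> carr A"
      "\<And>x y. x \<in> carr A \<Longrightarrow> y \<in> carr A \<Longrightarrow> vmult A x y \<in> carr A"
    and hom: "\<And>x y. x \<in> carr A \<Longrightarrow> y \<in> carr A \<Longrightarrow> f (vadd A x y) = vadd B (f x) (f y)"
      "f (vzero A) = vzero B" "\<And>c x. x \<in> carr A \<Longrightarrow> f (vscale A c x) = vscale B c (f x)"
      "\<And>x y. x \<in> carr A \<Longrightarrow> y \<in> carr A \<Longrightarrow> f (vmult A x y) = vmult B (f x) (f y)"
  shows "complex_algebra A"
proof -
  interpret B: complex_algebra B by (rule B)
  have fB: "f x \<in> carr B" if "x \<in> carr A" for x using bij that by (auto simp: bij_betw_def)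
  have inj: "x = y" if "f x = f y" "x \<in> carr A" "y \<in> carr A" for x y
    using bij that by (auto simp: bij_betw_def inj_on_def)
  note cl = closed fB and h = hom
  show ?thesis
  proof
    fix x assume x: "x \<in> carr A"
    obtain y' where y': "y' \<in> carr B" "vadd B (f x) y' = vzero B"
      using B.add_inverse[OF fB[OF x]] by blast
    then have "y' \<in> f ` carr A" using bij by (simp add: bij_betw_def)
    then obtain y where y: "y \<in> carr A" "f y = y'" by blast
    have "vadd A x y = vzero A" by (rule inj) (use x y y' cl h in simp_all)
    then show "\<exists>y\<in>carr A. vadd A x y = vzero A" using y by blast
  qed (rule inj closed; simp add: cl h B.add_assoc B.add_comm B.add_zero B.scale_add_right
      B.scale_add_left B.scale_scale B.scale_one B.mult_assoc B.mult_add_left B.mult_add_right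
      B.mult_scale_left B.mult_scale_right; fail)+
qed

section \<open>The basic construction\<close>

text \<open>Treats both kinds of index at once, with \<open>s\<close> marking half-integral k. The
  bound k \<ge> 1 becomes M \<ge> 1 if \<open>s\<close> holds and is no restriction
  otherwise.\<close>

locale basic_construction_step =
  fixes n :: complex and s :: bool and M :: nat and k :: real
  assumes sM: "s \<longrightarrow> 1 \<le> M"
    and k: "k = (if s then real M + 1/2 else real M + 1)"
begin

lemma half_notin_Ints: "real M + 1/2 \<notin> \<int>"
proof
  assume "real M + 1/2 \<in> \<int>"
  then obtain z where "real M + 1/2 = of_int z" by (auto elim: Ints_cases)
  then have "2 * int M + 1 = 2 * z" by linarith
  then show False by presburger
qed

lemma k_Ints: "k \<in> \<int> \<longleftrightarrow> \<not> s" "k - 1/2 \<in> \<int> \<longleftrightarrow> s" "k - 1 \<in> \<int> \<longleftrightarrow> \<not> s"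
proof -
  have "real M - 1/2 \<notin> \<int>"
    using half_notin_Ints Ints_add[OF _ Ints_1, of "real M - 1/2"] by auto
  then show "k \<in> \<int> \<longleftrightarrow> \<not> s" "k - 1/2 \<in> \<int> \<longleftrightarrow> s" "k - 1 \<in> \<int> \<longleftrightarrow> \<not> s"
    using half_notin_Ints by (auto simp: k algebra_simps)
qed

lemma k_round: "nat \<lceil>k\<rceil> = Suc M" "nat \<lfloor>k\<rfloor> = (if s then M else Suc M)"
  "nat \<lceil>k - 1/2\<rceil> = (if s then M else Suc M)" "nat \<lceil>k - 1\<rceil> = M"
proof -
  have "\<lceil>k\<rceil> = int (Suc M)" by (rule ceiling_unique) (auto simp: k)
  moreover have "\<lfloor>k\<rfloor> = int (if s then M else Suc M)" by (rule floor_unique) (auto simp: k)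
  moreover have "\<lceil>k - 1/2\<rceil> = int (if s then M else Suc M)" by (rule ceiling_unique) (auto simp: k)
  moreover have "\<lceil>k - 1\<rceil> = int M" by (rule ceiling_unique) (auto simp: k)
  ultimately show "nat \<lceil>k\<rceil> = Suc M" "nat \<lfloor>k\<rfloor> = (if s then M else Suc M)"
    "nat \<lceil>k - 1/2\<rceil> = (if s then M else Suc M)" "nat \<lceil>k - 1\<rceil> = M" by simp_all
qed

lemma vertices_eq_rows: "vertices m = rows {1..m} {1..m}"
  by (auto simp: vertices_def rows_def)

lemma diagrams_k: "diagrams k = mor s (Suc M) (Suc M)"
  unfolding diagrams_def mor_def dgms_def vertices_eq_rows k_round k_Ints
  by (auto simp: vpair_def)

lemma diagrams_half: "diagrams (k - 1/2) = half_dgms s M"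
  unfolding diagrams_def half_dgms_def mor_def dgms_def vertices_eq_rows k_round k_Ints
  by (auto simp: vpair_def)

lemma diagrams_pred: "diagrams (k - 1) = mor s M M"
  unfolding diagrams_def mor_def dgms_def vertices_eq_rows k_round k_Ints
  by (auto simp: vpair_def)

abbreviation "\<I> \<equiv> {d \<in> mor s (Suc M) (Suc M). pn d \<le> M}"
abbreviation "\<B> \<equiv> free_space (half_dgms s M)"
abbreviation "\<R> \<equiv> free_space (mor s M M)"

text \<open>A natural number is below M + 1 or below M + 1/2 exactly when it is at most M, so both
  kinds of index give the same bound.\<close>

lemma ideal_diagrams_k: "ideal_diagrams k = \<I>"
  unfolding ideal_diagrams_def diagrams_k by (auto simp: k)

lemma p_diag_k: "p_diag k = cut_dgm s M"
  by (simp add: p_diag_def cut_dgm_def k_Ints k_round)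

abbreviation "inc \<equiv> incl k"
abbreviation "inc' \<equiv> incl (k - 1/2)"
abbreviation "mult \<equiv> pmult n"
abbreviation "pr \<equiv> basis (proj s M)"
abbreviation "pr' \<equiv> basis (flip (proj s M))"

lemma inc_eq: "inc x = lin_ext (\<lambda>d. basis (lift s M d)) x"
  unfolding incl_def k_Ints k_round by (cases s) (simp_all add: lift_def strand_def)

lemma inc'_eq: "inc' x = lin_ext (\<lambda>d. basis (half_incl s M d)) x"
  unfolding incl_def k_Ints k_round by (cases s) (simp_all add: half_incl_def strand_def)

lemma eps_eq:
  "eps n k x = lin_ext (\<lambda>d. cscale (n ^ eps_loops s M d) (basis (eps_dgm s M d))) x"
  unfolding eps_def k_Ints k_round
  by (cases s) (auto simp: eps_lower_half_def eps_upper_half_def eps_loops_def eps_dgm_def Let_def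
      intro!: arg_cong[where f = "\<lambda>h. lin_ext h x"])

lemma inc_linear:
  "inc (x + y) = inc x + inc y" "inc (cscale c x) = cscale c (inc x)" "inc 0 = 0"
  "inc' (x + y) = inc' x + inc' y" "inc' (cscale c x) = cscale c (inc' x)" "inc' 0 = 0"
  by (simp_all add: incl_def lin_ext_add lin_ext_cscale)

lemma eps_linear:
  "eps n k (x + y) = eps n k x + eps n k y" "eps n k (cscale c x) = cscale c (eps n k x)"
  "eps n k 0 = 0"
  by (simp_all add: eps_eq lin_ext_add lin_ext_cscale)

lemma inc_closed: "x \<in> \<B> \<Longrightarrow> inc x \<in> free_space (mor s (Suc M) (Suc M))"
  unfolding inc_eq by (erule lin_ext_free_space) (simp add: lift_mor')

lemma inc'_closed: "r \<in> \<R> \<Longrightarrow> inc' r \<in> \<B>"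
  unfolding inc'_eq by (erule lin_ext_free_space) (simp add: half_incl_half_dgms)

lemma eps_closed: "x \<in> \<B> \<Longrightarrow> eps n k x \<in> \<R>"
  unfolding eps_eq
  by (erule lin_ext_free_space) (simp add: cscale_in_free_space eps_dgm_mor[OF sM])

lemma pr_closed: "pr \<in> free_space (mor s (Suc M) M)" "pr' \<in> free_space (mor s M (Suc M))"
  using proj_mor[OF sM] flip_mor by auto

lemma mult_closed_half: "x \<in> \<B> \<Longrightarrow> y \<in> \<B> \<Longrightarrow> mult x y \<in> \<B>"
  by (rule pmult_free_space)
    (auto simp: half_dgms_def diag_comp_dgms intro: diag_comp_mor split: if_splits)

lemma inc_mult: "x \<in> \<B> \<Longrightarrow> y \<in> \<B> \<Longrightarrow> inc (mult x y) = mult (inc x) (inc y)"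
proof (induction x rule: free_space_induct)
  case (basis d1)
  note d1 = basis(1)
  show ?case using basis(2)
  proof (induction rule: free_space_induct)
    case (basis d2)
    show ?case
    proof (cases s)
      case True
      then show ?thesis
        using d1 basis pmult_composes[OF composes_strand[of d1 M d2], of n]
        by (simp add: half_dgms_def inc_eq lift_def pmult_basis lin_ext_cscale)
    qed (simp add: inc_eq lift_def lin_ext_basis_id)
  qed (simp_all add: pmult_linear inc_linear)
qed (simp_all add: pmult_linear inc_linear)

text \<open>\<open>H\<close> and \<open>H'\<close> turn the two tensor factors into combinations of
  morphisms to and from \<open>M\<close> points. They are injective, so identities in the algebra of
  index k - 1/2 are proved by comparing images, where both module actions are plain
  composition.\<close>

definition H :: "comb \<Rightarrow> comb" where "H x = mult (inc x) pr"
definition H' :: "comb \<Rightarrow> comb" where "H' x = mult pr' (inc x)"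

lemma H_linear:
  "H (x + y) = H x + H y" "H (cscale c x) = cscale c (H x)" "H 0 = 0"
  "H' (x + y) = H' x + H' y" "H' (cscale c x) = cscale c (H' x)" "H' 0 = 0"
  by (simp_all add: H_def H'_def inc_linear pmult_linear)

lemma H_diff: "H (x - y) = H x - H y" "H' (x - y) = H' x - H' y"
  using H_linear(1)[of "x - y" y] H_linear(4)[of "x - y" y] by simp_all

lemma H_basis: "b \<in> half_dgms s M \<Longrightarrow> H (basis b) = basis (hat s M b)"
  using pmult_composes_0[OF composes_hat[OF sM]] by (simp add: H_def inc_eq)

lemma H'_basis: "b \<in> half_dgms s M \<Longrightarrow> H' (basis b) = basis (flip (hat s M (flip b)))"
  using pmult_composes_0[OF composes_flip[OF composes_hat[OF sM flip_half_dgms]], of b n]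
  by (simp add: H'_def inc_eq flip_lift flip_flip_half_dgms)

lemma H_closed: "x \<in> \<B> \<Longrightarrow> H x \<in> free_space (mor s (Suc M) M)"
  unfolding H_def by (rule pmult_mor[OF inc_closed pr_closed(1)]) auto

lemma H'_closed: "x \<in> \<B> \<Longrightarrow> H' x \<in> free_space (mor s M (Suc M))"
  unfolding H'_def by (rule pmult_mor[OF pr_closed(2) inc_closed]) (use sM in auto)

lemma H_hat: "x \<in> \<B> \<Longrightarrow> H x = lin_ext (\<lambda>b. basis (hat s M b)) x"
  by (induction rule: free_space_induct)
    (simp_all add: H_linear H_basis lin_ext_add lin_ext_cscale)

lemma H'_hat: "x \<in> \<B> \<Longrightarrow> H' x = lin_ext (\<lambda>b. basis (flip (hat s M (flip b)))) x"
  by (induction rule: free_space_induct)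
    (simp_all add: H_linear H'_basis lin_ext_add lin_ext_cscale)

lemma H_inj: "x \<in> \<B> \<Longrightarrow> y \<in> \<B> \<Longrightarrow> H x = H y \<Longrightarrow> x = y"
proof -
  assume xy: "x \<in> \<B>" "y \<in> \<B>" "H x = H y"
  have "x - y = 0"
  proof (rule lin_ext_basis_inj)
    show "inj_on (hat s M) (half_dgms s M)" by (rule inj_onI) (rule hat_inj[OF sM])
    show "x - y \<in> \<B>" using xy by (simp add: diff_in_free_space)
    then show "lin_ext (\<lambda>u. basis (hat s M u)) (x - y) = 0"
      using xy H_hat[of "x - y"] by (simp add: H_diff)
  qed
  then show "x = y" by simp
qed

lemma H'_inj: "x \<in> \<B> \<Longrightarrow> y \<in> \<B> \<Longrightarrow> H' x = H' y \<Longrightarrow> x = y"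
proof -
  assume xy: "x \<in> \<B>" "y \<in> \<B>" "H' x = H' y"
  have "x - y = 0"
  proof (rule lin_ext_basis_inj)
    show "inj_on (\<lambda>b. flip (hat s M (flip b))) (half_dgms s M)"
    proof (rule inj_onI)
      fix b b' assume b: "b \<in> half_dgms s M" "b' \<in> half_dgms s M"
        and eq: "flip (hat s M (flip b)) = flip (hat s M (flip b'))"
      have "hat s M (flip b) = hat s M (flip b')"
        using arg_cong[OF eq, of flip]
        by (simp only: flip_flip[OF mor_dgms[OF hat_mor[OF sM flip_half_dgms[OF b(1)]]]]
          flip_flip[OF mor_dgms[OF hat_mor[OF sM flip_half_dgms[OF b(2)]]]])
      then have "flip b = flip b'"
        using hat_inj[OF sM] flip_half_dgms b by blast
      then show "b = b'" using flip_flip_half_dgms b by metis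
    qed
    show "x - y \<in> \<B>" using xy by (simp add: diff_in_free_space)
    then show "lin_ext (\<lambda>b. basis (flip (hat s M (flip b)))) (x - y) = 0"
      using xy H'_hat[of "x - y"] by (simp add: H_diff)
  qed
  then show "x = y" by simp
qed

lemmas assoc = pmult_assoc[OF free_space_dgms free_space_dgms free_space_dgms]

lemma pr_commute:
  assumes "r \<in> \<R>"
  shows "mult (inc (inc' r)) pr = mult pr r" and "mult pr' (inc (inc' r)) = mult r pr'"
proof -
  show "mult (inc (inc' r)) pr = mult pr r"
    using assms
  proof (induction rule: free_space_induct)
    case (basis d)
    then show ?case
      using pmult_composes_0[OF composes_proj_hat[OF sM basis]]
        H_basis[OF half_incl_half_dgms[OF basis]] by (simp add: H_def inc'_eq)
  qed (simp_all add: inc_linear pmult_linear)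
  show "mult pr' (inc (inc' r)) = mult r pr'"
    using assms
  proof (induction rule: free_space_induct)
    case (basis d)
    have dd: "flip (flip d) = d" using flip_flip mor_dgms[OF basis] by blast
    have fd: "flip (half_incl s M d) = half_incl s M (flip d)"
      by (simp add: half_incl_def flip_strand)
    show ?case
      using pmult_composes_0[OF composes_flip[OF composes_proj_hat[OF sM flip_mor[OF basis]]], of n]
        H'_basis[OF half_incl_half_dgms[OF basis]] by (simp add: H'_def inc'_eq dd fd)
  qed (simp_all add: inc_linear pmult_linear)
qed

lemma H_mult: "x \<in> \<B> \<Longrightarrow> r \<in> \<R> \<Longrightarrow> H (mult x (inc' r)) = mult (H x) r"
  unfolding H_def
  using assoc[OF inc_closed inc_closed[OF inc'_closed] pr_closed(1), of x r n]
    assoc[OF inc_closed pr_closed(1), of x r s M n] pr_commute(1)[of r]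
  by (simp add: inc_mult inc'_closed)

lemma H'_mult: "x \<in> \<B> \<Longrightarrow> r \<in> \<R> \<Longrightarrow> H' (mult (inc' r) x) = mult r (H' x)"
  unfolding H'_def
  using assoc[OF pr_closed(2) inc_closed[OF inc'_closed] inc_closed, of r x n]
    assoc[OF _ pr_closed(2) inc_closed, of r s M x n] pr_commute(2)[of r]
  by (simp add: inc_mult inc'_closed)

lemma eps_conditional: "x \<in> \<B> \<Longrightarrow> mult pr' (H x) = eps n k x"
proof (induction rule: free_space_induct)
  case (basis b)
  show ?case
    using pmult_composes[OF composes_eps[OF sM basis]] by (simp add: H_basis[OF basis] eps_eq)
qed (simp_all add: H_linear pmult_linear eps_linear)

lemma cut_dgm_eq: "basis (p_diag k) = mult pr pr'"
  using pmult_composes_0[OF composes_cut_dgm[OF sM]] by (simp add: p_diag_k)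

lemma sandwich:
  assumes "x \<in> \<B>" and "y \<in> \<B>"
  shows "mult (mult (inc x) (basis (p_diag k))) (inc y) = mult (H x) (H' y)"
  unfolding cut_dgm_eq H_def H'_def
  using assoc[OF inc_closed[OF assms(1)] pr_closed, of n]
    assoc[OF pmult_mor[OF inc_closed[OF assms(1)] pr_closed(1)] pr_closed(2) inc_closed[OF assms(2)], of n n]
  by simp

lemma pn_mult_le: "a \<in> mor s (Suc M) M \<Longrightarrow> c \<in> mor s M (Suc M) \<Longrightarrow> diag_comp a c \<in> \<I>"
  using pn_diag_comp_le[OF mor_dgms mor_dgms] by (auto intro: diag_comp_mor)

lemma sandwich_closed: "x \<in> \<B> \<Longrightarrow> y \<in> \<B> \<Longrightarrow> mult (H x) (H' y) \<in> free_space \<I>"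
  by (rule pmult_free_space[OF H_closed H'_closed pn_mult_le])

text \<open>Factor the left diagram through \<open>M\<close> points and let the second factor absorb
  the right diagram; the product still passes through \<open>M\<close> points.\<close>

lemma ideal_mult_closed: "x \<in> free_space \<I> \<Longrightarrow> y \<in> free_space \<I> \<Longrightarrow> mult x y \<in> free_space \<I>"
proof (rule pmult_free_space)
  fix u v assume u: "u \<in> \<I>" and v: "v \<in> \<I>"
  obtain a c where ac: "a \<in> mor s (Suc M) M" "c \<in> mor s M (Suc M)" "composes (Suc M) M (Suc M) a c 0 u"
    using rank_factorization[OF refl, of u s M] u sM by blast
  have "diag_comp u v = diag_comp a (diag_comp c v)"
    using diag_comp_assoc(1)[OF mor_dgms mor_dgms mor_dgms, OF ac(1,2), of v s "Suc M"]
      composesD(1)[OF ac(3)] v by simp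
  moreover have "diag_comp c v \<in> mor s M (Suc M)"
    using ac v sM by (intro diag_comp_mor) auto
  ultimately show "diag_comp u v \<in> \<I>" using pn_mult_le[OF ac(1)] by simp
qed

lemma complex_algebra_ideal: "complex_algebra (partition_ideal n k)"
proof -
  have sub: "x \<in> free_space (mor s (Suc M) (Suc M))" if "x \<in> free_space \<I>" for x
    by (rule free_space_mono[OF _ that]) auto
  show ?thesis
    by unfold_locales
      (auto simp: partition_ideal_def partition_algebra_def ideal_diagrams_k algebra_simps
        pmult_linear fcomb.scale_left_distrib fcomb.scale_right_distrib
        add_in_free_space cscale_in_free_space ideal_mult_closed
        cscale_in_free_space[of _ _ "-1", simplified]
        assoc[OF sub sub sub] intro!: bexI[of _ "cscale (-1) _"])
qed

end

context basic_construction_step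
begin

section \<open>The tensor relations and the map to the ideal\<close>

abbreviation "\<T> \<equiv> free_space (\<B> \<times> \<B>)"

definition K :: "((comb \<times> comb) \<Rightarrow>\<^sub>0 complex) set" where
  "K = fcomb.span (tensor_rels \<B> \<B> \<R> (\<lambda>b r. mult b (inc' r)) (\<lambda>r b. mult (inc' r) b))"

definition \<Psi> :: "((comb \<times> comb) \<Rightarrow>\<^sub>0 complex) \<Rightarrow> comb" where
  "\<Psi> = lin_ext (\<lambda>(x, y). mult (H x) (H' y))"

lemma \<Psi>_linear: "\<Psi> (z + w) = \<Psi> z + \<Psi> w" "\<Psi> (cscale c z) = cscale c (\<Psi> z)" "\<Psi> 0 = 0"
  "\<Psi> (z - w) = \<Psi> z - \<Psi> w"
  by (simp_all add: \<Psi>_def lin_ext_add lin_ext_cscale lin_ext_diff)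

lemma \<Psi>_basis: "\<Psi> (basis (x, y)) = mult (H x) (H' y)"
  by (simp add: \<Psi>_def)

lemma \<Psi>_closed: "z \<in> \<T> \<Longrightarrow> \<Psi> z \<in> free_space \<I>"
  unfolding \<Psi>_def by (erule lin_ext_free_space) (auto simp: sandwich_closed)

lemma K_subspace: "0 \<in> K" "z \<in> K \<Longrightarrow> w \<in> K \<Longrightarrow> z + w \<in> K" "z \<in> K \<Longrightarrow> cscale c z \<in> K"
  "z \<in> K \<Longrightarrow> w \<in> K \<Longrightarrow> z - w \<in> K"
  unfolding K_def by (rule fcomb.span_zero fcomb.span_add fcomb.span_scale fcomb.span_diff; assumption)+

lemma K_rels:
  assumes "x \<in> \<B>" and "y \<in> \<B>"
  shows "x' \<in> \<B> \<Longrightarrow> basis (x + x', y) - basis (x, y) - basis (x', y) \<in> K"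
    and "y' \<in> \<B> \<Longrightarrow> basis (x, y + y') - basis (x, y) - basis (x, y') \<in> K"
    and "basis (cscale c x, y) - cscale c (basis (x, y)) \<in> K"
    and "basis (x, cscale c y) - cscale c (basis (x, y)) \<in> K"
    and "r \<in> \<R> \<Longrightarrow> basis (mult x (inc' r), y) - basis (x, mult (inc' r) y) \<in> K"
  unfolding K_def tensor_rels_def using assms by (intro fcomb.span_base; blast)+

text \<open>All relations but one follow from bilinearity. The balancing relation is associativity
  in the middle, because \<open>H\<close> and \<open>H'\<close> turn both actions into
  composition.\<close>

lemma \<Psi>_K: "z \<in> K \<Longrightarrow> \<Psi> z = 0"
  unfolding K_def
proof (induction rule: fcomb.span_induct_alt)
  case (step c z w)
  have bal: "mult (H (mult x (inc' r))) (H' y) = mult (H x) (H' (mult (inc' r) y))"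
    if "x \<in> \<B>" "r \<in> \<R>" "y \<in> \<B>" for x r y
    using assoc[OF H_closed[OF that(1)] that(2) H'_closed[OF that(3)], of n] that
    by (simp add: H_mult H'_mult)
  have "\<Psi> z = 0"
    using step(1) unfolding tensor_rels_def
    by (auto simp: \<Psi>_linear \<Psi>_basis H_linear pmult_linear bal)
  then show ?case using step by (simp add: \<Psi>_linear)
qed (simp add: \<Psi>_linear)

text \<open>
  Modulo \<open>K\<close>, every pure tensor of diagrams is a multiple of the chosen factorization
  \<open>A \<otimes> C\<close> of some \<open>d\<close> in the ideal. With \<open>\<alpha> = a \<rho>\<close>, \<open>a v a = a\<close>, \<open>d = a' c'\<close> and \<open>a' = d w\<close>
  this is the computation
  \<open>\<alpha> \<otimes> \<gamma> = a \<otimes> v a \<rho> \<gamma> = \<lambda> a \<otimes> v a' c' = \<lambda> a v a' \<otimes> c' = \<lambda> a' \<otimes> c'\<close>.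
\<close>

lemma pure_tensor_normal_form:
  assumes M: "1 \<le> M" and b1: "b1 \<in> half_dgms s M" and b2: "b2 \<in> half_dgms s M"
    and d: "diag_comp (hat s M b1) (flip (hat s M (flip b2))) = d"
    and A: "A \<in> half_dgms s M" and C: "C \<in> half_dgms s M"
    and fac: "composes (Suc M) M (Suc M) (hat s M A) (flip (hat s M (flip C))) 0 d"
    and w: "w \<in> mor s (Suc M) M" "composes (Suc M) (Suc M) M d w 0 (hat s M A)"
  shows "\<exists>c. basis (basis b1, basis b2) - cscale c (basis (basis A, basis C)) \<in> K"
proof -
  let ?\<alpha> = "hat s M b1" and ?\<gamma> = "flip (hat s M (flip b2))"
  let ?c = "n ^ removed ?\<alpha> ?\<gamma>"
  have \<alpha>: "?\<alpha> \<in> mor s (Suc M) M" by (rule hat_mor[OF sM b1])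
  have \<gamma>: "?\<gamma> \<in> mor s M (Suc M)" by (rule flip_mor[OF hat_mor[OF sM flip_half_dgms[OF b2]]])
  have d': "d \<in> mor s (Suc M) (Suc M)" unfolding d[symmetric] by (rule diag_comp_mor[OF \<alpha> \<gamma>]) simp
  have a': "hat s M A \<in> mor s (Suc M) M" by (rule hat_mor[OF sM A])
  have c': "flip (hat s M (flip C)) \<in> mor s M (Suc M)"
    by (rule flip_mor[OF hat_mor[OF sM flip_half_dgms[OF C]]])
  obtain a \<rho> v \<sigma> where a: "a \<in> mor s (Suc M) M" and \<rho>: "\<rho> \<in> mor s M M" and v: "v \<in> mor s M (Suc M)"
    and a\<rho>: "composes (Suc M) M M a \<rho> 0 ?\<alpha>" and va: "composes M (Suc M) M v a 0 \<sigma>"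
    and a\<sigma>: "composes (Suc M) M M a \<sigma> 0 a"
    using regular_factorization[OF refl M \<alpha>] by blast
  have \<sigma>: "\<sigma> \<in> mor s M M" by (rule composes_mor[OF va v a]) (use M in simp)
  obtain A0 where A0: "A0 \<in> half_dgms s M" "hat s M A0 = a" using hat_surj[OF sM a] by blast
  have HA0: "H (basis A0) = basis a" using H_basis[OF A0(1)] A0(2) by simp
  have mor_basis: "basis a \<in> free_space (mor s (Suc M) M)" "basis \<rho> \<in> \<R>" "basis \<sigma> \<in> \<R>"
    "basis v \<in> free_space (mor s M (Suc M))" "basis ?\<gamma> \<in> free_space (mor s M (Suc M))"
    "basis (hat s M A) \<in> free_space (mor s (Suc M) M)" "basis w \<in> free_space (mor s (Suc M) M)"
    "basis (flip (hat s M (flip C))) \<in> free_space (mor s M (Suc M))"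
    "basis d \<in> free_space (mor s (Suc M) (Suc M))"
    using a \<rho> \<sigma> v \<gamma> a' w c' d' by auto
  have BB: "basis A0 \<in> \<B>" "basis b1 \<in> \<B>" "basis b2 \<in> \<B>" "basis A \<in> \<B>" "basis C \<in> \<B>"
    using A0 b1 b2 A C by auto
  \<comment> \<open>The element that is finally moved back to the left factor. It arises when
    \<open>d\<close> is replaced by its chosen factorization behind \<open>v\<close>.\<close>
  define \<tau> where "\<tau> = mult (basis v) (basis (hat s M A))"
  have \<tau>: "\<tau> \<in> \<R>" unfolding \<tau>_def by (rule pmult_mor[OF mor_basis(4,6)]) (use M in simp)
  define y where "y = mult (inc' (basis \<rho>)) (basis b2)"
  have y: "y \<in> \<B>" unfolding y_def by (rule mult_closed_half[OF inc'_closed[OF mor_basis(2)] BB(3)])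
  have Hy: "H' y = mult (basis \<rho>) (basis ?\<gamma>)"
    unfolding y_def H'_mult[OF BB(3) mor_basis(2)] H'_basis[OF b2] ..
  have \<rho>\<gamma>: "mult (basis \<rho>) (basis ?\<gamma>) \<in> free_space (mor s M (Suc M))"
    by (rule pmult_mor[OF mor_basis(2,5)]) (use M in simp)
  have prod: "mult (basis a) (mult (basis \<rho>) (basis ?\<gamma>)) = cscale ?c (basis d)"
    using assoc[OF mor_basis(1,2,5), of n] pmult_composes_0[OF a\<rho>] pmult_basis[of n ?\<alpha> ?\<gamma>] d by simp
  have dw: "mult (basis d) (basis w) = basis (hat s M A)" by (rule pmult_composes_0[OF w(2)])
  \<comment> \<open>The factorization of \<open>\<alpha>\<close> is pulled back along the injective
    \<open>H\<close>, so that \<open>\<rho>\<close> becomes an element of index k - 1 that can cross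
    the tensor sign.\<close>
  have e1: "basis b1 = mult (basis A0) (inc' (basis \<rho>))"
  proof (rule H_inj)
    show "mult (basis A0) (inc' (basis \<rho>)) \<in> \<B>"
      by (rule mult_closed_half[OF BB(1) inc'_closed[OF mor_basis(2)]])
    show "H (basis b1) = H (mult (basis A0) (inc' (basis \<rho>)))"
      unfolding H_mult[OF BB(1) mor_basis(2)] HA0 H_basis[OF b1] pmult_composes_0[OF a\<rho>] ..
  qed (rule BB)
  have e2: "mult (basis A0) (inc' (basis \<sigma>)) = basis A0"
  proof (rule H_inj)
    show "mult (basis A0) (inc' (basis \<sigma>)) \<in> \<B>"
      by (rule mult_closed_half[OF BB(1) inc'_closed[OF mor_basis(3)]])
    show "H (mult (basis A0) (inc' (basis \<sigma>))) = H (basis A0)"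
      unfolding H_mult[OF BB(1) mor_basis(3)] HA0 pmult_composes_0[OF a\<sigma>] ..
  qed (rule BB)
  have tC: "mult (inc' \<tau>) (basis C) \<in> \<B>" by (rule mult_closed_half[OF inc'_closed[OF \<tau>] BB(5)])
  have e3: "mult (inc' (basis \<sigma>)) y = cscale ?c (mult (inc' \<tau>) (basis C))"
  proof (rule H'_inj)
    show "mult (inc' (basis \<sigma>)) y \<in> \<B>" by (rule mult_closed_half[OF inc'_closed[OF mor_basis(3)] y])
    show "cscale ?c (mult (inc' \<tau>) (basis C)) \<in> \<B>" using tC by (rule cscale_in_free_space)
    have "H' (mult (inc' (basis \<sigma>)) y) = mult (mult (basis v) (basis a)) (H' y)"
      unfolding H'_mult[OF y mor_basis(3)] pmult_composes_0[OF va] ..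
    also have "\<dots> = mult (basis v) (cscale ?c (basis d))"
      unfolding Hy prod[symmetric] by (rule assoc[OF mor_basis(4,1) \<rho>\<gamma>])
    also have "\<dots> = cscale ?c (mult (basis v) (mult (basis (hat s M A)) (basis (flip (hat s M (flip C))))))"
      unfolding pmult_composes_0[OF fac] by (simp add: pmult_linear)
    also have "\<dots> = H' (cscale ?c (mult (inc' \<tau>) (basis C)))"
      unfolding H_linear H'_mult[OF BB(5) \<tau>] H'_basis[OF C]
      by (simp only: \<tau>_def assoc[OF mor_basis(4,6,8)])
    finally show "H' (mult (inc' (basis \<sigma>)) y) = H' (cscale ?c (mult (inc' \<tau>) (basis C)))" .
  qed
  have At: "mult (basis A0) (inc' \<tau>) \<in> \<B>" by (rule mult_closed_half[OF BB(1) inc'_closed[OF \<tau>]])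
  \<comment> \<open>The scalar stays on both sides because it may be 0: a v d = d is only derived
    after multiplication by it, from the expression of \<open>d\<close> as a product that starts
    with \<open>a\<close>. Multiplying by \<open>w\<close> on the right then turns \<open>d\<close>
    into the chosen left factor.\<close>
  have e4: "cscale ?c (mult (basis A0) (inc' \<tau>)) = cscale ?c (basis A)"
  proof (rule H_inj)
    show "cscale ?c (mult (basis A0) (inc' \<tau>)) \<in> \<B>" "cscale ?c (basis A) \<in> \<B>"
      using At BB(4) by (auto intro: cscale_in_free_space)
    have vd: "mult (basis v) (basis d) \<in> free_space (mor s M (Suc M))"
      by (rule pmult_mor[OF mor_basis(4,9)]) (use M in simp)
    have "cscale ?c (mult (basis a) (mult (basis v) (basis d))) =
        mult (basis a) (mult (basis v) (cscale ?c (basis d)))"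
      by (simp add: pmult_linear)
    also have "\<dots> = mult (basis a) (mult (mult (basis v) (basis a)) (mult (basis \<rho>) (basis ?\<gamma>)))"
      unfolding prod[symmetric] assoc[OF mor_basis(4,1) \<rho>\<gamma>] ..
    also have "\<dots> = mult (mult (basis a) (basis \<sigma>)) (mult (basis \<rho>) (basis ?\<gamma>))"
      unfolding pmult_composes_0[OF va] by (rule assoc[OF mor_basis(1,3) \<rho>\<gamma>, symmetric])
    also have "\<dots> = cscale ?c (basis d)"
      unfolding pmult_composes_0[OF a\<sigma>] by (rule prod)
    finally have avd: "cscale ?c (mult (basis a) (mult (basis v) (basis d))) = cscale ?c (basis d)" .
    have "H (cscale ?c (mult (basis A0) (inc' \<tau>))) =
        cscale ?c (mult (basis a) (mult (basis v) (mult (basis d) (basis w))))"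
      unfolding H_linear H_mult[OF BB(1) \<tau>] HA0 dw by (simp only: \<tau>_def)
    also have "\<dots> = mult (cscale ?c (mult (basis a) (mult (basis v) (basis d)))) (basis w)"
      using assoc[OF mor_basis(4,9,7), of n] assoc[OF mor_basis(1) vd mor_basis(7), of n]
      by (simp add: pmult_linear)
    also have "\<dots> = H (cscale ?c (basis A))"
      unfolding avd by (simp add: pmult_linear dw H_linear H_basis[OF A])
    finally show "H (cscale ?c (mult (basis A0) (inc' \<tau>))) = H (cscale ?c (basis A))" .
  qed
  have trans: "u - u'' \<in> K" if "u - u' \<in> K" "u' - u'' \<in> K" for u u' u''
    using K_subspace(2)[OF that] by simp
  have sym: "u' - u \<in> K" if "u - u' \<in> K" for u u'
    using K_subspace(3)[OF that, of "-1"] by simp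
  \<comment> \<open>The chain of tensors modulo \<open>K\<close>: move \<open>\<rho>\<close> right,
    insert \<open>\<sigma>\<close> on the left and move it right, rewrite by \<open>e3\<close>, pull
    out the scalar, move \<open>\<tau>\<close> left, rewrite by \<open>e4\<close>.\<close>
  have "basis (basis b1, basis b2) - basis (basis A0, y) \<in> K"
    unfolding e1 y_def by (rule K_rels(5)[OF BB(1,3) mor_basis(2)])
  moreover have "basis (basis A0, y) - basis (basis A0, cscale ?c (mult (inc' \<tau>) (basis C))) \<in> K"
    using K_rels(5)[OF BB(1) y mor_basis(3)] unfolding e2 e3 .
  moreover have "basis (basis A0, cscale ?c (mult (inc' \<tau>) (basis C))) -
      cscale ?c (basis (basis A0, mult (inc' \<tau>) (basis C))) \<in> K"
    by (rule K_rels(4)[OF BB(1) tC])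
  moreover have "cscale ?c (basis (basis A0, mult (inc' \<tau>) (basis C))) -
      cscale ?c (basis (mult (basis A0) (inc' \<tau>), basis C)) \<in> K"
    using K_subspace(3)[OF sym[OF K_rels(5)[OF BB(1,5) \<tau>]], of ?c]
    by (simp only: fcomb.scale_right_diff_distrib)
  moreover have "cscale ?c (basis (mult (basis A0) (inc' \<tau>), basis C)) -
      basis (cscale ?c (basis A), basis C) \<in> K"
    unfolding e4[symmetric] by (rule sym[OF K_rels(3)[OF At BB(5)]])
  moreover have "basis (cscale ?c (basis A), basis C) - cscale ?c (basis (basis A, basis C)) \<in> K"
    by (rule K_rels(3)[OF BB(4,5)])
  ultimately show ?thesis by (meson trans)
qed

text \<open>The case left out by the normal form. Here k = 1, and the only diagram of index 1/2 is a
  single strand.\<close>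

lemma half_dgms_trivial:
  assumes M: "M = 0" and "b \<in> half_dgms s M" and "b' \<in> half_dgms s M"
  shows "b = b'"
proof -
  have s: "\<not> s" using sM M by simp
  have sat: "sat b P Q \<longleftrightarrow> (1 \<in> P \<longleftrightarrow> 1 \<in> Q)"
    if b: "b \<in> half_dgms s M" and PQ: "P \<subseteq> {1..1}" "Q \<subseteq> {1..1}" for b P Q
  proof
    have b': "b \<in> mor True 1 1" using b s M by (simp add: half_dgms_def)
    then show "sat b P Q \<Longrightarrow> (1 \<in> P \<longleftrightarrow> 1 \<in> Q)" by (rule mor_last)
    assume "1 \<in> P \<longleftrightarrow> 1 \<in> Q"
    then consider "P = {}" "Q = {}" | "P = {1..1}" "Q = {1..1}" using PQ by fastforce
    then show "sat b P Q"
    proof cases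
      case 2
      have "u \<in> rows {1..1} {1..1}" if "B \<in> b" "u \<in> B" for B u
        using mor_dgms[OF b'] that unfolding dgms_def partition_on_def by blast
      then show ?thesis using 2 unfolding sat_def closed_under_def by blast
    qed simp
  qed
  show ?thesis
  proof (rule sat_inject)
    show "b \<in> dgms 1 1" "b' \<in> dgms 1 1"
      using assms s M by (auto simp: half_dgms_def mor_def)
  qed (use sat[OF assms(2)] sat[OF assms(3)] in blast)
qed

section \<open>A linear section of the map to the ideal\<close>

lemma factorization_exists:
  assumes "d \<in> \<I>"
  shows "\<exists>A C. A \<in> half_dgms s M \<and> C \<in> half_dgms s M \<and>
    composes (Suc M) M (Suc M) (hat s M A) (flip (hat s M (flip C))) 0 d \<and>
    (1 \<le> M \<longrightarrow> (\<exists>w\<in>mor s (Suc M) M. composes (Suc M) (Suc M) M d w 0 (hat s M A)))"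
proof -
  obtain a c where ac: "a \<in> mor s (Suc M) M" "c \<in> mor s M (Suc M)"
    "composes (Suc M) M (Suc M) a c 0 d"
    "1 \<le> M \<Longrightarrow> \<exists>w\<in>mor s (Suc M) M. composes (Suc M) (Suc M) M d w 0 a"
    using rank_factorization[OF refl, of d s M] assms sM by blast
  obtain A where A: "A \<in> half_dgms s M" "hat s M A = a" using hat_surj[OF sM ac(1)] by blast
  obtain C where C: "C \<in> half_dgms s M" "hat s M C = flip c"
    using hat_surj[OF sM flip_mor[OF ac(2)]] by blast
  have "flip (hat s M (flip (flip C))) = c"
    using flip_flip_half_dgms[OF C(1)] flip_flip[OF mor_dgms[OF ac(2)]] C(2) by simp
  then show ?thesis
    using A ac flip_half_dgms[OF C(1)] by (intro exI[of _ A] exI[of _ "flip C"]) simp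
qed

text \<open>One factorization is fixed for each \<open>d\<close>, so that the normal form of a
  tensor of diagrams depends on their composite alone.\<close>

definition AC :: "diagram \<Rightarrow> diagram \<times> diagram" where
  "AC d = (SOME (A, C). A \<in> half_dgms s M \<and> C \<in> half_dgms s M \<and>
    composes (Suc M) M (Suc M) (hat s M A) (flip (hat s M (flip C))) 0 d \<and>
    (1 \<le> M \<longrightarrow> (\<exists>w\<in>mor s (Suc M) M. composes (Suc M) (Suc M) M d w 0 (hat s M A))))"

text \<open>A linear right inverse of \<open>\<Psi>\<close>. Once it is also a left inverse modulo
  \<open>K\<close>, the kernel of \<open>\<Psi>\<close> is contained in \<open>K\<close>.\<close>

definition section_map :: "comb \<Rightarrow> ((comb \<times> comb) \<Rightarrow>\<^sub>0 complex)" where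
  "section_map = lin_ext (\<lambda>d. basis (basis (fst (AC d)), basis (snd (AC d))))"

lemma AC:
  assumes "d \<in> \<I>"
  shows "fst (AC d) \<in> half_dgms s M" "snd (AC d) \<in> half_dgms s M"
    "composes (Suc M) M (Suc M) (hat s M (fst (AC d))) (flip (hat s M (flip (snd (AC d))))) 0 d"
    "1 \<le> M \<Longrightarrow> \<exists>w\<in>mor s (Suc M) M. composes (Suc M) (Suc M) M d w 0 (hat s M (fst (AC d)))"
proof -
  let ?P = "\<lambda>(A, C). A \<in> half_dgms s M \<and> C \<in> half_dgms s M \<and>
    composes (Suc M) M (Suc M) (hat s M A) (flip (hat s M (flip C))) 0 d \<and>
    (1 \<le> M \<longrightarrow> (\<exists>w\<in>mor s (Suc M) M. composes (Suc M) (Suc M) M d w 0 (hat s M A)))"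
  have "\<exists>p. ?P p" using factorization_exists[OF assms] by blast
  then have "?P (AC d)" unfolding AC_def by (rule someI_ex)
  then show "fst (AC d) \<in> half_dgms s M" "snd (AC d) \<in> half_dgms s M"
    "composes (Suc M) M (Suc M) (hat s M (fst (AC d))) (flip (hat s M (flip (snd (AC d))))) 0 d"
    "1 \<le> M \<Longrightarrow> \<exists>w\<in>mor s (Suc M) M. composes (Suc M) (Suc M) M d w 0 (hat s M (fst (AC d)))"
    unfolding case_prod_beta by blast+
qed

lemma section_map_closed: "x \<in> free_space \<I> \<Longrightarrow> section_map x \<in> \<T>"
  unfolding section_map_def by (erule lin_ext_free_space) (use AC(1,2) in auto)

lemma \<Psi>_section_map: "x \<in> free_space \<I> \<Longrightarrow> \<Psi> (section_map x) = x"
proof (induction rule: free_space_induct)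
  case (basis d)
  then show ?case
    using pmult_composes_0[OF AC(3)[OF basis]]
    by (simp add: section_map_def \<Psi>_basis H_basis[OF AC(1)] H'_basis[OF AC(2)])
qed (simp_all add: section_map_def \<Psi>_linear lin_ext_add lin_ext_cscale)

lemma section_map_linear:
  "section_map (x + y) = section_map x + section_map y"
  "section_map (cscale c x) = cscale c (section_map x)" "section_map 0 = 0"
  by (simp_all add: section_map_def lin_ext_add lin_ext_cscale)

lemma section_map_diagrams:
  assumes b1: "b1 \<in> half_dgms s M" and b2: "b2 \<in> half_dgms s M"
  shows "basis (basis b1, basis b2) - section_map (\<Psi> (basis (basis b1, basis b2))) \<in> K"
proof -
  define d where "d = diag_comp (hat s M b1) (flip (hat s M (flip b2)))"
  have d: "d \<in> \<I>"
    unfolding d_def by (intro pn_mult_le hat_mor[OF sM] flip_mor flip_half_dgms b1 b2)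
  let ?t = "basis (basis (fst (AC d)), basis (snd (AC d)))"
  obtain c where c: "basis (basis b1, basis b2) - cscale c ?t \<in> K"
  proof (cases "1 \<le> M")
    case True
    then show thesis
      using pure_tensor_normal_form[OF True b1 b2 d_def[symmetric] AC(1-3)[OF d]] AC(4)[OF d True] that
      by blast
  next
    \<comment> \<open>For M = 0 the chosen factors are the given diagrams themselves, so the scalar
      is 1.\<close>
    case False
    then have "M = 0" by simp
    then have "b1 = fst (AC d)" "b2 = snd (AC d)"
      using half_dgms_trivial b1 b2 AC(1,2)[OF d] by blast+
    then show thesis using that[of 1] K_subspace(1) by simp
  qed
  have t: "\<Psi> ?t = basis d" and g: "section_map (basis d) = ?t"
    using \<Psi>_section_map[of "basis d"] d by (simp_all add: section_map_def)
  \<comment> \<open>The scalar of the normal form need not be known: applying \<open>\<Psi>\<close>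
    to the relation shows that the image of the tensor is the same multiple of
    \<open>d\<close>.\<close>
  have "\<Psi> (basis (basis b1, basis b2)) = cscale c (basis d)"
    using \<Psi>_K[OF c] t by (simp add: \<Psi>_linear)
  then show ?thesis using c g by (simp add: section_map_linear)
qed

text \<open>In the free space \<open>basis (x, y)\<close> is not bilinear in x and y; it is so only
  modulo \<open>K\<close>. The defect \<open>E\<close> therefore satisfies each linearity step only
  up to one of the tensor relations.\<close>

lemma section_map_pure:
  assumes x: "x \<in> \<B>" and y: "y \<in> \<B>"
  shows "basis (x, y) - section_map (\<Psi> (basis (x, y))) \<in> K"
proof -
  define E where "E x y = basis (x, y) - section_map (\<Psi> (basis (x, y)))" for x y
  have add1: "E (x + x') y \<in> K" if "x \<in> \<B>" "x' \<in> \<B>" "y \<in> \<B>" "E x y \<in> K" "E x' y \<in> K" for x x' y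
  proof -
    have "E (x + x') y = (basis (x + x', y) - basis (x, y) - basis (x', y)) + (E x y + E x' y)"
      by (simp add: E_def \<Psi>_basis H_linear pmult_linear section_map_linear algebra_simps)
    then show ?thesis using K_rels(1)[OF that(1,3,2)] K_subspace(2) that(4,5) by simp
  qed
  have add2: "E x (y + y') \<in> K" if "x \<in> \<B>" "y \<in> \<B>" "y' \<in> \<B>" "E x y \<in> K" "E x y' \<in> K" for x y y'
  proof -
    have "E x (y + y') = (basis (x, y + y') - basis (x, y) - basis (x, y')) + (E x y + E x y')"
      by (simp add: E_def \<Psi>_basis H_linear pmult_linear section_map_linear algebra_simps)
    then show ?thesis using K_rels(2)[OF that(1-3)] K_subspace(2) that(4,5) by simp
  qed
  have scale1: "E (cscale c x) y \<in> K" if "x \<in> \<B>" "y \<in> \<B>" "E x y \<in> K" for c x y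
  proof -
    have "E (cscale c x) y = (basis (cscale c x, y) - cscale c (basis (x, y))) + cscale c (E x y)"
      by (simp add: E_def \<Psi>_basis H_linear pmult_linear section_map_linear
          fcomb.scale_right_diff_distrib)
    then show ?thesis using K_rels(3)[OF that(1,2)] K_subspace(2,3) that(3) by simp
  qed
  have scale2: "E x (cscale c y) \<in> K" if "x \<in> \<B>" "y \<in> \<B>" "E x y \<in> K" for c x y
  proof -
    have "E x (cscale c y) = (basis (x, cscale c y) - cscale c (basis (x, y))) + cscale c (E x y)"
      by (simp add: E_def \<Psi>_basis H_linear pmult_linear section_map_linear
          fcomb.scale_right_diff_distrib)
    then show ?thesis using K_rels(4)[OF that(1,2)] K_subspace(2,3) that(3) by simp
  qed
  \<comment> \<open>A tensor with a zero factor is a nonzero basis vector of the free space; the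
    scalar relation with scalar 0 puts it into \<open>K\<close>.\<close>
  have zero1: "E 0 y \<in> K" if "y \<in> \<B>" for y
    using K_rels(3)[of 0 y 0] that by (simp add: E_def \<Psi>_basis H_linear pmult_linear section_map_linear)
  have zero2: "E x 0 \<in> K" if "x \<in> \<B>" for x
    using K_rels(4)[of x 0 0] that by (simp add: E_def \<Psi>_basis H_linear pmult_linear section_map_linear)
  have "E x y \<in> K"
    using x
  proof (induction rule: free_space_induct)
    case (basis b1)
    note b1 = basis
    show ?case using y
    proof (induction rule: free_space_induct)
      case (basis b2)
      show ?case unfolding E_def by (rule section_map_diagrams[OF b1 basis])
    qed (use b1 in \<open>auto intro!: zero2 add2 scale2\<close>)
  qed (use y in \<open>auto intro!: zero1 add1 scale1\<close>)
  then show ?thesis by (simp add: E_def)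
qed

lemma section_map_mod_K: "z \<in> \<T> \<Longrightarrow> z - section_map (\<Psi> z) \<in> K"
proof (induction rule: free_space_induct)
  case (add z w)
  then show ?case
    using K_subspace(2)[OF add.IH] by (simp add: \<Psi>_linear section_map_linear algebra_simps)
next
  case (scale c z)
  then show ?case
    using K_subspace(3)[OF scale.IH, of c]
    by (simp add: \<Psi>_linear section_map_linear fcomb.scale_right_diff_distrib)
next
  case (basis p)
  then show ?case by (cases p) (auto simp: section_map_pure)
qed (simp add: \<Psi>_linear section_map_linear K_subspace)

text \<open>If \<open>\<Psi>\<close> vanishes on z, then so does the section term, and z itself is
  the difference that lies in \<open>K\<close>. This is the injectivity of the isomorphism.\<close>

lemma K_iff: "z \<in> \<T> \<Longrightarrow> z \<in> K \<longleftrightarrow> \<Psi> z = 0"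
  using \<Psi>_K section_map_mod_K[of z] by (auto simp: section_map_linear)

section \<open>Operations on the classes of the tensor product\<close>

lemma carr_half: "carr (partition_algebra n (k - 1/2)) = \<B>"
  by (simp add: partition_algebra_def diagrams_half)

lemma carr_pred: "carr (partition_algebra n (k - 1)) = \<R>"
  by (simp add: partition_algebra_def diagrams_pred)

text \<open>Classes become the fibres of \<open>\<Psi>\<close>, so an operation on representatives
  is well defined as soon as \<open>\<Psi>\<close> carries it to an operation on the ideal.\<close>

lemma bc_eq_iff: "(z, w) \<in> bc_eq n k \<longleftrightarrow> z \<in> \<T> \<and> w \<in> \<T> \<and> \<Psi> z = \<Psi> w"
  unfolding bc_eq_def carr_half carr_pred tensor_eq_def K_def[symmetric]
  using K_iff[OF diff_in_free_space, of z w] by (auto simp: \<Psi>_linear)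

abbreviation "cls z \<equiv> bc_eq n k `` {z}"

lemma cls_eq: "z \<in> \<T> \<Longrightarrow> cls z = {w \<in> \<T>. \<Psi> w = \<Psi> z}"
  by (auto simp: bc_eq_iff)

lemma carr_bc: "carr (basic_construction n k) = cls ` \<T>"
  unfolding basic_construction_def carr_half by (auto simp: quotient_def)

text \<open>The union over representatives that defines an operation on classes collapses to one
  term when all representatives give the same class.\<close>

lemma UN_cls:
  assumes "z \<in> \<T>" and "\<And>w. w \<in> \<T> \<Longrightarrow> \<Psi> w = \<Psi> z \<Longrightarrow> F w = F z"
  shows "(\<Union>w\<in>cls z. F w) = F z"
proof -
  have "(\<Union>w\<in>cls z. F w) = (\<Union>w\<in>cls z. F z)"
  proof (rule SUP_cong[OF refl])
    fix w assume "w \<in> cls z"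
    then have "w \<in> \<T>" "\<Psi> w = \<Psi> z" unfolding cls_eq[OF assms(1)] by blast+
    then show "F w = F z" by (rule assms(2))
  qed
  moreover have "z \<in> cls z" using assms(1) by (simp add: cls_eq)
  ultimately show ?thesis by auto
qed

lemma vadd_cls:
  assumes z: "z \<in> \<T>" and w: "w \<in> \<T>"
  shows "vadd (basic_construction n k) (cls z) (cls w) = cls (z + w)"
proof -
  have "cls (z' + w') = cls (z + w)" if "z' \<in> \<T>" "w' \<in> \<T>" "\<Psi> z' = \<Psi> z" "\<Psi> w' = \<Psi> w" for z' w'
    using that z w by (simp add: cls_eq add_in_free_space \<Psi>_linear)
  then have "(\<Union>w'\<in>cls w. cls (z' + w')) = cls (z + w)" if "z' \<in> \<T>" "\<Psi> z' = \<Psi> z" for z'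
    using that w by (subst UN_cls) simp_all
  then show ?thesis
    unfolding basic_construction_def using z by simp (subst UN_cls; simp)
qed

lemma vscale_cls:
  assumes z: "z \<in> \<T>"
  shows "vscale (basic_construction n k) c (cls z) = cls (cscale c z)"
  unfolding basic_construction_def using z
  by simp (subst UN_cls; simp add: cls_eq cscale_in_free_space \<Psi>_linear)

definition rep_mult ::
  "((comb \<times> comb) \<Rightarrow>\<^sub>0 complex) \<Rightarrow> ((comb \<times> comb) \<Rightarrow>\<^sub>0 complex) \<Rightarrow> ((comb \<times> comb) \<Rightarrow>\<^sub>0 complex)" where
  "rep_mult = bilin_ext (\<lambda>(c1, c2) (c3, c4). basis (c1, mult (inc' (eps n k (mult c2 c3))) c4))"

lemma rep_mult_linear:
  "rep_mult (x + x') y = rep_mult x y + rep_mult x' y"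
  "rep_mult x (y + y') = rep_mult x y + rep_mult x y'"
  "rep_mult (cscale c x) y = cscale c (rep_mult x y)"
  "rep_mult x (cscale c y) = cscale c (rep_mult x y)"
  "rep_mult 0 y = 0" "rep_mult x 0 = 0"
  unfolding rep_mult_def by (rule bilin_ext_linear)+

lemma rep_mult_basis:
  "rep_mult (basis (c1, c2)) (basis (c3, c4)) =
    basis (c1, mult (inc' (eps n k (mult c2 c3))) c4)"
  by (simp add: rep_mult_def bilin_ext_basis)

lemma eps_mult_closed: "x \<in> \<B> \<Longrightarrow> y \<in> \<B> \<Longrightarrow> z \<in> \<B> \<Longrightarrow> mult (inc' (eps n k (mult x y))) z \<in> \<B>"
  by (intro mult_closed_half inc'_closed eps_closed)

text \<open>In the product of two sandwiches the inner factors meet as the compression of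
  \<open>mult c2 c3\<close> between \<open>pr'\<close> and \<open>pr\<close>, which is its image
  under \<open>eps\<close>. Together with \<open>bc_eq_iff\<close> this also shows that the product
  of classes is well defined.\<close>

lemma rep_mult_closed_hom:
  assumes z: "z \<in> \<T>" and w: "w \<in> \<T>"
  shows "rep_mult z w \<in> \<T> \<and> \<Psi> (rep_mult z w) = mult (\<Psi> z) (\<Psi> w)"
  using z
proof (induction rule: free_space_induct)
  case (basis p)
  then obtain c1 c2 where p: "p = (c1, c2)" and c12: "c1 \<in> \<B>" "c2 \<in> \<B>" by auto
  show ?case using w
  proof (induction rule: free_space_induct)
    case (basis q)
    then obtain c3 c4 where q: "q = (c3, c4)" and c34: "c3 \<in> \<B>" "c4 \<in> \<B>" by auto
    have c23: "mult c2 c3 \<in> \<B>" by (rule mult_closed_half[OF c12(2) c34(1)])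
    note cl = H_closed[OF c12(1)] H'_closed[OF c12(2)] H_closed[OF c34(1)] H'_closed[OF c34(2)]
    have "mult (H' c2) (H c3) = mult pr' (mult (inc c2) (H c3))"
      unfolding H'_def by (rule assoc[OF pr_closed(2) inc_closed[OF c12(2)] cl(3)])
    also have "mult (inc c2) (H c3) = H (mult c2 c3)"
      unfolding H_def inc_mult[OF c12(2) c34(1)]
      by (rule assoc[OF inc_closed[OF c12(2)] inc_closed[OF c34(1)] pr_closed(1), symmetric])
    also have "mult pr' (H (mult c2 c3)) = eps n k (mult c2 c3)"
      by (rule eps_conditional[OF c23])
    finally have mid: "mult (H' c2) (H c3) = eps n k (mult c2 c3)" .
    have "mult (H c1) (mult (eps n k (mult c2 c3)) (H' c4)) =
        mult (H c1) (mult (H' c2) (mult (H c3) (H' c4)))"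
      unfolding mid[symmetric] assoc[OF cl(2,3,4)] ..
    also have "\<dots> = mult (mult (H c1) (H' c2)) (mult (H c3) (H' c4))"
      by (rule assoc[OF cl(1,2) pmult_mor[OF cl(3,4)], symmetric]) simp
    finally show ?case
      using eps_mult_closed[OF c12(2) c34] c12
      by (simp add: p q rep_mult_basis \<Psi>_basis H'_mult[OF c34(2) eps_closed[OF c23]])
  qed (auto simp: rep_mult_linear \<Psi>_linear pmult_linear intro: add_in_free_space cscale_in_free_space)
qed (auto simp: rep_mult_linear \<Psi>_linear pmult_linear intro: add_in_free_space cscale_in_free_space)

lemma vmult_cls:
  assumes z: "z \<in> \<T>" and w: "w \<in> \<T>"
  shows "vmult (basic_construction n k) (cls z) (cls w) = cls (rep_mult z w)"
proof -
  have "cls (rep_mult z' w') = cls (rep_mult z w)"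
    if "z' \<in> \<T>" "w' \<in> \<T>" "\<Psi> z' = \<Psi> z" "\<Psi> w' = \<Psi> w" for z' w'
    using that z w rep_mult_closed_hom by (simp add: cls_eq)
  then have "(\<Union>w'\<in>cls w. cls (rep_mult z' w')) = cls (rep_mult z w)" if "z' \<in> \<T>" "\<Psi> z' = \<Psi> z" for z'
    using that w by (subst UN_cls) simp_all
  then show ?thesis
    unfolding basic_construction_def rep_mult_def[symmetric] using z by simp (subst UN_cls; simp)
qed

definition \<Phi> :: "((comb \<times> comb) \<Rightarrow>\<^sub>0 complex) set \<Rightarrow> comb" where
  "\<Phi> X = \<Psi> (SOME z. z \<in> X)"

lemma \<Phi>_cls:
  assumes "z \<in> \<T>" shows "\<Phi> (cls z) = \<Psi> z"
proof -
  have "z \<in> cls z" using assms by (simp add: cls_eq)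
  then have "(SOME z'. z' \<in> cls z) \<in> cls z" by (rule someI)
  then show ?thesis unfolding \<Phi>_def cls_eq[OF assms] by simp
qed

lemma bij_\<Phi>: "bij_betw \<Phi> (carr (basic_construction n k)) (carr (partition_ideal n k))"
proof -
  have carr: "carr (partition_ideal n k) = free_space \<I>"
    by (simp add: partition_ideal_def ideal_diagrams_k)
  show ?thesis
    unfolding bij_betw_def carr carr_bc
  proof
    show "inj_on \<Phi> (cls ` \<T>)"
    proof (rule inj_onI)
      fix X Y assume "X \<in> cls ` \<T>" "Y \<in> cls ` \<T>" and eq: "\<Phi> X = \<Phi> Y"
      then obtain z w where zw: "z \<in> \<T>" "w \<in> \<T>" "X = cls z" "Y = cls w" by blast
      then have "\<Psi> z = \<Psi> w" using eq by (simp only: \<Phi>_cls)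
      then show "X = Y" using zw by (simp only: cls_eq)
    qed
    show "\<Phi> ` cls ` \<T> = free_space \<I>"
    proof
      show "\<Phi> ` cls ` \<T> \<subseteq> free_space \<I>" by (auto simp: \<Phi>_cls simp del: mem_Collect_eq intro: \<Psi>_closed)
      show "free_space \<I> \<subseteq> \<Phi> ` cls ` \<T>"
      proof
        fix x assume x: "x \<in> free_space \<I>"
        then have "x = \<Phi> (cls (section_map x))"
          by (simp add: \<Phi>_cls section_map_closed \<Psi>_section_map)
        then show "x \<in> \<Phi> ` cls ` \<T>" using section_map_closed[OF x] by blast
      qed
    qed
  qed
qed

lemma \<Phi>_hom:
  assumes "X \<in> carr (basic_construction n k)" and "Y \<in> carr (basic_construction n k)"
  shows "vadd (basic_construction n k) X Y \<in> carr (basic_construction n k)"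
    "vscale (basic_construction n k) c X \<in> carr (basic_construction n k)"
    "vmult (basic_construction n k) X Y \<in> carr (basic_construction n k)"
    "\<Phi> (vadd (basic_construction n k) X Y) = vadd (partition_ideal n k) (\<Phi> X) (\<Phi> Y)"
    "\<Phi> (vscale (basic_construction n k) c X) = vscale (partition_ideal n k) c (\<Phi> X)"
    "\<Phi> (vmult (basic_construction n k) X Y) = vmult (partition_ideal n k) (\<Phi> X) (\<Phi> Y)"
proof -
  obtain z w where zw: "z \<in> \<T>" "w \<in> \<T>" "X = cls z" "Y = cls w"
    using assms unfolding carr_bc by blast
  note cl = add_in_free_space[OF zw(1,2)] cscale_in_free_space[OF zw(1), of c]
    rep_mult_closed_hom[OF zw(1,2)]
  show "vadd (basic_construction n k) X Y \<in> carr (basic_construction n k)"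
    "vscale (basic_construction n k) c X \<in> carr (basic_construction n k)"
    "vmult (basic_construction n k) X Y \<in> carr (basic_construction n k)"
    unfolding zw carr_bc using zw cl by (auto simp: vadd_cls vscale_cls vmult_cls)
  show "\<Phi> (vadd (basic_construction n k) X Y) = vadd (partition_ideal n k) (\<Phi> X) (\<Phi> Y)"
    "\<Phi> (vscale (basic_construction n k) c X) = vscale (partition_ideal n k) c (\<Phi> X)"
    "\<Phi> (vmult (basic_construction n k) X Y) = vmult (partition_ideal n k) (\<Phi> X) (\<Phi> Y)"
    unfolding zw using zw cl
    by (simp_all add: vadd_cls vscale_cls vmult_cls \<Phi>_cls \<Psi>_linear partition_ideal_def
        partition_algebra_def)
qed

lemma complex_algebra_bc: "complex_algebra (basic_construction n k)"
proof (rule complex_algebra_transport[OF complex_algebra_ideal bij_\<Phi>])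
  have 0: "vzero (basic_construction n k) = cls 0" by (simp add: basic_construction_def)
  show "vzero (basic_construction n k) \<in> carr (basic_construction n k)"
    unfolding 0 carr_bc by simp
  show "\<Phi> (vzero (basic_construction n k)) = vzero (partition_ideal n k)"
    unfolding 0 by (simp add: \<Phi>_cls \<Psi>_linear partition_ideal_def partition_algebra_def)
qed (rule \<Phi>_hom; assumption)+

theorem basic_construction_iso:
  "complex_algebra (basic_construction n k) \<and>
    complex_algebra (partition_ideal n k) \<and>
    (\<forall>c1\<in>carr (partition_algebra n (k - 1/2)). \<forall>c2\<in>carr (partition_algebra n (k - 1/2)).
     \<forall>c3\<in>carr (partition_algebra n (k - 1/2)). \<forall>c4\<in>carr (partition_algebra n (k - 1/2)).
       vmult (basic_construction n k) (pure_tensor n k c1 c2) (pure_tensor n k c3 c4) =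
       pure_tensor n k c1 (pmult n (incl (k - 1/2) (eps n k (pmult n c2 c3))) c4)) \<and>
    (\<exists>\<Phi>. alg_iso (basic_construction n k) (partition_ideal n k) \<Phi> \<and>
       (\<forall>b1\<in>carr (partition_algebra n (k - 1/2)). \<forall>b2\<in>carr (partition_algebra n (k - 1/2)).
          \<Phi> (pure_tensor n k b1 b2) =
          pmult n (pmult n (incl k b1) (basis (p_diag k))) (incl k b2)))"
  unfolding carr_half
proof (intro conjI ballI exI[of _ \<Phi>])
  fix c1 c2 c3 c4 assume "c1 \<in> \<B>" "c2 \<in> \<B>" "c3 \<in> \<B>" "c4 \<in> \<B>"
  then show "vmult (basic_construction n k) (pure_tensor n k c1 c2) (pure_tensor n k c3 c4) =
      pure_tensor n k c1 (pmult n (incl (k - 1/2) (eps n k (pmult n c2 c3))) c4)"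
    unfolding pure_tensor_def by (subst vmult_cls) (simp_all add: rep_mult_basis)
next
  fix b1 b2 assume b: "b1 \<in> \<B>" "b2 \<in> \<B>"
  then show "\<Phi> (pure_tensor n k b1 b2) =
      pmult n (pmult n (incl k b1) (basis (p_diag k))) (incl k b2)"
    unfolding pure_tensor_def sandwich[OF b] by (simp add: \<Phi>_cls \<Psi>_basis)
next
  show "alg_iso (basic_construction n k) (partition_ideal n k) \<Phi>"
    unfolding alg_iso_def by (intro conjI allI ballI bij_\<Phi>; rule \<Phi>_hom; assumption)
qed (rule complex_algebra_bc complex_algebra_ideal)+

end

theorem mainTheorem2:
  fixes n :: complex and k :: real
  assumes "2 * k \<in> \<int>" and "k \<ge> 1"
  shows "complex_algebra (basic_construction n k) \<and>
    complex_algebra (partition_ideal n k) \<and>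
    (\<forall>c1\<in>carr (partition_algebra n (k - 1/2)). \<forall>c2\<in>carr (partition_algebra n (k - 1/2)).
     \<forall>c3\<in>carr (partition_algebra n (k - 1/2)). \<forall>c4\<in>carr (partition_algebra n (k - 1/2)).
       vmult (basic_construction n k) (pure_tensor n k c1 c2) (pure_tensor n k c3 c4) =
       pure_tensor n k c1 (pmult n (incl (k - 1/2) (eps n k (pmult n c2 c3))) c4)) \<and>
    (\<exists>\<Phi>. alg_iso (basic_construction n k) (partition_ideal n k) \<Phi> \<and>
       (\<forall>b1\<in>carr (partition_algebra n (k - 1/2)). \<forall>b2\<in>carr (partition_algebra n (k - 1/2)).
          \<Phi> (pure_tensor n k b1 b2) =
          pmult n (pmult n (incl k b1) (basis (p_diag k))) (incl k b2)))"
proof -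
  obtain z where z: "2 * k = of_int z" using assms(1) by (auto elim: Ints_cases)
  have "z \<ge> 2" using assms(2) z by linarith
  show ?thesis
  proof (cases "even z")
    case True
    then obtain q where q: "z = 2 * q" by (elim evenE)
    \<comment> \<open>For even z the index k equals q, so M is q - 1, which is 0 for k = 1.\<close>
    have "basic_construction_step False (nat (q - 1)) k"
      using z \<open>z \<ge> 2\<close> q by unfold_locales simp_all
    then show ?thesis by (rule basic_construction_step.basic_construction_iso)
  next
    case False
    then obtain q where q: "z = 2 * q + 1" by (elim oddE)
    \<comment> \<open>For odd z the index k is q + 1/2, and z \<ge> 2 gives q \<ge> 1, the bound on
      M that the locale demands.\<close>
    then have "basic_construction_step True (nat q) k"
      using z \<open>z \<ge> 2\<close> by unfold_locales simp_all
    then show ?thesis by (rule basic_construction_step.basic_construction_iso)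
  qed
qed

end
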